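(* Let $G$ be a finitely generated group hyperbolic relative to $\mathcal{P}=\{P_1,\dots,P_m\}$, and let $H\le G$ be a finitely generated subgroup. Assume $(G,H)\in\mathbf{SLC}_{\mathrm{subexp}}$. Then either $H$ is $s$-normal in $G$, or $H$ is parabolic (i.e. conjugate into some $P_i$), or $H$ is virtually cyclic. Moreover, if each peripheral subgroup $P_i$ is virtually nilpotent, then in the parabolic case $H$ is virtually nilpotent.
   Context: Relative hyperbolicity is in the sense of Osin and Bowditch. An infinite subgroup $H\le G$ is $s$-normal in $G$ if $H\cap gHg^{-1}$ is infinite for every $g\in G$. "Virtually cyclic" includes finite groups. Let $\ell$ be the word length on $G$ for a finite symmetric generating set. For $f\in\mathbb{C}G$, $\|f\|_{(2,1)}:=\bigl(\sum_{x\in G/H}(\sum_{g\in x}|f(g)|)^2\bigr)^{1/2}$ (sum over left cosets) and $\|f\|_h:=\sup\{\|f*\varphi\|_{(2,1)}:\varphi\in\mathbb{C}G,\ \|\varphi\|_{(2,1)}=1\}$. $(G,H)\in\mathbf{SLC}_{\mathrm{subexp}}$ means: there exist $C_h>0$ and $w:G\to[1,\infty)$ such that $\|f\|_h\le C_h\|fw\|_{(2,1)}$ for all $f\in\mathbb{C}G$ and $W(t):=\sup\{w(g):\ell(g)\le t\}$ satisfies $\lim_{t\to\infty}\frac{\log W(t)}{t}=0$. *)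

theory Defs
  imports
    "HOL-Analysis.Analysis"
    "HOL-Algebra.Group_Action"
    "HOL-Algebra.Left_Coset"
    "HOL-Algebra.Elementary_Groups"
begin

section \<open>Group-theoretic notions\<close>

definition fin_gen_group :: "('a, 'b) monoid_scheme \<Rightarrow> bool" where
  "fin_gen_group G \<longleftrightarrow> (\<exists>S. finite S \<and> S \<subseteq> carrier G \<and> generate G S = carrier G)"

definition fin_sym_gen_set :: "('a, 'b) monoid_scheme \<Rightarrow> 'a set \<Rightarrow> bool" where
  "fin_sym_gen_set G S \<longleftrightarrow>
     finite S \<and> S \<subseteq> carrier G \<and> (\<forall>s\<in>S. inv\<^bsub>G\<^esub> s \<in> S) \<and> generate G S = carrier G"

definition word_length :: "('a, 'b) monoid_scheme \<Rightarrow> 'a set \<Rightarrow> 'a \<Rightarrow> nat" where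
  "word_length G S g =
     (LEAST n. \<exists>xs. length xs = n \<and> set xs \<subseteq> S \<and> foldr (\<lambda>x y. x \<otimes>\<^bsub>G\<^esub> y) xs \<one>\<^bsub>G\<^esub> = g)"

definition conj_subgroup :: "('a, 'b) monoid_scheme \<Rightarrow> 'a \<Rightarrow> 'a set \<Rightarrow> 'a set" where
  "conj_subgroup G g H = g <#\<^bsub>G\<^esub> H #>\<^bsub>G\<^esub> (inv\<^bsub>G\<^esub> g)"

definition s_normal :: "('a, 'b) monoid_scheme \<Rightarrow> 'a set \<Rightarrow> bool" where
  "s_normal G H \<longleftrightarrow> subgroup H G \<and> infinite H \<and>
     (\<forall>g\<in>carrier G. infinite (H \<inter> conj_subgroup G g H))"

definition parabolic ::
  "('a, 'b) monoid_scheme \<Rightarrow> nat \<Rightarrow> (nat \<Rightarrow> 'a set) \<Rightarrow> 'a set \<Rightarrow> bool" where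
  "parabolic G m P H \<longleftrightarrow> (\<exists>i\<in>{1..m}. \<exists>g\<in>carrier G. H \<subseteq> conj_subgroup G g (P i))"

definition finite_index_subgroup :: "'a set \<Rightarrow> ('a, 'b) monoid_scheme \<Rightarrow> bool" where
  "finite_index_subgroup K G \<longleftrightarrow> subgroup K G \<and> finite (rcosets\<^bsub>G\<^esub> K)"

definition virtually_cyclic :: "('a, 'b) monoid_scheme \<Rightarrow> bool" where
  "virtually_cyclic G \<longleftrightarrow>
     (\<exists>K. finite_index_subgroup K G \<and> cyclic_group (G\<lparr>carrier := K\<rparr>))"

primrec lower_central :: "('a, 'b) monoid_scheme \<Rightarrow> nat \<Rightarrow> 'a set" where
  "lower_central G 0 = carrier G"
| "lower_central G (Suc n) =
     generate G (\<Union>x\<in>carrier G. \<Union>y\<in>lower_central G n.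
       {x \<otimes>\<^bsub>G\<^esub> y \<otimes>\<^bsub>G\<^esub> (inv\<^bsub>G\<^esub> x) \<otimes>\<^bsub>G\<^esub> (inv\<^bsub>G\<^esub> y)})"

definition nilpotent_group :: "('a, 'b) monoid_scheme \<Rightarrow> bool" where
  "nilpotent_group G \<longleftrightarrow> (\<exists>n. lower_central G n = {\<one>\<^bsub>G\<^esub>})"

definition virtually_nilpotent :: "('a, 'b) monoid_scheme \<Rightarrow> bool" where
  "virtually_nilpotent G \<longleftrightarrow>
     (\<exists>K. finite_index_subgroup K G \<and> nilpotent_group (G\<lparr>carrier := K\<rparr>))"


section \<open>Fine hyperbolic graphs\<close>

definition simple_graph :: "'v set \<Rightarrow> 'v set set \<Rightarrow> bool" where
  "simple_graph V E \<longleftrightarrow> (\<forall>e\<in>E. e \<subseteq> V \<and> card e = 2)"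

definition graph_walk :: "'v set \<Rightarrow> 'v set set \<Rightarrow> 'v \<Rightarrow> 'v list \<Rightarrow> 'v \<Rightarrow> bool" where
  "graph_walk V E x xs y \<longleftrightarrow> xs \<noteq> [] \<and> hd xs = x \<and> last xs = y \<and> set xs \<subseteq> V \<and>
     (\<forall>i. Suc i < length xs \<longrightarrow> {xs ! i, xs ! Suc i} \<in> E)"

definition graph_connected :: "'v set \<Rightarrow> 'v set set \<Rightarrow> bool" where
  "graph_connected V E \<longleftrightarrow> V \<noteq> {} \<and> (\<forall>x\<in>V. \<forall>y\<in>V. \<exists>xs. graph_walk V E x xs y)"

definition graph_dist :: "'v set \<Rightarrow> 'v set set \<Rightarrow> 'v \<Rightarrow> 'v \<Rightarrow> nat" where
  "graph_dist V E x y = (LEAST n. \<exists>xs. graph_walk V E x xs y \<and> length xs = Suc n)"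

text \<open>Gromov's four-point condition for the path metric on the vertex set.\<close>

definition graph_hyperbolic :: "'v set \<Rightarrow> 'v set set \<Rightarrow> bool" where
  "graph_hyperbolic V E \<longleftrightarrow> (\<exists>\<delta>::real. \<forall>x\<in>V. \<forall>y\<in>V. \<forall>z\<in>V. \<forall>u\<in>V.
     real (graph_dist V E x y + graph_dist V E z u) \<le>
       max (real (graph_dist V E x z + graph_dist V E y u))
           (real (graph_dist V E x u + graph_dist V E y z)) + 2 * \<delta>)"

text \<open>A circuit is a closed path without repeated vertices, identified with its set of edges.\<close>

definition graph_circuits :: "'v set \<Rightarrow> 'v set set \<Rightarrow> nat \<Rightarrow> 'v set set set" where
  "graph_circuits V E n = {C. C \<subseteq> E \<and> n \<ge> 3 \<and>
     (\<exists>xs. length xs = n \<and> distinct xs \<and> set xs \<subseteq> V \<and>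
        C = {{xs ! i, xs ! (Suc i mod n)} | i. i < n})}"

definition graph_fine :: "'v set \<Rightarrow> 'v set set \<Rightarrow> bool" where
  "graph_fine V E \<longleftrightarrow> (\<forall>n. \<forall>e\<in>E. finite {C \<in> graph_circuits V E n. e \<in> C})"


section \<open>Relative hyperbolicity\<close>

text \<open>
  Bowditch's definition by an action on a fine hyperbolic graph. As in Osin's definition, some
  \<open>P i\<close> may be finite: every \<open>P i\<close> is a vertex stabilizer, and the infinite vertex stabilizers
  are represented by the \<open>P i\<close> exactly once up to conjugacy. Finite vertex stabilizers need not
  occur among the \<open>P i\<close>.
\<close>

definition bowditch_graph ::
  "('a, 'b) monoid_scheme \<Rightarrow> nat \<Rightarrow> (nat \<Rightarrow> 'a set) \<Rightarrow>
   'v set \<Rightarrow> 'v set set \<Rightarrow> ('a \<Rightarrow> 'v \<Rightarrow> 'v) \<Rightarrow> bool" where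
  "bowditch_graph G m P V E \<phi> \<longleftrightarrow>
     simple_graph V E \<and> graph_connected V E \<and> graph_hyperbolic V E \<and> graph_fine V E \<and>
     group_action G V \<phi> \<and>
     (\<forall>g\<in>carrier G. \<forall>e\<in>E. \<phi> g ` e \<in> E) \<and>
     finite {{\<phi> g ` e | g. g \<in> carrier G} | e. e \<in> E} \<and>
     (\<forall>e\<in>E. finite {g \<in> carrier G. \<phi> g ` e = e}) \<and>
     (\<forall>i\<in>{1..m}. \<exists>v\<in>V. stabilizer G \<phi> v = P i) \<and>
     (\<forall>v\<in>V. infinite (stabilizer G \<phi> v) \<longrightarrow>
        (\<exists>!i. i \<in> {1..m} \<and>
           (\<exists>g\<in>carrier G. stabilizer G \<phi> v = conj_subgroup G g (P i))))"

text \<open>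
  For countable \<open>G\<close>, in particular for finitely generated \<open>G\<close>, taking the vertices in \<open>nat\<close> is
  no restriction: a connected graph with finitely many edge orbits then has countably many
  vertices.
\<close>

definition relatively_hyperbolic ::
  "('a, 'b) monoid_scheme \<Rightarrow> nat \<Rightarrow> (nat \<Rightarrow> 'a set) \<Rightarrow> bool" where
  "relatively_hyperbolic G m P \<longleftrightarrow>
     (\<exists>(V :: nat set) E \<phi>. bowditch_graph G m P V E \<phi>)"


section \<open>The group algebra and the property SLC\<close>

definition group_algebra :: "('a, 'b) monoid_scheme \<Rightarrow> ('a \<Rightarrow> complex) set" where
  "group_algebra G = {f. finite {g. f g \<noteq> 0} \<and> {g. f g \<noteq> 0} \<subseteq> carrier G}"

definition convolution ::
  "('a, 'b) monoid_scheme \<Rightarrow> ('a \<Rightarrow> complex) \<Rightarrow> ('a \<Rightarrow> complex) \<Rightarrow> 'a \<Rightarrow> complex" where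
  "convolution G f \<phi> = (\<lambda>x. if x \<in> carrier G
     then (\<Sum>y | y \<in> carrier G \<and> f y \<noteq> 0. f y * \<phi> (inv\<^bsub>G\<^esub> y \<otimes>\<^bsub>G\<^esub> x)) else 0)"

text \<open>For members of \<open>group_algebra\<close> both sums have only finitely many nonzero terms.\<close>

definition norm21 :: "('a, 'b) monoid_scheme \<Rightarrow> 'a set \<Rightarrow> ('a \<Rightarrow> complex) \<Rightarrow> real" where
  "norm21 G H f = sqrt (\<Sum>\<^sub>\<infinity>x\<in>lcosets\<^bsub>G\<^esub> H. (\<Sum>\<^sub>\<infinity>g\<in>x. cmod (f g))\<^sup>2)"

text \<open>
  For \<open>f\<close> in \<open>group_algebra\<close> this is a supremum of a nonempty set of reals bounded by the
  \<open>\<ell>\<^sup>1\<close>-norm of \<open>f\<close>, because left translation permutes the left cosets.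
\<close>

definition norm_h :: "('a, 'b) monoid_scheme \<Rightarrow> 'a set \<Rightarrow> ('a \<Rightarrow> complex) \<Rightarrow> real" where
  "norm_h G H f =
     Sup {norm21 G H (convolution G f \<phi>) | \<phi>. \<phi> \<in> group_algebra G \<and> norm21 G H \<phi> = 1}"

definition SLC_subexp ::
  "('a, 'b) monoid_scheme \<Rightarrow> 'a set \<Rightarrow> 'a set \<Rightarrow> bool" where
  "SLC_subexp G S H \<longleftrightarrow>
     (\<exists>C>0. \<exists>w :: 'a \<Rightarrow> real. (\<forall>g\<in>carrier G. 1 \<le> w g) \<and>
        (\<forall>f\<in>group_algebra G. norm_h G H f \<le> C * norm21 G H (\<lambda>g. f g * of_real (w g))) \<and>
        ((\<lambda>t::real. ln (Sup {w g | g. g \<in> carrier G \<and> real (word_length G S g) \<le> t}) / t)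
           \<longlongrightarrow> 0) at_top)"

end

theory Submission
  imports Defs
begin

text \<open>
  Suppose \<open>H\<close> is infinite and not \<open>s\<close>-normal, so that \<open>H \<inter> gHg\<^sup>-\<^sup>1\<close> is finite for some \<open>g\<close>. Testing the
  norm inequality on the indicator of \<open>Fg\<close> for finite \<open>F \<subseteq> H\<close> bounds \<open>|F|\<close> by a constant times
  \<open>W\<^sup>2\<close>; hence \<open>H\<close> has subexponential growth and contains no free subsemigroup of rank two.

  Let such an \<open>H\<close> act on the fine hyperbolic graph. By ping-pong, if \<open>H\<close> contains a loxodromic
  element, all translates of its axis by \<open>H\<close> have the same two ends, and acylindricity, a consequence
  of fineness, makes \<open>H\<close> virtually cyclic. If \<open>H\<close> contains no loxodromic element, every finite subset
  of \<open>H\<close> moves some vertex by a bounded amount, acylindricity makes the orbits of \<open>H\<close> bounded, and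
  fineness yields a fixed vertex, whose stabilizer is conjugate to a peripheral subgroup.
\<close>

section \<open>Walks and circuits in graphs\<close>

text \<open>The graph need not be locally finite, so balls cannot be counted. Fineness enters only
  as finiteness of the set of edges that share a circuit of bounded length with a given edge, and
  finitely many edge orbits make this uniform; therefore edges, not vertices, are compared. No
  boundary at infinity is built: an end is represented by the image of a base point under a large
  power, and two ends agree when their Gromov product is large. Doubled products and an integer
  hyperbolicity constant reduce the estimates to linear integer arithmetic. The absence of free
  subsemigroups is used only through the contrapositive of ping-pong: an inequality that fails there
  tells which directions fellow-travel.\<close>

fun path_edges :: "'v list \<Rightarrow> 'v set set" where
  "path_edges (x # y # zs) = insert {x, y} (path_edges (y # zs))"
| "path_edges _ = {}"

lemma path_edges_Cons: "xs \<noteq> [] \<Longrightarrow> path_edges (x # xs) = insert {x, hd xs} (path_edges xs)"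
  by (cases xs) auto

lemma path_edges_conv_nth:
  "path_edges xs = {{xs ! i, xs ! Suc i} | i. Suc i < length xs}"
proof (induction xs rule: path_edges.induct)
  case (1 x y zs)
  have "{{(x # y # zs) ! i, (x # y # zs) ! Suc i} | i. Suc i < length (x # y # zs)} =
    insert {x, y} {{(y # zs) ! i, (y # zs) ! Suc i} | i. Suc i < length (y # zs)}"
    (is "?L = insert _ ?R")
  proof (intro equalityI subsetI)
    fix e assume "e \<in> ?L"
    then obtain i where "e = {(x # y # zs) ! i, (x # y # zs) ! Suc i}" "Suc i < length (x # y # zs)"
      by blast
    then show "e \<in> insert {x, y} ?R" by (cases i) auto
  next
    fix e assume "e \<in> insert {x, y} ?R"
    then consider "e = {x, y}" | i where "e = {(y # zs) ! i, (y # zs) ! Suc i}" "Suc i < length (y # zs)"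
      by blast
    then show "e \<in> ?L"
    proof cases
      case 1
      then show ?thesis by (intro CollectI exI[of _ 0]) auto
    next
      case (2 i)
      then show ?thesis by (intro CollectI exI[of _ "Suc i"]) auto
    qed
  qed
  with 1 show ?case by simp
qed auto

lemma path_edges_append:
  "xs \<noteq> [] \<Longrightarrow> ys \<noteq> [] \<Longrightarrow>
    path_edges (xs @ ys) = path_edges xs \<union> insert {last xs, hd ys} (path_edges ys)"
  by (induction xs rule: path_edges.induct) (auto simp: path_edges_Cons)

lemma path_edges_join:
  assumes "xs \<noteq> []" "ys \<noteq> []" "last xs = hd ys"
  shows "path_edges (xs @ tl ys) = path_edges xs \<union> path_edges ys"
  using assms by (cases ys; cases "tl ys") (auto simp: path_edges_append)

lemma path_edges_rev: "path_edges (rev xs) = path_edges xs"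
proof (induction xs)
  case (Cons x xs)
  then show ?case
    by (cases "xs = []") (simp_all add: path_edges_append path_edges_Cons last_rev insert_commute)
qed simp

lemma path_edges_map: "path_edges (map f xs) = (`) f ` path_edges xs"
  by (induction xs rule: path_edges.induct) auto

lemma finite_path_edges [simp]: "finite (path_edges xs)"
  by (induction xs rule: path_edges.induct) auto

lemma card_path_edges_le: "card (path_edges xs) \<le> length xs - 1"
  by (induction xs rule: path_edges.induct) (simp_all add: card_insert_if)

lemma path_edges_subset: "e \<in> path_edges xs \<Longrightarrow> e \<subseteq> set xs"
  by (induction xs rule: path_edges.induct) auto

lemma card_path_edges_distinct: "distinct xs \<Longrightarrow> card (path_edges xs) = length xs - 1"
proof (induction xs rule: path_edges.induct)
  case (1 x y zs)
  then have "{x, y} \<notin> path_edges (y # zs)"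
    using path_edges_subset[of "{x, y}" "y # zs"] by auto
  with 1 show ?case by simp
qed auto

lemma path_edges_take: "path_edges (take n xs) \<subseteq> path_edges xs"
  by (auto simp: path_edges_conv_nth)

lemma path_edges_drop: "path_edges (drop n xs) \<subseteq> path_edges xs"
proof (cases "n = 0 \<or> n \<ge> length xs")
  case False
  then have "path_edges (take n xs @ drop n xs) =
      path_edges (take n xs) \<union> insert {last (take n xs), hd (drop n xs)} (path_edges (drop n xs))"
    by (intro path_edges_append) auto
  then show ?thesis by auto
qed auto

text \<open>Loop erasure: the piece between two visits to the same vertex is cut out until no
  repetition is left. Keeping the edges inside those of the original path is what later allows
  circuits to be extracted from closed walks.\<close>

lemma ex_distinct_path:
  assumes "xs \<noteq> []"
  obtains ys where "ys \<noteq> []" "distinct ys" "hd ys = hd xs" "last ys = last xs"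
    "set ys \<subseteq> set xs" "path_edges ys \<subseteq> path_edges xs" "length ys \<le> length xs"
  using assms
proof (induction "length xs" arbitrary: xs thesis rule: less_induct)
  case less
  show ?case
  proof (cases "distinct xs")
    case True
    with less.prems show ?thesis by blast
  next
    case False
    then obtain as x bs cs where xs: "xs = as @ [x] @ bs @ [x] @ cs"
      using not_distinct_decomp by blast
    let ?zs = "as @ [x] @ cs"
    have "path_edges (x # cs) \<subseteq> path_edges xs"
      using path_edges_drop[of "length (as @ [x] @ bs)" xs] xs by simp
    moreover have "path_edges (as @ [x]) \<subseteq> path_edges xs"
      using path_edges_take[of "length (as @ [x])" xs] xs by simp
    moreover have "path_edges ?zs = path_edges (as @ [x]) \<union> path_edges (x # cs)"
      using path_edges_join[of "as @ [x]" "x # cs"] by simp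
    ultimately have sub: "path_edges ?zs \<subseteq> path_edges xs" by blast
    have "length ?zs < length xs" "?zs \<noteq> []" using xs by auto
    from less.hyps[OF this(1) _ this(2)]
    obtain ys where "ys \<noteq> []" "distinct ys" "hd ys = hd ?zs" "last ys = last ?zs"
      "set ys \<subseteq> set ?zs" "path_edges ys \<subseteq> path_edges ?zs" "length ys \<le> length ?zs" by metis
    moreover have "hd ?zs = hd xs" "last ?zs = last xs" "set ?zs \<subseteq> set xs"
      using xs by (auto simp: hd_append last_append)
    ultimately show ?thesis
      using less.prems(1)[of ys] sub \<open>length ?zs < length xs\<close> by force
  qed
qed

text \<open>Serves to show that a path cannot cross the gap left by a deleted edge.\<close>

lemma path_edges_stays:
  assumes "xs \<noteq> []" "hd xs \<in> A" "\<And>u v. {u, v} \<in> path_edges xs \<Longrightarrow> u \<in> A \<Longrightarrow> v \<in> A"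
  shows "last xs \<in> A"
  using assms
proof (induction xs rule: path_edges.induct)
  case (1 x y zs)
  have "y \<in> A" using 1(4)[of x y] 1(3) by simp
  moreover have "v \<in> A" if "{u, v} \<in> path_edges (y # zs)" "u \<in> A" for u v
    using 1(4)[of u v] that by simp
  ultimately show ?case using 1(1) by simp
qed auto

lemma graph_walk_iff:
  "graph_walk V E x xs y \<longleftrightarrow>
    xs \<noteq> [] \<and> hd xs = x \<and> last xs = y \<and> set xs \<subseteq> V \<and> path_edges xs \<subseteq> E"
  unfolding graph_walk_def path_edges_conv_nth by auto

lemma graph_walk_join:
  assumes "graph_walk V E x xs y" "graph_walk V E y ys z"
  shows "graph_walk V E x (xs @ tl ys) z"
proof -
  have "set (tl ys) \<subseteq> set ys" by (cases ys) auto
  with assms show ?thesis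
    unfolding graph_walk_iff
    by (cases ys; cases "tl ys") (auto simp: path_edges_join path_edges_append last_append)
qed

lemma graph_walk_rev: "graph_walk V E x xs y \<Longrightarrow> graph_walk V E y (rev xs) x"
  by (auto simp: graph_walk_iff path_edges_rev hd_rev last_rev)

lemma graph_walk_take:
  assumes "graph_walk V E x xs y" "i < length xs"
  shows "graph_walk V E x (take (Suc i) xs) (xs ! i)"
  using assms path_edges_take[of "Suc i" xs] set_take_subset[of "Suc i" xs]
  by (auto simp: graph_walk_iff last_conv_nth)

lemma graph_walk_drop:
  assumes "graph_walk V E x xs y" "i < length xs"
  shows "graph_walk V E (xs ! i) (drop i xs) y"
  using assms path_edges_drop[of i xs] set_drop_subset[of i xs]
  by (auto simp: graph_walk_iff hd_drop_conv_nth)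

lemma circuit_of_path:
  assumes "graph_walk V E x q y" "distinct q" "{x, y} \<in> E" "x \<noteq> y" "{x, y} \<notin> path_edges q"
  shows "insert {x, y} (path_edges q) \<in> graph_circuits V E (length q)"
proof -
  let ?n = "length q"
  have q: "q \<noteq> []" "hd q = x" "last q = y" "set q \<subseteq> V" "path_edges q \<subseteq> E"
    using assms(1) by (auto simp: graph_walk_iff)
  \<comment> \<open>A simple path with one vertex would force \<open>x = y\<close>, and one with two
    vertices would be the edge \<open>{x, y}\<close> itself.\<close>
  have n: "?n \<ge> 3"
  proof (rule ccontr)
    assume "\<not> ?n \<ge> 3"
    then consider u where "q = [u]" | u v where "q = [u, v]"
      using q(1) by (cases q rule: path_edges.cases) (auto simp: Suc_le_eq)
    then show False by cases (use q assms in auto)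
  qed
  have "insert {x, y} (path_edges q) = {{q ! i, q ! (Suc i mod ?n)} | i. i < ?n}" (is "?L = ?R")
  proof (intro equalityI subsetI)
    fix e assume "e \<in> ?L"
    then consider "e = {x, y}" | i where "e = {q ! i, q ! Suc i}" "Suc i < ?n"
      by (auto simp: path_edges_conv_nth)
    then show "e \<in> ?R"
    proof cases
      case 1
      then have "e = {q ! (?n - 1), q ! (Suc (?n - 1) mod ?n)}"
        using q n by (auto simp: hd_conv_nth last_conv_nth)
      then show ?thesis using n by (intro CollectI exI[of _ "?n - 1"]) auto
    next
      case (2 i)
      then show ?thesis by (intro CollectI exI[of _ i]) auto
    qed
  next
    fix e assume "e \<in> ?R"
    then obtain i where i: "e = {q ! i, q ! (Suc i mod ?n)}" "i < ?n" by blast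
    show "e \<in> ?L"
    proof (cases "Suc i = ?n")
      case True
      then have "e = {x, y}" using q i by (auto simp: hd_conv_nth last_conv_nth simp flip: True)
      then show ?thesis by simp
    next
      case False
      then show ?thesis using i by (auto simp: path_edges_conv_nth)
    qed
  qed
  moreover have "insert {x, y} (path_edges q) \<subseteq> E" using q assms(3) by blast
  ultimately show ?thesis
    using q(4) assms(2) n unfolding graph_circuits_def by blast
qed

text \<open>The finite substitute for a ball in a graph that need not be locally finite. The clause
  \<open>e' = e\<close> keeps \<open>e\<close> in the set even if it lies on no circuit.\<close>

definition near_edges :: "'v set \<Rightarrow> 'v set set \<Rightarrow> nat \<Rightarrow> 'v set \<Rightarrow> 'v set set" where
  "near_edges V E n e =
    {e' \<in> E. e' = e \<or> (\<exists>k\<le>n. \<exists>C\<in>graph_circuits V E k. e \<in> C \<and> e' \<in> C)}"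

lemma near_edges_mono: "m \<le> n \<Longrightarrow> near_edges V E m e \<subseteq> near_edges V E n e"
  unfolding near_edges_def by (auto intro: order.trans)

lemma graph_circuits_subset: "C \<in> graph_circuits V E k \<Longrightarrow> C \<subseteq> E"
  by (simp add: graph_circuits_def)

lemma near_edges_circuitI:
  "C \<in> graph_circuits V E k \<Longrightarrow> k \<le> n \<Longrightarrow> e \<in> C \<Longrightarrow> e' \<in> C \<Longrightarrow> e' \<in> near_edges V E n e"
  unfolding near_edges_def using graph_circuits_subset by blast

lemma finite_near_edges:
  assumes "graph_fine V E" "e \<in> E"
  shows "finite (near_edges V E n e)"
proof -
  have C: "finite C" if "C \<in> graph_circuits V E k" for C k
  proof -
    have "\<exists>xs. C = (\<lambda>i. {xs ! i, xs ! (Suc i mod k)}) ` {i. i < k}"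
      using that by (auto simp: graph_circuits_def setcompr_eq_image)
    then show ?thesis by auto
  qed
  have "near_edges V E n e \<subseteq> insert e (\<Union>k\<in>{..n}. \<Union>{C \<in> graph_circuits V E k. e \<in> C})"
    unfolding near_edges_def by blast
  moreover have "finite (\<Union>k\<in>{..n}. \<Union>{C \<in> graph_circuits V E k. e \<in> C})"
    using assms C by (auto simp: graph_fine_def)
  ultimately show ?thesis by (meson finite_insert finite_subset)
qed

text \<open>
  Deleting an edge from a simple path leaves two pieces; going around through the other walk closes
  the edge up to a circuit, which has to use an edge of the other walk.
\<close>

lemma path_edge_near_walk:
  assumes \<gamma>: "graph_walk V E x \<gamma> y" "distinct \<gamma>" and \<alpha>: "graph_walk V E x \<alpha> y"
    and e: "e \<in> path_edges \<gamma>"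
  shows "\<exists>e'\<in>path_edges \<alpha>. e \<in> near_edges V E (length \<alpha> + length \<gamma>) e'"
proof (cases "e \<in> path_edges \<alpha>")
  case True
  then show ?thesis using \<alpha> by (auto simp: near_edges_def graph_walk_iff)
next
  case False
  obtain j where j: "e = {\<gamma> ! j, \<gamma> ! Suc j}" "Suc j < length \<gamma>"
    using e by (auto simp: path_edges_conv_nth)
  let ?u = "\<gamma> ! Suc j" and ?v = "\<gamma> ! j"
  let ?p = "drop (Suc j) \<gamma>" and ?q = "take (Suc j) \<gamma>"
  have nth_eq: "\<gamma> ! a = \<gamma> ! b \<longleftrightarrow> a = b" if "a < length \<gamma>" "b < length \<gamma>" for a b
    using that \<gamma>(2) by (simp add: nth_eq_iff_index_eq)
  have eE: "e \<in> E" using e \<gamma>(1) by (auto simp: graph_walk_iff)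
  have w1: "graph_walk V E ?u ?p y" using graph_walk_drop[OF \<gamma>(1) j(2)] .
  have w2: "graph_walk V E x ?q ?v" using graph_walk_take[OF \<gamma>(1)] j(2) by simp
  have w12: "graph_walk V E ?u (?p @ tl (rev \<alpha>)) x"
    using graph_walk_join[OF w1 graph_walk_rev[OF \<alpha>]] .
  define w where "w = (?p @ tl (rev \<alpha>)) @ tl ?q"
  have w: "graph_walk V E ?u w ?v"
    unfolding w_def using graph_walk_join[OF w12 w2] .
  have pw: "path_edges w = path_edges ?p \<union> path_edges \<alpha> \<union> path_edges ?q"
    unfolding w_def using w1 w2 w12 \<alpha>
    by (subst path_edges_join; (subst path_edges_join)?)
      (auto simp: graph_walk_iff path_edges_rev hd_rev)
  have "path_edges ?p \<subseteq> path_edges \<gamma>" "path_edges ?q \<subseteq> path_edges \<gamma>"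
    by (rule path_edges_drop path_edges_take)+
  moreover have "e \<notin> path_edges ?p"
  proof
    assume "e \<in> path_edges ?p"
    then have "?v \<in> set ?p" using path_edges_subset j by blast
    then show False using j nth_eq by (auto simp: in_set_conv_nth)
  qed
  moreover have "e \<notin> path_edges ?q"
  proof
    assume "e \<in> path_edges ?q"
    then have "?u \<in> set ?q" using path_edges_subset j by blast
    then show False using j nth_eq by (auto simp: in_set_conv_nth)
  qed
  ultimately have pw': "path_edges w \<subseteq> (path_edges \<gamma> - {e}) \<union> path_edges \<alpha>" "e \<notin> path_edges w"
    using pw False by auto
  obtain r where r: "r \<noteq> []" "distinct r" "hd r = hd w" "last r = last w"
      "set r \<subseteq> set w" "path_edges r \<subseteq> path_edges w" "length r \<le> length w"
    using ex_distinct_path[of w] w by (auto simp: graph_walk_iff)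
  have rw: "graph_walk V E ?u r ?v" using r w by (auto simp: graph_walk_iff)
  have "length w \<le> length \<alpha> + length \<gamma>" unfolding w_def using j by simp
  have "?u \<noteq> ?v" using nth_eq j by auto
  have C: "insert {?u, ?v} (path_edges r) \<in> graph_circuits V E (length r)"
    using circuit_of_path[OF rw r(2)] eE j pw'(2) r(6) \<open>?u \<noteq> ?v\<close> by (auto simp: insert_commute)
  have "\<exists>e'\<in>path_edges r. e' \<in> path_edges \<alpha>"
  proof (rule ccontr)
    assume "\<not> ?thesis"
    then have sub: "path_edges r \<subseteq> path_edges \<gamma> - {e}" using r(6) pw'(1) by blast
    \<comment> \<open>\<open>?A\<close> is the part of \<open>\<gamma>\<close> after
      \<open>e\<close>. Every edge of \<open>\<gamma>\<close> other than \<open>e\<close> has both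
      ends on the same side of \<open>e\<close>, so a path using only such edges cannot reach
      \<open>?v\<close>.\<close>
    let ?A = "{\<gamma> ! i | i. Suc j \<le> i \<and> i < length \<gamma>}"
    have "last r \<in> ?A"
    proof (rule path_edges_stays)
      show "hd r \<in> ?A" using rw j by (auto simp: graph_walk_iff)
      fix a b assume ab: "{a, b} \<in> path_edges r" "a \<in> ?A"
      then obtain i where i: "{a, b} = {\<gamma> ! i, \<gamma> ! Suc i}" "Suc i < length \<gamma>" "i \<noteq> j"
        using sub path_edges_conv_nth[of \<gamma>] j by blast
      obtain k where k: "a = \<gamma> ! k" "Suc j \<le> k" "k < length \<gamma>" using ab(2) by blast
      show "b \<in> ?A"
      proof (cases "a = \<gamma> ! i")
        case True
        then have "b = \<gamma> ! Suc i" "k = i" using i k nth_eq by (auto simp: doubleton_eq_iff)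
        then show ?thesis using i k by auto
      next
        case False
        then have "b = \<gamma> ! i" "k = Suc i" using i k nth_eq by (auto simp: doubleton_eq_iff)
        moreover have "Suc j \<le> i" using i k \<open>k = Suc i\<close> by linarith
        ultimately show ?thesis using i by auto
      qed
    qed (use r in auto)
    then show False using rw j nth_eq by (auto simp: graph_walk_iff)
  qed
  then obtain e' where e': "e' \<in> path_edges r" "e' \<in> path_edges \<alpha>" by blast
  have "e \<in> near_edges V E (length \<alpha> + length \<gamma>) e'"
    using C \<open>length w \<le> _\<close> r(7) e' j
    by (intro near_edges_circuitI[OF C]) (auto simp: insert_commute)
  then show ?thesis using e' by blast
qed

text \<open>Closing a simple path inside \<open>w\<close> through \<open>v\<close> gives a circuit
  containing both edges. The use is contrapositive: if two edges at \<open>v\<close> are not near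
  each other, every short walk between their other ends passes through \<open>v\<close>.\<close>

lemma near_edges_at_vertex:
  assumes w: "graph_walk V E u w u'" "v \<notin> set w" and e: "{v, u} \<in> E" "{v, u'} \<in> E" and v: "v \<in> V"
  shows "{v, u'} \<in> near_edges V E (Suc (length w)) {v, u}"
proof (cases "u = u'")
  case True
  then show ?thesis using e by (auto simp: near_edges_def)
next
  case False
  obtain r where r: "r \<noteq> []" "distinct r" "hd r = hd w" "last r = last w"
      "set r \<subseteq> set w" "path_edges r \<subseteq> path_edges w" "length r \<le> length w"
    using ex_distinct_path[of w] w by (auto simp: graph_walk_iff)
  let ?r = "v # r"
  have rw: "graph_walk V E v ?r u'" "distinct ?r"
    using r w e v by (auto simp: graph_walk_iff path_edges_Cons)
  have "{v, u'} \<notin> path_edges r" using path_edges_subset[of "{v, u'}" r] r(5) w(2) by auto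
  moreover have "hd r = u" using r w by (simp add: graph_walk_iff)
  ultimately have pr: "{v, u'} \<notin> path_edges ?r" "{v, u} \<in> path_edges ?r"
    using r(1) False by (auto simp: path_edges_Cons doubleton_eq_iff)
  have "u' \<in> set w" using w by (auto simp: graph_walk_iff)
  then have "v \<noteq> u'" using w by auto
  then have "insert {v, u'} (path_edges ?r) \<in> graph_circuits V E (length ?r)"
    using circuit_of_path[OF rw e(2)] pr by blast
  from near_edges_circuitI[OF this, of "Suc (length w)"] show ?thesis using pr r(7) by simp
qed

section \<open>The path metric\<close>

locale connected_graph =
  fixes V :: "'v set" and E :: "'v set set"
  assumes simple: "simple_graph V E" and connected: "graph_connected V E"
begin

abbreviation d :: "'v \<Rightarrow> 'v \<Rightarrow> nat" where "d \<equiv> graph_dist V E"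

lemma edgeD: "{x, y} \<in> E \<Longrightarrow> x \<in> V \<and> y \<in> V \<and> x \<noteq> y"
  using simple by (cases "x = y") (auto simp: simple_graph_def)

lemma ex_geodesic:
  assumes "x \<in> V" "y \<in> V"
  obtains xs where "graph_walk V E x xs y" "length xs = Suc (d x y)"
proof -
  obtain xs where xs: "graph_walk V E x xs y"
    using assms connected unfolding graph_connected_def by blast
  then have "length xs = Suc (length xs - 1)" by (cases xs) (auto simp: graph_walk_def)
  with xs have "\<exists>n xs. graph_walk V E x xs y \<and> length xs = Suc n" by blast
  then have "\<exists>xs. graph_walk V E x xs y \<and> length xs = Suc (d x y)"
    unfolding graph_dist_def by (rule LeastI_ex)
  then show ?thesis using that by blast
qed

lemma d_le: "graph_walk V E x xs y \<Longrightarrow> d x y \<le> length xs - 1"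
  unfolding graph_dist_def
  by (rule Least_le) (intro exI[of _ xs], auto simp: graph_walk_def)

lemma d_self [simp]: "x \<in> V \<Longrightarrow> d x x = 0"
  using d_le[of x "[x]" x] by (simp add: graph_walk_iff)

lemma d_eq_0: "x \<in> V \<Longrightarrow> y \<in> V \<Longrightarrow> d x y = 0 \<longleftrightarrow> x = y"
proof
  assume "x \<in> V" "y \<in> V" "d x y = 0"
  then obtain xs where "graph_walk V E x xs y" "length xs = Suc 0" using ex_geodesic by metis
  then show "x = y" by (auto simp: graph_walk_iff length_Suc_conv)
qed simp

lemma d_triangle: "x \<in> V \<Longrightarrow> y \<in> V \<Longrightarrow> z \<in> V \<Longrightarrow> d x z \<le> d x y + d y z"
proof -
  assume "x \<in> V" "y \<in> V" "z \<in> V"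
  then obtain xs ys where "graph_walk V E x xs y" "length xs = Suc (d x y)"
    "graph_walk V E y ys z" "length ys = Suc (d y z)" using ex_geodesic by metis
  then show ?thesis using d_le[OF graph_walk_join[of V E x xs y ys z]] by simp
qed

lemma d_sym: "x \<in> V \<Longrightarrow> y \<in> V \<Longrightarrow> d x y = d y x"
proof -
  have "d y x \<le> d x y" if "x \<in> V" "y \<in> V" for x y
  proof -
    obtain xs where "graph_walk V E x xs y" "length xs = Suc (d x y)"
      using ex_geodesic \<open>x \<in> V\<close> \<open>y \<in> V\<close> .
    then show ?thesis using d_le[OF graph_walk_rev] by fastforce
  qed
  then show "x \<in> V \<Longrightarrow> y \<in> V \<Longrightarrow> d x y = d y x" by (simp add: le_antisym)
qed

lemma walk_verts: "graph_walk V E x xs y \<Longrightarrow> x \<in> V \<and> y \<in> V \<and> set xs \<subseteq> V"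
  by (auto simp: graph_walk_iff)

lemma geodesic_nth:
  assumes xs: "graph_walk V E x xs y" "length xs = Suc (d x y)" and i: "i \<le> d x y"
  shows "xs ! i \<in> V" "d x (xs ! i) = i" "d (xs ! i) y = d x y - i"
proof -
  have i': "i < length xs" using xs(2) i by simp
  then show V: "xs ! i \<in> V" using walk_verts[OF xs(1)] by auto
  have "d x (xs ! i) \<le> i" using d_le[OF graph_walk_take[OF xs(1) i']] i' by simp
  moreover have "d (xs ! i) y \<le> d x y - i" using d_le[OF graph_walk_drop[OF xs(1) i']] xs(2) by simp
  moreover have "d x y \<le> d x (xs ! i) + d (xs ! i) y"
    using d_triangle V walk_verts[OF xs(1)] by blast
  ultimately show "d x (xs ! i) = i" "d (xs ! i) y = d x y - i" using i by linarith+
qed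

lemma geodesic_split:
  assumes "x \<in> V" "y \<in> V" "k \<le> d x y"
  obtains z where "z \<in> V" "d x z = k" "d z y = d x y - k"
  using assms ex_geodesic[OF assms(1,2)] geodesic_nth by metis

lemma geodesic_first_edge:
  assumes "x \<in> V" "y \<in> V" "x \<noteq> y"
  obtains u where "{x, u} \<in> E" "u \<in> V" "d x y = Suc (d u y)"
proof -
  obtain xs where xs: "graph_walk V E x xs y" "length xs = Suc (d x y)"
    using ex_geodesic assms by blast
  have pos: "1 \<le> d x y" using d_eq_0[of x y] assms by linarith
  have "xs ! 0 = x" using xs by (cases xs) (auto simp: graph_walk_def)
  moreover have "{xs ! 0, xs ! Suc 0} \<in> E" using xs pos by (auto simp: graph_walk_def)
  ultimately show ?thesis using that[of "xs ! 1"] geodesic_nth[OF xs pos] pos by simp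
qed

text \<open>The last condition shows that the geodesic avoids every vertex farther from
  \<open>y\<close> than \<open>x\<close> is.\<close>

lemma ex_geodesic_closer:
  assumes "x \<in> V" "y \<in> V"
  obtains xs where "graph_walk V E x xs y" "length xs = Suc (d x y)" "\<And>z. z \<in> set xs \<Longrightarrow> d z y \<le> d x y"
proof -
  obtain xs where xs: "graph_walk V E x xs y" "length xs = Suc (d x y)"
    using ex_geodesic assms by blast
  have "d z y \<le> d x y" if z: "z \<in> set xs" for z
  proof -
    obtain i where "z = xs ! i" "i < length xs" using z by (auto simp: in_set_conv_nth)
    then show ?thesis using geodesic_nth[OF xs, of i] xs(2) by simp
  qed
  then show ?thesis using that xs by blast
qed

end

section \<open>Actions on fine graphs\<close>

locale graph_action = connected_graph V E + group_action G V \<phi>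
  for V :: "'v set" and E and G (structure) and \<phi> +
  assumes edge_closed: "g \<in> carrier G \<Longrightarrow> e \<in> E \<Longrightarrow> \<phi> g ` e \<in> E"
begin

sublocale group G using group_hom group_hom.axioms(1) by auto

lemma act_closed [simp]: "g \<in> carrier G \<Longrightarrow> x \<in> V \<Longrightarrow> \<phi> g x \<in> V"
  using element_image by blast

lemma act_mult: "g \<in> carrier G \<Longrightarrow> h \<in> carrier G \<Longrightarrow> x \<in> V \<Longrightarrow> \<phi> (g \<otimes> h) x = \<phi> g (\<phi> h x)"
  by (rule composition_rule)

lemma act_one [simp]: "x \<in> V \<Longrightarrow> \<phi> \<one> x = x"
  using id_eq_one by (metis restrict_apply')

lemma act_inv [simp]: "g \<in> carrier G \<Longrightarrow> x \<in> V \<Longrightarrow> \<phi> (inv g) (\<phi> g x) = x"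
  using orbit_sym_aux by blast

lemma act_inv' [simp]: "g \<in> carrier G \<Longrightarrow> x \<in> V \<Longrightarrow> \<phi> g (\<phi> (inv g) x) = x"
  using act_inv[of "inv g" x] by simp

lemma edge_subset: "e \<in> E \<Longrightarrow> e \<subseteq> V"
  using simple by (auto simp: simple_graph_def)

lemma act_edge_mult:
  "g \<in> carrier G \<Longrightarrow> h \<in> carrier G \<Longrightarrow> e \<subseteq> V \<Longrightarrow> \<phi> (g \<otimes> h) ` e = \<phi> g ` \<phi> h ` e"
  unfolding image_image by (rule image_cong) (auto simp: act_mult)

lemma act_edge_inv: "g \<in> carrier G \<Longrightarrow> e \<subseteq> V \<Longrightarrow> \<phi> (inv g) ` \<phi> g ` e = e"
  unfolding image_image by (subst image_cong[OF refl, of _ _ "\<lambda>x. x"]) auto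

lemma walk_map:
  assumes "g \<in> carrier G" "graph_walk V E x xs y"
  shows "graph_walk V E (\<phi> g x) (map (\<phi> g) xs) (\<phi> g y)"
  using assms edge_closed by (auto simp: graph_walk_iff path_edges_map hd_map last_map)

lemma d_act:
  assumes "g \<in> carrier G" "x \<in> V" "y \<in> V"
  shows "d (\<phi> g x) (\<phi> g y) = d x y"
proof -
  have le: "d (\<phi> g x) (\<phi> g y) \<le> d x y" if "g \<in> carrier G" "x \<in> V" "y \<in> V" for g x y
  proof -
    obtain xs where "graph_walk V E x xs y" "length xs = Suc (d x y)"
      using ex_geodesic \<open>x \<in> V\<close> \<open>y \<in> V\<close> .
    then show ?thesis using d_le[OF walk_map[OF that(1)]] by fastforce
  qed
  show ?thesis
    using le[OF assms] le[of "inv g" "\<phi> g x" "\<phi> g y"] assms by simp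
qed

lemma act_circuit:
  assumes g: "g \<in> carrier G" and C: "C \<in> graph_circuits V E n"
  shows "(`) (\<phi> g) ` C \<in> graph_circuits V E n"
proof -
  have "C \<subseteq> E" "n \<ge> 3" using C by (auto simp: graph_circuits_def)
  moreover have "\<exists>xs. length xs = n \<and> distinct xs \<and> set xs \<subseteq> V \<and> C = {{xs ! i, xs ! (Suc i mod n)} | i. i < n}"
    using C by (simp add: graph_circuits_def)
  then obtain xs where xs: "length xs = n" "distinct xs" "set xs \<subseteq> V"
    "C = {{xs ! i, xs ! (Suc i mod n)} | i. i < n}" by (elim exE conjE) (rule that)
  let ?ys = "map (\<phi> g) xs"
  have "inj_on (\<phi> g) (set xs)" using inj_prop[OF g] xs(3) inj_on_subset by blast
  then have "distinct ?ys" using xs(2) by (simp add: distinct_map)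
  moreover have "length ?ys = n" using xs by simp
  moreover have "set ?ys \<subseteq> V" using xs g by auto
  moreover have "(`) (\<phi> g) ` C = {{?ys ! i, ?ys ! (Suc i mod n)} | i. i < n}"
  proof -
    have "\<phi> g ` {xs ! i, xs ! (Suc i mod n)} = {?ys ! i, ?ys ! (Suc i mod n)}" if "i < n" for i
      using that xs(1) by simp
    then have "(\<lambda>i. \<phi> g ` {xs ! i, xs ! (Suc i mod n)}) ` {i. i < n} =
        (\<lambda>i. {?ys ! i, ?ys ! (Suc i mod n)}) ` {i. i < n}"
      by (intro image_cong) auto
    then show ?thesis unfolding xs(4) setcompr_eq_image image_image by simp
  qed
  moreover have "(`) (\<phi> g) ` C \<subseteq> E" using \<open>C \<subseteq> E\<close> edge_closed g by auto
  ultimately show ?thesis unfolding graph_circuits_def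
    by (intro CollectI conjI exI[of _ ?ys]) auto
qed

lemma act_near_edges:
  assumes g: "g \<in> carrier G" and e: "e' \<in> near_edges V E n e"
  shows "\<phi> g ` e' \<in> near_edges V E n (\<phi> g ` e)"
proof -
  have "\<phi> g ` e' \<in> E" using e edge_closed g by (simp add: near_edges_def)
  moreover have "\<exists>k\<le>n. \<exists>C\<in>graph_circuits V E k. \<phi> g ` e \<in> C \<and> \<phi> g ` e' \<in> C" if "e' \<noteq> e"
  proof -
    obtain k C where "k \<le> n" "C \<in> graph_circuits V E k" "e \<in> C" "e' \<in> C"
      using e \<open>e' \<noteq> e\<close> by (auto simp: near_edges_def)
    moreover from this have "\<phi> g ` e \<in> (`) (\<phi> g) ` C" "\<phi> g ` e' \<in> (`) (\<phi> g) ` C" by simp_all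
    ultimately show ?thesis using act_circuit[OF g, of C k] by metis
  qed
  ultimately show ?thesis by (auto simp: near_edges_def)
qed

end

locale fine_graph_action = graph_action V E G \<phi>
  for V :: "'v set" and E and G (structure) and \<phi> +
  assumes fine: "graph_fine V E"
    and finite_edge_orbits: "finite {{\<phi> g ` e | g. g \<in> carrier G} | e. e \<in> E}"
    and finite_edge_stabilizers: "\<And>e. e \<in> E \<Longrightarrow> finite {g \<in> carrier G. \<phi> g ` e = e}"
begin

text \<open>An invariant function takes at most one value per edge orbit. This turns finiteness at
  each edge into a bound uniform over all edges.\<close>

lemma bounded_on_edges:
  fixes f :: "'v set \<Rightarrow> nat"
  assumes inv: "\<And>g e. g \<in> carrier G \<Longrightarrow> e \<in> E \<Longrightarrow> f (\<phi> g ` e) = f e"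
  obtains N where "\<And>e. e \<in> E \<Longrightarrow> f e \<le> N"
proof -
  let ?O = "{{\<phi> g ` e | g. g \<in> carrier G} | e. e \<in> E}"
  have "f ` E \<subseteq> (\<lambda>X. f (SOME e. e \<in> X)) ` ?O"
  proof
    fix k assume "k \<in> f ` E"
    then obtain e where e: "e \<in> E" "k = f e" by blast
    let ?X = "{\<phi> g ` e | g. g \<in> carrier G}"
    have "\<phi> \<one> ` e \<in> ?X" by blast
    then have "(SOME e. e \<in> ?X) \<in> ?X" by (rule someI)
    then have "f (SOME e. e \<in> ?X) = k" using inv e by auto
    then show "k \<in> (\<lambda>X. f (SOME e. e \<in> X)) ` ?O" using e by blast
  qed
  then have "finite (f ` E)" using finite_edge_orbits finite_surj by blast
  then show ?thesis using that[of "Max (f ` E)"] by simp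
qed

lemma near_edges_bound:
  obtains N where "\<And>e. e \<in> E \<Longrightarrow> finite (near_edges V E n e) \<and> card (near_edges V E n e) \<le> N"
proof -
  have le: "card (near_edges V E n e) \<le> card (near_edges V E n (\<phi> g ` e))"
    if "g \<in> carrier G" "e \<in> E" for g e
  proof (rule card_inj_on_le)
    show "(`) (\<phi> g) ` near_edges V E n e \<subseteq> near_edges V E n (\<phi> g ` e)"
      using act_near_edges that by blast
    show "finite (near_edges V E n (\<phi> g ` e))"
      using finite_near_edges fine edge_closed that by blast
    show "inj_on ((`) (\<phi> g)) (near_edges V E n e)"
      by (rule inj_on_inverseI[of _ "(`) (\<phi> (inv g))"])
        (use act_edge_inv that edge_subset in \<open>auto simp: near_edges_def\<close>)
  qed
  have "card (near_edges V E n (\<phi> g ` e)) = card (near_edges V E n e)"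
    if "g \<in> carrier G" "e \<in> E" for g e
    using le[OF that] le[of "inv g" "\<phi> g ` e"] that edge_closed act_edge_inv edge_subset
    by fastforce
  then obtain N where "\<And>e. e \<in> E \<Longrightarrow> card (near_edges V E n e) \<le> N"
    using bounded_on_edges[of "\<lambda>e. card (near_edges V E n e)"] by blast
  then show ?thesis using that finite_near_edges fine by blast
qed

text \<open>A nonempty set of elements carrying \<open>e\<close> to \<open>e'\<close> is a coset of
  the stabilizer of \<open>e\<close>, and stabilizers of edges in one orbit are conjugate; so
  finitely many stabilizers decide the bound.\<close>

lemma transporter_bound:
  obtains N where "\<And>e e'. e \<in> E \<Longrightarrow>
    finite {g \<in> carrier G. \<phi> g ` e = e'} \<and> card {g \<in> carrier G. \<phi> g ` e = e'} \<le> N"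
proof -
  let ?T = "\<lambda>e e'. {g \<in> carrier G. \<phi> g ` e = e'}"
  have tr: "finite (?T e e') \<and> card (?T e e') \<le> card (?T e e)" if e: "e \<in> E" for e e'
  proof (cases "?T e e' = {}")
    case True
    show ?thesis unfolding True by simp
  next
    case False
    then obtain h where h: "h \<in> carrier G" "\<phi> h ` e = e'" by blast
    have inj: "inj_on (\<lambda>g. inv h \<otimes> g) (?T e e')"
      using h by (auto simp: inj_on_def)
    have sub: "(\<lambda>g. inv h \<otimes> g) ` ?T e e' \<subseteq> ?T e e"
    proof (intro image_subsetI CollectI conjI)
      fix g assume "g \<in> ?T e e'"
      then have g: "g \<in> carrier G" "\<phi> g ` e = \<phi> h ` e" using h by auto
      then show "inv h \<otimes> g \<in> carrier G" using h by simp
      show "\<phi> (inv h \<otimes> g) ` e = e"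
        using act_edge_mult[of "inv h" g e] act_edge_inv[of h e] g h(1) edge_subset[OF e] by simp
    qed
    show ?thesis
      using inj_on_finite[OF inj sub finite_edge_stabilizers[OF e]]
        card_inj_on_le[OF inj sub finite_edge_stabilizers[OF e]] by simp
  qed
  have le: "card (?T e e) \<le> card (?T (\<phi> g ` e) (\<phi> g ` e))" if "g \<in> carrier G" "e \<in> E" for g e
  proof (rule card_inj_on_le)
    show "inj_on (\<lambda>h. g \<otimes> h \<otimes> inv g) (?T e e)"
    proof (rule inj_onI)
      fix h k assume "h \<in> ?T e e" "k \<in> ?T e e" and eq: "g \<otimes> h \<otimes> inv g = g \<otimes> k \<otimes> inv g"
      then have hk: "h \<in> carrier G" "k \<in> carrier G" by auto
      then have "g \<otimes> h = g \<otimes> k"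
        using right_cancel[of "inv g" "g \<otimes> h" "g \<otimes> k"] eq that(1) by blast
      then show "h = k" using that(1) hk by simp
    qed
    show "(\<lambda>h. g \<otimes> h \<otimes> inv g) ` ?T e e \<subseteq> ?T (\<phi> g ` e) (\<phi> g ` e)"
    proof (intro image_subsetI CollectI conjI)
      fix h assume h: "h \<in> ?T e e"
      then show "g \<otimes> h \<otimes> inv g \<in> carrier G" using that by simp
      have "\<phi> (g \<otimes> h \<otimes> inv g) ` \<phi> g ` e = \<phi> (g \<otimes> h) ` \<phi> (inv g) ` \<phi> g ` e"
        using that h edge_subset[OF edge_closed[OF that]] by (intro act_edge_mult) auto
      also have "\<dots> = \<phi> g ` \<phi> h ` e"
        using that h edge_subset[OF that(2)] by (simp add: act_edge_inv act_edge_mult)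
      finally show "\<phi> (g \<otimes> h \<otimes> inv g) ` \<phi> g ` e = \<phi> g ` e" using h by simp
    qed
    show "finite (?T (\<phi> g ` e) (\<phi> g ` e))"
      using finite_edge_stabilizers edge_closed that by blast
  qed
  have "card (?T (\<phi> g ` e) (\<phi> g ` e)) = card (?T e e)" if "g \<in> carrier G" "e \<in> E" for g e
  proof -
    have "\<phi> (inv g) ` \<phi> g ` e = e" using that act_edge_inv edge_subset by blast
    then show ?thesis using le[OF that] le[of "inv g" "\<phi> g ` e"] that edge_closed by simp
  qed
  then obtain N where "\<And>e. e \<in> E \<Longrightarrow> card (?T e e) \<le> N"
    using bounded_on_edges[of "\<lambda>e. card (?T e e)"] by blast
  then show ?thesis using that[of N] tr order.trans by blast
qed

end

lemma card_UN_bound: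
  assumes "finite I" "card I \<le> n" "\<And>i. i \<in> I \<Longrightarrow> finite (A i) \<and> card (A i) \<le> (m::nat)"
  shows "finite (\<Union>i\<in>I. A i) \<and> card (\<Union>i\<in>I. A i) \<le> n * m"
proof
  show "finite (\<Union>i\<in>I. A i)" using assms by blast
  have "card (\<Union>i\<in>I. A i) \<le> (\<Sum>i\<in>I. card (A i))" using card_UN_le assms(1) by blast
  also have "\<dots> \<le> (\<Sum>i\<in>I. m)" using assms(3) by (intro sum_mono) blast
  also have "\<dots> \<le> n * m" using assms(2) by simp
  finally show "card (\<Union>i\<in>I. A i) \<le> n * m" .
qed

section \<open>Bounded orbits and fixed vertices\<close>

text \<open>A pigeonhole argument in place of local finiteness. If the geodesics from
  \<open>x\<close> to points of \<open>A\<close> use infinitely many first edges, then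
  \<open>v = x\<close>; otherwise infinitely many points share a first edge, and the argument moves
  to its far end with \<open>n\<close> lowered by one.\<close>

lemma (in connected_graph) bounded_infinite_set_branches:
  assumes "infinite A" "A \<subseteq> V" "x \<in> V" "\<And>a. a \<in> A \<Longrightarrow> d x a \<le> n"
  shows "\<exists>v\<in>V. \<exists>A'\<subseteq>A. \<exists>u. infinite A' \<and> inj_on u A' \<and>
    (\<forall>a\<in>A'. {v, u a} \<in> E \<and> d v a = Suc (d (u a) a) \<and> d v a \<le> n)"
  using assms
proof (induction n arbitrary: x A)
  case 0
  then have "A \<subseteq> {x}" using d_eq_0 by fastforce
  then show ?case using 0 finite_subset by blast
next
  case (Suc n)
  let ?A = "A - {x}"
  have inf: "infinite ?A" using Suc.prems by simp
  have "\<exists>u. {x, u} \<in> E \<and> u \<in> V \<and> d x a = Suc (d u a)" if "a \<in> ?A" for a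
    using geodesic_first_edge[of x a] that Suc.prems by blast
  then obtain u where u: "\<And>a. a \<in> ?A \<Longrightarrow> {x, u a} \<in> E \<and> u a \<in> V \<and> d x a = Suc (d (u a) a)"
    by metis
  show ?case
  proof (cases "finite (u ` ?A)")
    case True
    then obtain a0 where a0: "a0 \<in> ?A" "infinite {a \<in> ?A. u a = u a0}"
      using pigeonhole_infinite[OF inf] by blast
    have "\<exists>v\<in>V. \<exists>A'\<subseteq>{a \<in> ?A. u a = u a0}. \<exists>u. infinite A' \<and> inj_on u A' \<and>
        (\<forall>a\<in>A'. {v, u a} \<in> E \<and> d v a = Suc (d (u a) a) \<and> d v a \<le> n)"
    proof (rule Suc.IH[OF a0(2)])
      show "d (u a0) a \<le> n" if "a \<in> {a \<in> ?A. u a = u a0}" for a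
      proof -
        have "d x a = Suc (d (u a0) a)" using u[of a] that by auto
        moreover have "d x a \<le> Suc n" using Suc.prems that by blast
        ultimately show ?thesis by simp
      qed
    qed (use u a0 Suc.prems in auto)
    then obtain v A' u' where v: "v \<in> V" "A' \<subseteq> {a \<in> ?A. u a = u a0}" "infinite A'" "inj_on u' A'"
      "\<forall>a\<in>A'. {v, u' a} \<in> E \<and> d v a = Suc (d (u' a) a) \<and> d v a \<le> n" by blast
    show ?thesis
      using v le_SucI by (intro bexI[OF _ v(1)] exI[of _ A'] conjI exI[of _ u']) auto
  next
    case False
    \<comment> \<open>One point is kept for each first edge, so that \<open>u\<close> becomes
      injective.\<close>
    obtain A' where A': "A' \<subseteq> ?A" "inj_on u A'" "u ` ?A = u ` A'"
      using subset_image_inj[of "u ` ?A" u ?A] by blast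
    have "infinite A'" using False A'(3) by auto
    then show ?thesis
      using A' u Suc.prems by (intro bexI[OF _ Suc.prems(3)] exI[of _ A'] conjI exI[of _ u]) auto
  qed
qed

text \<open>A walk avoiding \<open>v\<close> could be prolonged by geodesics from \<open>u\<close>
  to \<open>a\<close> and from \<open>b\<close> to \<open>u'\<close>, which avoid \<open>v\<close>
  too because \<open>v\<close> is farther from \<open>a\<close> than \<open>u\<close> is, and
  farther from \<open>b\<close> than \<open>u'\<close> is. Then \<open>near_edges_at_vertex\<close>
  would make the two edges near.\<close>

lemma (in connected_graph) separated_pair:
  assumes e: "{v, u} \<in> E" "{v, u'} \<in> E" and ab: "a \<in> V" "b \<in> V"
    and d: "d v a = Suc (d u a)" "d v b = Suc (d u' b)" "d v a \<le> D" "d v b \<le> D"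
    and sep: "{v, u'} \<notin> near_edges V E (Suc (4 * D)) {v, u}"
    and w: "graph_walk V E a w b" "length w \<le> Suc (2 * D)"
  shows "v \<in> set w"
proof (rule ccontr)
  assume nin: "v \<notin> set w"
  have V: "v \<in> V" "u \<in> V" "u' \<in> V" using e edgeD by blast+
  obtain p where p: "graph_walk V E u p a" "length p = Suc (d u a)"
    "\<And>z. z \<in> set p \<Longrightarrow> d z a \<le> d u a" using ex_geodesic_closer V ab by metis
  obtain q where q: "graph_walk V E u' q b" "length q = Suc (d u' b)"
    "\<And>z. z \<in> set q \<Longrightarrow> d z b \<le> d u' b" using ex_geodesic_closer V ab by metis
  let ?r = "(p @ tl w) @ tl (rev q)"
  have r: "graph_walk V E u ?r u'"
    by (rule graph_walk_join[OF graph_walk_join[OF p(1) w(1)] graph_walk_rev[OF q(1)]])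
  have "v \<notin> set p" using p(3)[of v] d(1) by auto
  moreover have "v \<notin> set q" using q(3)[of v] d(2) by auto
  moreover have "set (tl w) \<subseteq> set w" by (cases w) auto
  moreover have "set (tl (rev q)) \<subseteq> set q" by (cases "rev q") (auto simp flip: set_rev[of q])
  ultimately have "v \<notin> set ?r" using nin by auto
  from near_edges_at_vertex[OF r this e V(1)]
  have "{v, u'} \<in> near_edges V E (Suc (length ?r)) {v, u}" .
  \<comment> \<open>\<open>p\<close> and \<open>q\<close> have at most \<open>D\<close> vertices
    each and \<open>w\<close> at most \<open>2 * D + 1\<close>.\<close>
  moreover have "Suc (length ?r) \<le> Suc (4 * D)"
    using p(2) q(2) d w(2) by simp
  ultimately show False using sep near_edges_mono by blast
qed

context fine_graph_action
begin

lemma orbit_dist: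
  assumes "subgroup H G" "h \<in> H" "k \<in> H" "x \<in> V" "y \<in> V"
  shows "d (\<phi> h x) (\<phi> k y) = d x (\<phi> (inv h \<otimes> k) y)" "inv h \<otimes> k \<in> H"
proof -
  interpret H: subgroup H G by fact
  have c: "h \<in> carrier G" "k \<in> carrier G" using assms by auto
  show "d (\<phi> h x) (\<phi> k y) = d x (\<phi> (inv h \<otimes> k) y)"
    using d_act[of "inv h" "\<phi> h x" "\<phi> k y"] c assms(4,5) by (simp add: act_mult)
  show "inv h \<otimes> k \<in> H" using assms by auto
qed

text \<open>
  If \<open>x\<close> minimizes the diameter \<open>D\<close> of its orbit and \<open>D > 0\<close>, fineness provides a vertex \<open>v\<close>
  through which all short walks between two orbit points \<open>a\<close>, \<open>b\<close> must pass. The orbit of \<open>v\<close>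
  then has smaller diameter.
\<close>

lemma bounded_orbit_separating_vertex:
  assumes H: "subgroup H G" "infinite H" and x: "x \<in> V"
    and bd: "\<forall>h\<in>H. d x (\<phi> h x) \<le> D" and nf: "h0 \<in> H" "\<phi> h0 x \<noteq> x"
  shows "\<exists>v\<in>V. \<exists>a\<in>(\<lambda>h. \<phi> h x) ` H. \<exists>b\<in>(\<lambda>h. \<phi> h x) ` H. a \<noteq> v \<and> b \<noteq> v \<and>
    (\<forall>w. graph_walk V E a w b \<longrightarrow> length w \<le> Suc (2 * D) \<longrightarrow> v \<in> set w)"
proof -
  interpret H: subgroup H G by fact
  let ?O = "(\<lambda>h. \<phi> h x) ` H"
  have OV: "?O \<subseteq> V" using x by auto
  show ?thesis
  proof (cases "finite ?O")
    case False
    \<comment> \<open>An infinite bounded orbit branches at some vertex \<open>v\<close>. Infinitely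
      many edges lead from \<open>v\<close> towards orbit points, but only finitely many of them are
      near the one towards \<open>a\<close>; any other gives \<open>b\<close>.\<close>
    have "\<And>a. a \<in> ?O \<Longrightarrow> d x a \<le> D" using bd by auto
    from bounded_infinite_set_branches[OF False OV x this]
    obtain v A u where v: "v \<in> V" "A \<subseteq> ?O" "infinite A" "inj_on u A"
      and u: "\<And>a. a \<in> A \<Longrightarrow> {v, u a} \<in> E \<and> d v a = Suc (d (u a) a) \<and> d v a \<le> D" by blast
    obtain a where a: "a \<in> A" using v(3) by fastforce
    have "inj_on (\<lambda>b. {v, u b}) A"
      using v(4) by (auto simp: inj_on_def doubleton_eq_iff)
    then have "infinite ((\<lambda>b. {v, u b}) ` A)" using v(3) finite_imageD by blast
    moreover have "finite (near_edges V E (Suc (4 * D)) {v, u a})"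
      using finite_near_edges fine u a by blast
    ultimately obtain b where b: "b \<in> A" "{v, u b} \<notin> near_edges V E (Suc (4 * D)) {v, u a}"
      by (meson finite_subset image_subsetI)
    have sep: "v \<in> set w" if "graph_walk V E a w b" "length w \<le> Suc (2 * D)" for w
    proof (rule separated_pair[OF _ _ _ _ _ _ _ _ _ that])
      show "a \<in> V" "b \<in> V" using a b(1) v(2) OV by auto
    qed (use u[OF a] u[OF b(1)] b(2) in simp_all)
    have "a \<noteq> v" "b \<noteq> v" using u[OF a] u[OF b(1)] v(1) by auto
    moreover have "a \<in> ?O" "b \<in> ?O" using v(2) a b(1) by auto
    ultimately show ?thesis using v(1) sep by metis
  next
    case True
    \<comment> \<open>A finite orbit of the infinite group \<open>H\<close> has an infinite point
      stabilizer \<open>?K\<close>. Here \<open>v = x\<close>: edge stabilizers being finite, some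
      \<open>k\<close> in \<open>?K\<close> carries the first edge towards \<open>?y\<close> outside
      the finite set of edges near it.\<close>
    let ?K = "{h \<in> H. \<phi> h x = x}"
    have "infinite ?K"
    proof
      assume fin: "finite ?K"
      obtain h1 where h1: "h1 \<in> H" "infinite {h \<in> H. \<phi> h x = \<phi> h1 x}"
        using pigeonhole_infinite[OF H(2) True] by blast
      have "(\<lambda>h. inv h1 \<otimes> h) ` {h \<in> H. \<phi> h x = \<phi> h1 x} \<subseteq> ?K"
        using h1(1) x by (auto simp: act_mult)
      moreover have "inj_on (\<lambda>h. inv h1 \<otimes> h) {h \<in> H. \<phi> h x = \<phi> h1 x}"
        using h1(1) by (auto simp: inj_on_def)
      ultimately show False using fin h1(2) inj_on_finite by blast
    qed
    let ?y = "\<phi> h0 x"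
    have y: "?y \<in> V" using nf x by simp
    obtain u where u: "{x, u} \<in> E" "u \<in> V" "d x ?y = Suc (d u ?y)"
      using geodesic_first_edge[OF x y] nf(2) by metis
    let ?n = "near_edges V E (Suc (4 * D)) {x, u}"
    have fin: "finite ?n" using finite_near_edges fine u by blast
    obtain N where "\<And>e e'. e \<in> E \<Longrightarrow> finite {g \<in> carrier G. \<phi> g ` e = e'} \<and>
        card {g \<in> carrier G. \<phi> g ` e = e'} \<le> N"
      using transporter_bound by blast
    then have "finite (\<Union>e\<in>?n. {g \<in> carrier G. \<phi> g ` {x, u} = e})"
      using u fin by blast
    then obtain k where k: "k \<in> ?K" "k \<notin> (\<Union>e\<in>?n. {g \<in> carrier G. \<phi> g ` {x, u} = e})"
      using \<open>infinite ?K\<close> by (meson finite_subset subsetI)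
    then have kG: "k \<in> carrier G" "\<phi> k x = x" "k \<in> H" by auto
    have e: "\<phi> k ` {x, u} = {x, \<phi> k u}" using kG by simp
    then have n: "{x, \<phi> k u} \<notin> ?n" using k(2) kG(1) by blast
    have eE: "{x, \<phi> k u} \<in> E" using edge_closed[OF kG(1) u(1)] e by simp
    let ?b = "\<phi> k ?y"
    have bV: "?b \<in> V" using y kG by simp
    have db: "d x ?b = Suc (d (\<phi> k u) ?b)"
      using d_act[OF kG(1) x y] d_act[OF kG(1) u(2) y] u(3) kG(2) by simp
    have bO: "?b = \<phi> (k \<otimes> h0) x" using kG nf x by (simp add: act_mult)
    have "k \<otimes> h0 \<in> H" using kG nf by simp
    then have "d x ?b \<le> D" using bd bO by simp
    have sep: "x \<in> set w" if "graph_walk V E ?y w ?b" "length w \<le> Suc (2 * D)" for w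
      using separated_pair[OF u(1) eE y bV u(3) db bspec[OF bd nf(1)] \<open>d x ?b \<le> D\<close> n that] .
    have "?b \<noteq> x" using db x by (metis d_self Zero_not_Suc)
    moreover have "?y \<in> ?O" "?b \<in> ?O" using nf(1) bO \<open>k \<otimes> h0 \<in> H\<close> by auto
    ultimately show ?thesis using x nf(2) sep by metis
  qed
qed

lemma bounded_orbit_fixed_vertex:
  assumes H: "subgroup H G" "infinite H" and "x0 \<in> V" "\<And>h. h \<in> H \<Longrightarrow> d x0 (\<phi> h x0) \<le> D0"
  shows "\<exists>v\<in>V. \<forall>h\<in>H. \<phi> h v = v"
proof -
  interpret H: subgroup H G by fact
  let ?P = "\<lambda>D. \<exists>x\<in>V. \<forall>h\<in>H. d x (\<phi> h x) \<le> D"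
  define D where "D = (LEAST D. ?P D)"
  have "?P D0" using assms by blast
  then have "?P D" unfolding D_def by (rule LeastI)
  then obtain x where x: "x \<in> V" "\<forall>h\<in>H. d x (\<phi> h x) \<le> D" by blast
  have least: "\<not> ?P D'" if "D' < D" for D' using that not_less_Least unfolding D_def by blast
  have "\<phi> h0 x = x" if h0: "h0 \<in> H" for h0
  proof (rule ccontr)
    assume moved: "\<phi> h0 x \<noteq> x"
    obtain v a b where v: "v \<in> V" "a \<in> (\<lambda>h. \<phi> h x) ` H" "b \<in> (\<lambda>h. \<phi> h x) ` H" "a \<noteq> v" "b \<noteq> v"
      and sep: "\<And>w. graph_walk V E a w b \<Longrightarrow> length w \<le> Suc (2 * D) \<Longrightarrow> v \<in> set w"
      using bounded_orbit_separating_vertex[OF H x h0 moved] by (elim bexE conjE) simp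
    have abV: "a \<in> V" "b \<in> V" using v x by auto
    \<comment> \<open>The detour from \<open>a\<close> to \<open>b\<close> through \<open>y\<close>
      is short enough to be forced through \<open>v\<close>. As \<open>v\<close> differs from
      \<open>a\<close> and \<open>b\<close>, it lies strictly before the end of one of the two
      geodesics, hence closer to \<open>y\<close> than that end.\<close>
    have key: "Suc (d y v) \<le> D'" if y: "y \<in> V" "d y a \<le> D'" "d y b \<le> D'" and "D' \<le> D" for y D'
    proof -
      obtain p where p: "graph_walk V E y p a" "length p = Suc (d y a)" using ex_geodesic y abV by blast
      obtain q where q: "graph_walk V E y q b" "length q = Suc (d y b)" using ex_geodesic y abV by blast
      have "v \<in> set (rev p @ tl q)"
        by (rule sep[OF graph_walk_join[OF graph_walk_rev[OF p(1)] q(1)]]) (use p q that in simp)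
      moreover have "set (tl q) \<subseteq> set q" by (cases q) auto
      ultimately have "v \<in> set p \<or> v \<in> set q" by auto
      moreover have *: "Suc (d y v) \<le> d y c"
        if r: "graph_walk V E y r c" "length r = Suc (d y c)" "v \<in> set r" and c: "c \<in> V" "c \<noteq> v" for r c
      proof -
        obtain i where i: "v = r ! i" "i < length r" using r(3) by (auto simp: in_set_conv_nth)
        have i': "i \<le> d y c" using i r(2) by simp
        have "d v c \<noteq> 0" using d_eq_0 v c by blast
        then show ?thesis using geodesic_nth[OF r(1,2) i'] i(1) i' by simp
      qed
      ultimately have "Suc (d y v) \<le> d y a \<or> Suc (d y v) \<le> d y b"
        using *[of p a] *[of q b] p q v(4,5) abV by blast
      then show ?thesis using y by linarith
    qed
    have ab: "\<exists>k\<in>H. a = \<phi> k x" "\<exists>k\<in>H. b = \<phi> k x" using v by blast+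
    have 0: "d (\<phi> h x) (\<phi> k x) \<le> D" if "h \<in> H" "k \<in> H" for h k
      unfolding orbit_dist(1)[OF H(1) that x(1) x(1)] using x(2) orbit_dist(2)[OF H(1) that x(1) x(1)] by blast
    have 1: "Suc (d (\<phi> h x) v) \<le> D" if "h \<in> H" for h
    proof (rule key)
      show "d (\<phi> h x) a \<le> D" "d (\<phi> h x) b \<le> D"
        using ab 0[OF that] by auto
    qed (use that x in auto)
    have 2: "d (\<phi> h v) (\<phi> k x) \<le> D - 1" if "h \<in> H" "k \<in> H" for h k
    proof -
      have k: "inv h \<otimes> k \<in> H" by (rule orbit_dist(2)[OF H(1) that v(1) x(1)])
      then have "\<phi> (inv h \<otimes> k) x \<in> V" using x(1) by simp
      then show ?thesis
        unfolding orbit_dist(1)[OF H(1) that v(1) x(1)] using 1[OF k] d_sym[of v] v(1) by fastforce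
    qed
    \<comment> \<open>\<open>key\<close> is used a second time, with translates of \<open>v\<close>
      in place of orbit points of \<open>x\<close>; each use gains one, so the displacements of
      \<open>v\<close> stay below \<open>D\<close>.\<close>
    have "Suc (d (\<phi> h v) v) \<le> D - 1" if "h \<in> H" for h
      by (rule key) (use ab 2 that v in auto)
    then have "d v (\<phi> h v) \<le> D - 1" if "h \<in> H" for h
      using that d_sym[of v "\<phi> h v"] v(1) by fastforce
    moreover have "D - 1 < D" using 1[OF h0] by simp
    ultimately show False using least[of "D - 1"] v(1) by blast
  qed
  then show ?thesis using x by blast
qed

end

section \<open>Hyperbolicity and acylindricity\<close>

locale hyperbolic_graph_action = fine_graph_action V E G \<phi>
  for V :: "'v set" and E and G (structure) and \<phi> +
  fixes \<Delta> :: nat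
  assumes four_point: "x \<in> V \<Longrightarrow> y \<in> V \<Longrightarrow> z \<in> V \<Longrightarrow> u \<in> V \<Longrightarrow>
      d x y + d z u \<le> max (d x z + d y u) (d x u + d y z) + \<Delta>"
    and \<Delta>_pos: "1 \<le> \<Delta>"
begin

text \<open>The four-point inequality for \<open>z\<close>, \<open>\<phi> g z\<close>,
  \<open>x\<close>, \<open>y\<close>: each of the two competing sums is at most
  \<open>d x y + L\<close>.\<close>

lemma displacement_along_geodesic:
  assumes g: "g \<in> carrier G" and V: "x \<in> V" "y \<in> V" "z \<in> V"
    and z: "d x z + d z y = d x y" and L: "d x (\<phi> g x) \<le> L" "d y (\<phi> g y) \<le> L"
  shows "d z (\<phi> g z) \<le> L + \<Delta>"
proof -
  have V': "\<phi> g x \<in> V" "\<phi> g y \<in> V" "\<phi> g z \<in> V" using g V by auto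
  have "d z (\<phi> g z) + d x y \<le> max (d z x + d (\<phi> g z) y) (d z y + d (\<phi> g z) x) + \<Delta>"
    using four_point[of z "\<phi> g z" x y] V V' by simp
  moreover have "d (\<phi> g z) y \<le> d z y + L"
    using d_triangle[of "\<phi> g z" "\<phi> g y" y] d_act[of g z y] d_sym[of "\<phi> g y" y] V V' g L by simp
  moreover have "d (\<phi> g z) x \<le> d z x + L"
    using d_triangle[of "\<phi> g z" "\<phi> g x" x] d_act[of g z x] d_sym[of "\<phi> g x" x] V V' g L by simp
  ultimately show ?thesis using z d_sym[of z x] V by linarith
qed

text \<open>
  An element that moves both ends of a long geodesic by at most \<open>L\<close> moves all its points by at most
  \<open>L + \<Delta>\<close>, so some edge of the translated geodesic is near an edge of the original one. There are
  boundedly many such elements.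
\<close>

lemma acylindrical:
  obtains R N where "\<And>x y. x \<in> V \<Longrightarrow> y \<in> V \<Longrightarrow> R \<le> d x y \<Longrightarrow>
    finite {g \<in> carrier G. d x (\<phi> g x) \<le> L \<and> d y (\<phi> g y) \<le> L} \<and>
    card {g \<in> carrier G. d x (\<phi> g x) \<le> L \<and> d y (\<phi> g y) \<le> L} \<le> N"
proof -
  define c where "c = L + \<Delta>"
  \<comment> \<open>\<open>R\<close> exceeds \<open>L + c\<close>, the largest total length of the
    two connecting geodesics, so these cannot contain all edges of a simple path spanning distance
    \<open>R\<close>. \<open>M\<close> bounds the number of vertices of the two paths to which
    \<open>path_edge_near_walk\<close> is applied.\<close>
  define R where "R = L + c + 1"
  define M where "M = 2 * R + L + c + 2"
  obtain N1 where N1: "\<And>e. e \<in> E \<Longrightarrow> finite (near_edges V E M e) \<and> card (near_edges V E M e) \<le> N1"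
    using near_edges_bound by blast
  obtain N2 where N2: "\<And>e e'. e \<in> E \<Longrightarrow> finite {g \<in> carrier G. \<phi> g ` e = e'} \<and>
        card {g \<in> carrier G. \<phi> g ` e = e'} \<le> N2"
    using transporter_bound by blast
  have "finite {g \<in> carrier G. d x (\<phi> g x) \<le> L \<and> d y (\<phi> g y) \<le> L} \<and>
      card {g \<in> carrier G. d x (\<phi> g x) \<le> L \<and> d y (\<phi> g y) \<le> L} \<le> R * (R * (N1 * N2))"
    (is "finite ?S \<and> card ?S \<le> _")
    if xy: "x \<in> V" "y \<in> V" "R \<le> d x y" for x y
  proof -
    obtain p where p: "graph_walk V E x p y" "length p = Suc (d x y)" using ex_geodesic xy by blast
    \<comment> \<open>Only the first \<open>R\<close> steps of the geodesic are used, which keeps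
      the count independent of the distance from \<open>x\<close> to \<open>y\<close>.\<close>
    let ?\<alpha> = "take (Suc R) p" and ?z = "p ! R"
    have R: "R < length p" using p xy by simp
    have \<alpha>: "graph_walk V E x ?\<alpha> ?z" using graph_walk_take[OF p(1) R] .
    have z: "?z \<in> V" "d x ?z = R" "d ?z y = d x y - R" using geodesic_nth[OF p xy(3)] by auto
    have len: "length ?\<alpha> = Suc R" using R by simp
    let ?A = "path_edges ?\<alpha>"
    have AE: "?A \<subseteq> E" using \<alpha> by (simp add: graph_walk_iff)
    have cA: "card ?A \<le> R" using card_path_edges_le[of ?\<alpha>] len by simp
    let ?U = "\<Union>e\<in>?A. \<Union>e'\<in>?A. \<Union>e''\<in>near_edges V E M e. {g \<in> carrier G. \<phi> g ` e' = e''}"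
    have "?S \<subseteq> ?U"
    proof
      fix g assume "g \<in> ?S"
      then have g: "g \<in> carrier G" and gx: "d x (\<phi> g x) \<le> L" and gy: "d y (\<phi> g y) \<le> L" by auto
      have gz: "d ?z (\<phi> g ?z) \<le> c"
        unfolding c_def using displacement_along_geodesic[OF g xy(1,2) z(1) _ gx gy] z xy(3) by simp
      obtain \<beta> where \<beta>: "graph_walk V E x \<beta> (\<phi> g x)" "length \<beta> = Suc (d x (\<phi> g x))"
        using ex_geodesic g xy act_closed by metis
      obtain \<beta>' where \<beta>': "graph_walk V E ?z \<beta>' (\<phi> g ?z)" "length \<beta>' = Suc (d ?z (\<phi> g ?z))"
        using ex_geodesic g z act_closed by metis
      let ?g\<alpha> = "map (\<phi> g) ?\<alpha>"
      have g\<alpha>: "graph_walk V E (\<phi> g x) ?g\<alpha> (\<phi> g ?z)" using walk_map[OF g \<alpha>] .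
      have w1: "graph_walk V E x (\<beta> @ tl ?g\<alpha>) (\<phi> g ?z)" using graph_walk_join[OF \<beta>(1) g\<alpha>] .
      define w where "w = (\<beta> @ tl ?g\<alpha>) @ tl (rev \<beta>')"
      have w: "graph_walk V E x w ?z"
        unfolding w_def using graph_walk_join[OF w1 graph_walk_rev[OF \<beta>'(1)]] .
      have "path_edges (\<beta> @ tl ?g\<alpha>) = path_edges \<beta> \<union> path_edges ?g\<alpha>"
        by (rule path_edges_join) (use \<beta> g\<alpha> in \<open>auto simp: graph_walk_iff\<close>)
      moreover have "path_edges w = path_edges (\<beta> @ tl ?g\<alpha>) \<union> path_edges (rev \<beta>')"
        unfolding w_def
        by (rule path_edges_join) (use w1 \<beta>' in \<open>auto simp: graph_walk_iff hd_rev\<close>)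
      ultimately have pw: "path_edges w = path_edges \<beta> \<union> path_edges ?g\<alpha> \<union> path_edges \<beta>'"
        by (simp add: path_edges_rev)
      have lw: "length w \<le> L + c + R + 1"
        unfolding w_def using \<beta> \<beta>' gx gz len by simp
      obtain \<gamma> where \<gamma>: "\<gamma> \<noteq> []" "distinct \<gamma>" "hd \<gamma> = hd w" "last \<gamma> = last w"
        "set \<gamma> \<subseteq> set w" "path_edges \<gamma> \<subseteq> path_edges w" "length \<gamma> \<le> length w"
        using ex_distinct_path[of w] w by (auto simp: graph_walk_iff)
      have \<gamma>w: "graph_walk V E x \<gamma> ?z" using \<gamma> w by (auto simp: graph_walk_iff)
      have "\<not> path_edges \<gamma> \<subseteq> path_edges \<beta> \<union> path_edges \<beta>'"
      proof
        assume "path_edges \<gamma> \<subseteq> path_edges \<beta> \<union> path_edges \<beta>'"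
        then have "card (path_edges \<gamma>) \<le> card (path_edges \<beta> \<union> path_edges \<beta>')"
          by (intro card_mono) auto
        also have "\<dots> \<le> card (path_edges \<beta>) + card (path_edges \<beta>')" by (rule card_Un_le)
        also have "\<dots> \<le> L + c"
          using card_path_edges_le[of \<beta>] card_path_edges_le[of \<beta>'] \<beta>(2) \<beta>'(2) gx gz by simp
        finally have "length \<gamma> - 1 \<le> L + c" using card_path_edges_distinct[OF \<gamma>(2)] by simp
        moreover have "R \<le> length \<gamma> - 1" using d_le[OF \<gamma>w] z by simp
        ultimately show False unfolding R_def by simp
      qed
      then obtain f where f: "f \<in> path_edges \<gamma>" "f \<in> path_edges ?g\<alpha>" using \<gamma>(6) pw by blast
      obtain e' where e': "e' \<in> ?A" "f = \<phi> g ` e'" using f(2) by (auto simp: path_edges_map)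
      obtain e where e: "e \<in> ?A" "f \<in> near_edges V E (length ?\<alpha> + length \<gamma>) e"
        using path_edge_near_walk[OF \<gamma>w \<gamma>(2) \<alpha> f(1)] by blast
      have "length ?\<alpha> + length \<gamma> \<le> M" unfolding M_def using len lw \<gamma>(7) by simp
      then have "f \<in> near_edges V E M e" using e(2) near_edges_mono by blast
      then show "g \<in> ?U" using e e' g by blast
    qed
    moreover have U: "finite ?U \<and> card ?U \<le> R * (R * (N1 * N2))"
    proof (intro card_UN_bound finite_path_edges cA)
      fix e e' assume e: "e \<in> ?A" "e' \<in> ?A"
      then show "finite (near_edges V E M e)" "card (near_edges V E M e) \<le> N1"
        using N1 AE by blast+
      show "finite {g \<in> carrier G. \<phi> g ` e' = e''} \<and> card {g \<in> carrier G. \<phi> g ` e' = e''} \<le> N2" for e''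
        using N2 AE e by blast
    qed
    ultimately have "finite ?S" "card ?S \<le> card ?U"
      by (auto intro: finite_subset[of ?S ?U] card_mono[of ?U ?S])
    then show ?thesis using U by linarith
  qed
  then show ?thesis using that by blast
qed

end

section \<open>Free pairs from ping-pong\<close>

text \<open>Words are compared only with words of the same length: the \<open>2 ^ n\<close> distinct
  products of length \<open>n\<close> are all that the growth argument counts.\<close>

definition free_pair :: "('a, 'b) monoid_scheme \<Rightarrow> 'a \<Rightarrow> 'a \<Rightarrow> bool" where
  "free_pair G a b \<longleftrightarrow> a \<noteq> b \<and>
    (\<forall>n. inj_on (\<lambda>ws. foldr (\<lambda>x y. x \<otimes>\<^bsub>G\<^esub> y) ws \<one>\<^bsub>G\<^esub>) {ws. set ws \<subseteq> {a, b} \<and> length ws = n})"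

lemma (in group) foldr_mult_closed: "set ws \<subseteq> carrier G \<Longrightarrow> foldr (\<otimes>) ws \<one> \<in> carrier G"
  by (induction ws) auto

lemma (in group) foldr_mult_replicate:
  "g \<in> carrier G \<Longrightarrow> foldr (\<otimes>) (replicate n g) \<one> = g [^] n"
proof (induction n)
  case (Suc n)
  then show ?case using nat_pow_Suc2[of g n] by simp
qed simp

context hyperbolic_graph_action
begin

text \<open>Twice the Gromov product, so that it is an integer.\<close>

definition gp :: "'v \<Rightarrow> 'v \<Rightarrow> 'v \<Rightarrow> int" where
  "gp o' x y = int (d o' x) + int (d o' y) - int (d x y)"

lemma gp_commute: "x \<in> V \<Longrightarrow> y \<in> V \<Longrightarrow> gp p x y = gp p y x"
  unfolding gp_def using d_sym[of x y] by simp

text \<open>The four-point inequality in the form of Gromov's inequality; since products are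
  doubled, the error is \<open>\<Delta>\<close> itself.\<close>

lemma gp_min:
  assumes "p \<in> V" "x \<in> V" "y \<in> V" "z \<in> V"
  shows "min (gp p x y) (gp p y z) - int \<Delta> \<le> gp p x z"
proof -
  have "d x z + d p y \<le> max (d x p + d z y) (d x y + d z p) + \<Delta>"
    using four_point[of x z p y] assms by simp
  then show ?thesis
    unfolding gp_def using d_sym[of x p] d_sym[of z y] d_sym[of z p] assms by linarith
qed

lemma gp_act:
  "g \<in> carrier G \<Longrightarrow> p \<in> V \<Longrightarrow> x \<in> V \<Longrightarrow> y \<in> V \<Longrightarrow> gp (\<phi> g p) (\<phi> g x) (\<phi> g y) = gp p x y"
  unfolding gp_def by (simp add: d_act)

text \<open>This exchange turns a small product at one end of a segment into a large product at the
  other end; it carries ping-pong estimates from one corner to the next.\<close>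

lemma gp_add_swap: "p \<in> V \<Longrightarrow> x \<in> V \<Longrightarrow> gp p x y + gp x p y = 2 * int (d p x)"
  unfolding gp_def using d_sym[of p x] by simp

lemma gp_self_left: "p \<in> V \<Longrightarrow> gp p p y = 0" "p \<in> V \<Longrightarrow> y \<in> V \<Longrightarrow> gp p y p = 0"
  unfolding gp_def using d_sym[of p y] by auto

lemma gp_diag: "x \<in> V \<Longrightarrow> gp p x x = 2 * int (d p x)"
  unfolding gp_def by simp

lemma gp_nonneg: "p \<in> V \<Longrightarrow> x \<in> V \<Longrightarrow> y \<in> V \<Longrightarrow> 0 \<le> gp p x y"
  unfolding gp_def using d_triangle[of x p y] d_sym[of p x] by simp

lemma gp_change_base:
  "p \<in> V \<Longrightarrow> q \<in> V \<Longrightarrow> x \<in> V \<Longrightarrow> y \<in> V \<Longrightarrow> gp p x y \<le> gp q x y + 2 * int (d p q)"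
  unfolding gp_def using d_triangle[of p q x] d_triangle[of p q y] by simp

lemma gp_change_right:
  "p \<in> V \<Longrightarrow> x \<in> V \<Longrightarrow> y \<in> V \<Longrightarrow> z \<in> V \<Longrightarrow> gp p x y \<le> gp p x z + 2 * int (d y z)"
  unfolding gp_def using d_triangle[of p z y] d_triangle[of x y z] d_sym[of y z] by simp

lemma gp_change_left:
  "p \<in> V \<Longrightarrow> x \<in> V \<Longrightarrow> y \<in> V \<Longrightarrow> z \<in> V \<Longrightarrow> gp p x y \<le> gp p z y + 2 * int (d x z)"
  using gp_change_right[of p y x z] gp_commute by simp

text \<open>The images of \<open>p\<close> under the prefixes of a word in \<open>T\<close> form a
  broken path. Moved back to \<open>p\<close>, a corner between letters \<open>s\<close> and
  \<open>t\<close> has neighbours \<open>\<phi> (inv s) p\<close> and \<open>\<phi> t p\<close>;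
  \<open>A\<close> limits the backtracking there, and the segments are longer than this loss.
  Nothing is asked of \<open>\<phi> s p\<close> against \<open>\<phi> t p\<close>, so a single
  letter is allowed.\<close>

definition ping_pong :: "'a set \<Rightarrow> int \<Rightarrow> 'v \<Rightarrow> bool" where
  "ping_pong T A p \<longleftrightarrow> T \<subseteq> carrier G \<and> p \<in> V \<and>
    (\<forall>s\<in>T. \<forall>t\<in>T. gp p (\<phi> (inv s) p) (\<phi> t p) \<le> A) \<and> (\<forall>t\<in>T. A + int \<Delta> < int (d p (\<phi> t p)))"

text \<open>Control of corners becomes global with a single loss of \<open>\<Delta>\<close>. The
  estimate for the rest of the word, translated by \<open>t\<close>, makes the product of
  \<open>\<phi> t p\<close> with the end point exceed \<open>A + \<Delta>\<close>; a large product
  of the end point with \<open>\<phi> (inv s) p\<close> would then violate the bound at the corner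
  between \<open>s\<close> and \<open>t\<close>.\<close>

lemma ping_pong_word:
  assumes T: "ping_pong T A p" and ws: "set ws \<subseteq> T" and "ws \<noteq> []" "s \<in> T"
  shows "gp p (\<phi> (inv s) p) (\<phi> (foldr (\<otimes>) ws \<one>) p) \<le> A + int \<Delta>"
  using ws \<open>ws \<noteq> []\<close> \<open>s \<in> T\<close>
proof (induction ws arbitrary: s)
  case (Cons t us)
  have c: "t \<in> carrier G" "s \<in> carrier G" "set us \<subseteq> carrier G" and p: "p \<in> V"
    using T Cons.prems by (auto simp: ping_pong_def)
  let ?u = "foldr (\<otimes>) us \<one>"
  have u: "?u \<in> carrier G" using foldr_mult_closed c by blast
  have st: "gp p (\<phi> (inv s) p) (\<phi> t p) \<le> A" and dt: "A + int \<Delta> < int (d p (\<phi> t p))"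
    using T Cons.prems by (auto simp: ping_pong_def)
  show ?case
  proof (cases "us = []")
    case True
    then show ?thesis using st c by simp
  next
    case False
    let ?z = "\<phi> t (\<phi> ?u p)"
    have z: "\<phi> (foldr (\<otimes>) (t # us) \<one>) p = ?z" using c u p by (simp add: act_mult)
    have "gp p (\<phi> (inv t) p) (\<phi> ?u p) \<le> A + int \<Delta>"
      using Cons.IH[of t] Cons.prems False by simp
    then have "gp (\<phi> t p) p ?z \<le> A + int \<Delta>"
      using gp_act[of t p "\<phi> (inv t) p" "\<phi> ?u p"] c u p by simp
    then have "gp p (\<phi> t p) ?z > A + int \<Delta>"
      using gp_add_swap[of p "\<phi> t p" ?z] dt c p by simp
    moreover have "min (gp p (\<phi> (inv s) p) ?z) (gp p ?z (\<phi> t p)) - int \<Delta> \<le> A"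
      using gp_min[of p "\<phi> (inv s) p" ?z "\<phi> t p"] st c u p by simp
    ultimately show ?thesis
      using z gp_commute[of "\<phi> t p" ?z p] c u p by auto
  qed
qed simp

text \<open>Both follow by translating the corner estimate for \<open>t\<close> and the rest of the
  word to \<open>\<phi> t p\<close>. The first conclusion decodes a word from its end point, the
  second gives linear growth.\<close>

lemma ping_pong_first_letter:
  assumes T: "ping_pong T A p" and ws: "set (t # us) \<subseteq> T"
  shows "gp p (\<phi> t p) (\<phi> (foldr (\<otimes>) (t # us) \<one>) p) > A + int \<Delta>"
    and "d p (\<phi> (foldr (\<otimes>) us \<one>) p) < d p (\<phi> (foldr (\<otimes>) (t # us) \<one>) p)"
proof -
  have c: "t \<in> carrier G" "set us \<subseteq> carrier G" and p: "p \<in> V"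
    using T ws by (auto simp: ping_pong_def)
  let ?u = "foldr (\<otimes>) us \<one>"
  have u: "?u \<in> carrier G" using foldr_mult_closed c by blast
  have dt: "A + int \<Delta> < int (d p (\<phi> t p))" and A: "0 \<le> A"
    using T ws gp_nonneg[of p "\<phi> (inv t) p" "\<phi> t p"] c by (force simp: ping_pong_def)+
  let ?z = "\<phi> t (\<phi> ?u p)"
  have z: "\<phi> (foldr (\<otimes>) (t # us) \<one>) p = ?z" using c u p by (simp add: act_mult)
  have "gp p (\<phi> (inv t) p) (\<phi> ?u p) \<le> A + int \<Delta>"
  proof (cases "us = []")
    case True
    then show ?thesis using gp_self_left p A c by simp
  next
    case False
    then show ?thesis using ping_pong_word[OF T, of us t] ws by simp
  qed
  then have *: "gp (\<phi> t p) p ?z \<le> A + int \<Delta>"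
    using gp_act[of t p "\<phi> (inv t) p" "\<phi> ?u p"] c u p by simp
  then show "gp p (\<phi> t p) (\<phi> (foldr (\<otimes>) (t # us) \<one>) p) > A + int \<Delta>"
    using gp_add_swap[of p "\<phi> t p" ?z] dt z c p by simp
  have "d (\<phi> t p) ?z = d p (\<phi> ?u p)" using d_act c u p by simp
  then show "d p (\<phi> ?u p) < d p (\<phi> (foldr (\<otimes>) (t # us) \<one>) p)"
    using * dt d_sym[of p "\<phi> t p"] z c p unfolding gp_def by simp
qed

lemma ping_pong_length:
  "ping_pong T A p \<Longrightarrow> set ws \<subseteq> T \<Longrightarrow> length ws \<le> d p (\<phi> (foldr (\<otimes>) ws \<one>) p)"
proof (induction ws)
  case (Cons t us)
  then show ?case using ping_pong_first_letter(2)[of T A p t us] by simp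
qed simp

lemma ping_pong_free_pair:
  assumes T: "ping_pong {a, b} A p" and ab: "gp p (\<phi> a p) (\<phi> b p) \<le> A"
  shows "free_pair G a b"
proof -
  have c: "a \<in> carrier G" "b \<in> carrier G" and p: "p \<in> V" using T by (auto simp: ping_pong_def)
  let ?W = "\<lambda>ws. foldr (\<otimes>) ws \<one>"
  \<comment> \<open>If two products with different first letters agreed, the image of
    \<open>p\<close> would lie in both directions, and \<open>gp_min\<close> would contradict
    \<open>ab\<close>.\<close>
  have no: False if "s \<in> {a, b}" "t \<in> {a, b}" "s \<noteq> t" "set us \<subseteq> {a, b}" "set vs \<subseteq> {a, b}"
    "?W (s # us) = ?W (t # vs)" for s t us vs
  proof -
    let ?z = "\<phi> (?W (s # us)) p"
    have zV: "?z \<in> V" "\<phi> s p \<in> V" "\<phi> t p \<in> V"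
    proof -
      have "set (s # us) \<subseteq> carrier G" using that(1,4) c by auto
      then show "?z \<in> V" by (rule act_closed[OF foldr_mult_closed p])
      show "\<phi> s p \<in> V" "\<phi> t p \<in> V" using that(1,2) c p by auto
    qed
    have sub: "set (s # us) \<subseteq> {a, b}" "set (t # vs) \<subseteq> {a, b}" using that(1-5) by simp_all
    have "gp p (\<phi> s p) ?z > A + int \<Delta>" by (rule ping_pong_first_letter(1)[OF T sub(1)])
    moreover have "gp p (\<phi> t p) ?z > A + int \<Delta>"
      using ping_pong_first_letter(1)[OF T sub(2)] by (simp only: that(6))
    ultimately have "gp p (\<phi> s p) (\<phi> t p) > A"
      using gp_min[of p "\<phi> s p" ?z "\<phi> t p"] gp_commute[of "\<phi> t p" ?z p] zV p by simp
    moreover have "gp p (\<phi> s p) (\<phi> t p) \<le> A"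
      using ab that(1-3) gp_commute[of "\<phi> a p" "\<phi> b p" p] c p by auto
    ultimately show False by simp
  qed
  have inj: "ws = vs" if "length ws = length vs" "set ws \<subseteq> {a, b}" "set vs \<subseteq> {a, b}" "?W ws = ?W vs" for ws vs
    using that
  proof (induction ws vs rule: list_induct2)
    case (Cons s us t vs)
    have "s \<in> {a, b}" "t \<in> {a, b}" "set us \<subseteq> {a, b}" "set vs \<subseteq> {a, b}"
      using Cons.prems(1,2) by simp_all
    then have "s = t" using no[of s t us vs] Cons.prems(3) by blast
    moreover have "?W us \<in> carrier G" "?W vs \<in> carrier G" "s \<in> carrier G"
      using foldr_mult_closed Cons.prems c by auto
    ultimately have "?W us = ?W vs" using Cons.prems(3) by simp
    then show ?case using Cons.IH Cons.prems \<open>s = t\<close> by simp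
  qed simp
  have "a \<noteq> b"
  proof
    assume "a = b"
    then have "2 * int (d p (\<phi> a p)) \<le> A" using ab gp_diag[of "\<phi> a p" p] c p by simp
    then show False using T gp_nonneg[of p "\<phi> (inv a) p" "\<phi> a p"] c p by (auto simp: ping_pong_def)
  qed
  then show ?thesis unfolding free_pair_def inj_on_def using inj by auto
qed

section \<open>Loxodromic elements\<close>

text \<open>A certificate at one base point: the ping-pong inequality for the single letter
  \<open>g\<close>, with an extra \<open>\<Delta>\<close> that is spent in
  \<open>gp_axis_ends\<close>. By \<open>ping_pong_length\<close>, powers of \<open>g\<close> then
  move \<open>p\<close> arbitrarily far.\<close>

definition loxodromic_at :: "'a \<Rightarrow> 'v \<Rightarrow> bool" where
  "loxodromic_at g p \<longleftrightarrow> gp p (\<phi> (inv g) p) (\<phi> g p) + 2 * int \<Delta> < int (d p (\<phi> g p))"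

text \<open>
  At a point minimizing the maximal displacement \<open>L\<close> of the elements of \<open>S\<close>, the elements with
  displacement almost \<open>L\<close> cannot all move it in the same direction, as otherwise moving the point
  in that direction would decrease \<open>L\<close>. Two elements pointing in different directions give a
  loxodromic element.
\<close>

lemma small_displacement_or_loxodromic:
  assumes S: "finite S" "S \<subseteq> carrier G" "\<And>s. s \<in> S \<Longrightarrow> inv s \<in> S" "S \<noteq> {}" and V: "V \<noteq> {}"
    and large: "\<And>x. x \<in> V \<Longrightarrow> \<exists>s\<in>S. 40 * \<Delta> < d x (\<phi> s x)"
  shows "\<exists>x\<in>V. \<exists>g. loxodromic_at g x \<and> (g \<in> S \<or> (\<exists>s\<in>S. \<exists>t\<in>S. g = s \<otimes> t))"
proof (rule ccontr)
  assume neg: "\<not> ?thesis"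
  then have nl1: "\<not> loxodromic_at s x" if "x \<in> V" "s \<in> S" for s x using that by blast
  have nl2: "\<not> loxodromic_at (s \<otimes> t) x" if "x \<in> V" "s \<in> S" "t \<in> S" for s t x
    using that neg by blast
  define f where "f x = Max ((\<lambda>s. d x (\<phi> s x)) ` S)" for x
  have f_ge: "d x (\<phi> s x) \<le> f x" if "s \<in> S" for s x
    unfolding f_def using S that by (intro Max_ge) auto
  have f_att: "\<exists>s\<in>S. f x = d x (\<phi> s x)" for x
  proof -
    have "f x \<in> (\<lambda>s. d x (\<phi> s x)) ` S" unfolding f_def using S by (intro Max_in) auto
    then show ?thesis by auto
  qed
  obtain x where x: "x \<in> V" "\<And>y. y \<in> V \<Longrightarrow> f x \<le> f y"
    using V ex_has_least_nat[of "\<lambda>x. x \<in> V" _ f] by blast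
  let ?L = "int (f x)"
  have L: "40 * int \<Delta> < ?L"
  proof -
    obtain s where "s \<in> S" "40 * \<Delta> < d x (\<phi> s x)" using large x by blast
    then show ?thesis using f_ge[of s x] by simp
  qed
  have sV: "s \<in> carrier G" "\<phi> s x \<in> V" "\<phi> (inv s) x \<in> V" if "s \<in> S" for s
    using that S x by auto
  have dinv: "d x (\<phi> (inv s) x) = d x (\<phi> s x)" if "s \<in> S" for s
    using d_act[of s x "\<phi> (inv s) x"] d_sym[of x "\<phi> s x"] sV[OF that] x by simp
  have nonlox: "int (d x (\<phi> s x)) - 2 * int \<Delta> \<le> gp x (\<phi> (inv s) x) (\<phi> s x)" if "s \<in> S" for s
    using nl1[OF x(1) that] by (simp add: loxodromic_at_def)
  have dir: "4 * int \<Delta> \<le> gp x (\<phi> (inv s) x) (\<phi> t x)"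
    if s: "s \<in> S" "?L - 4 * int \<Delta> \<le> int (d x (\<phi> s x))"
      and t: "t \<in> S" "?L - 4 * int \<Delta> \<le> int (d x (\<phi> t x))" for s t
  proof (rule ccontr)
    assume "\<not> ?thesis"
    then have less: "gp x (\<phi> (inv s) x) (\<phi> t x) < 4 * int \<Delta>" by simp
    let ?s = "\<phi> s x" and ?s' = "\<phi> (inv s) x" and ?t = "\<phi> t x" and ?t' = "\<phi> (inv t) x"
      and ?st = "\<phi> (s \<otimes> t) x" and ?st' = "\<phi> (inv (s \<otimes> t)) x"
    have c: "s \<in> carrier G" "t \<in> carrier G" using s t sV by auto
    have st: "?st = \<phi> s ?t" "?st' = \<phi> (inv t) ?s'"
      using c x by (simp_all add: act_mult inv_mult_group)
    have pts: "?s \<in> V" "?s' \<in> V" "?t \<in> V" "?t' \<in> V" "?st \<in> V" "?st' \<in> V" using c x by simp_all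
    have dst: "d x ?st = d ?s' ?t"
      using d_act[of s ?s' ?t] c x pts by (simp add: st)
    then have Dst: "int (d x ?st) > 2 * ?L - 12 * int \<Delta>"
      using less s(2) t(2) dinv[OF s(1)] unfolding gp_def by linarith
    have "gp ?s x ?st = gp x ?s' ?t"
      using gp_act[of s x ?s' ?t] c x pts st by simp
    then have 1: "gp x ?s ?st > 2 * ?L - 12 * int \<Delta>"
      using gp_add_swap[of x ?s ?st] less s(2) x pts by linarith
    have "gp ?t' x ?st' = gp x ?t ?s'"
      using gp_act[of "inv t" x ?t ?s'] c x pts st by simp
    then have 2: "gp x ?t' ?st' > 2 * ?L - 12 * int \<Delta>"
      using gp_add_swap[of x ?t' ?st'] less t(2) dinv[OF t(1)] gp_commute[of ?s' ?t x] x pts by linarith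
    have 3: "gp x ?st' ?st \<ge> int (d x ?st) - 2 * int \<Delta>"
      using nl2[OF x(1) s(1) t(1)] by (simp add: loxodromic_at_def)
    have 4: "gp x ?s' ?s \<ge> ?L - 6 * int \<Delta>" using nonlox[OF s(1)] s(2) by linarith
    have 5: "gp x ?t' ?t \<ge> ?L - 6 * int \<Delta>" using nonlox[OF t(1)] t(2) by linarith
    \<comment> \<open>Along the chain \<open>?s'\<close>, \<open>?s\<close>, \<open>?st\<close>,
      \<open>?st'\<close>, \<open>?t'\<close>, \<open>?t\<close> all five consecutive products are
      large: three because \<open>s\<close>, \<open>t\<close> and \<open>s \<otimes> t\<close> are
      not loxodromic at \<open>x\<close>, two because the product assumed small makes
      \<open>s \<otimes> t\<close> nearly a concatenation. Four uses of \<open>gp_min\<close> make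
      the product of \<open>?s'\<close> and \<open>?t\<close> large as well.\<close>
    have "min (gp x ?s' ?s) (gp x ?s ?st) - int \<Delta> \<le> gp x ?s' ?st" using gp_min x pts by blast
    moreover have "min (gp x ?s' ?st) (gp x ?st ?st') - int \<Delta> \<le> gp x ?s' ?st'" using gp_min x pts by blast
    moreover have "min (gp x ?s' ?st') (gp x ?st' ?t') - int \<Delta> \<le> gp x ?s' ?t'" using gp_min x pts by blast
    moreover have "min (gp x ?s' ?t') (gp x ?t' ?t) - int \<Delta> \<le> gp x ?s' ?t" using gp_min x pts by blast
    moreover have "gp x ?st ?st' = gp x ?st' ?st" "gp x ?st' ?t' = gp x ?t' ?st'"
      using gp_commute pts by blast+
    ultimately show False using 1 2 3 4 5 Dst less L \<Delta>_pos by linarith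
  qed
  obtain s0 where s0: "s0 \<in> S" "f x = d x (\<phi> s0 x)" using f_att by blast
  \<comment> \<open>A step of \<open>2 * \<Delta>\<close> in the direction of an element with
    maximal displacement. By \<open>dir\<close>, elements moving \<open>x\<close> almost as far
    share this direction, and so do their inverses; the two gains together beat the error of the
    four-point inequality.\<close>
  obtain x' where x': "x' \<in> V" "d x x' = 2 * \<Delta>" "d x' (\<phi> s0 x) = d x (\<phi> s0 x) - 2 * \<Delta>"
    using geodesic_split[of x "\<phi> s0 x" "2 * \<Delta>"] sV[OF s0(1)] x s0(2) L by auto
  have gx': "gp x (\<phi> s0 x) x' = 4 * int \<Delta>"
    unfolding gp_def using x' d_sym[of "\<phi> s0 x" x'] sV[OF s0(1)] s0(2) L by auto
  have closer: "int (d x' (\<phi> s x)) \<le> int (d x (\<phi> s x)) - int \<Delta>"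
    if s: "s \<in> S" "?L - 4 * int \<Delta> \<le> int (d x (\<phi> s x))" for s
  proof -
    have "4 * int \<Delta> \<le> gp x (\<phi> (inv (inv s)) x) (\<phi> s0 x)"
      using dir[of "inv s" s0] S(3)[OF s(1)] dinv[OF s(1)] s s0 L by simp
    then have "4 * int \<Delta> \<le> gp x (\<phi> s x) (\<phi> s0 x)" using sV[OF s(1)] by simp
    moreover have "min (gp x (\<phi> s x) (\<phi> s0 x)) (gp x (\<phi> s0 x) x') - int \<Delta> \<le> gp x (\<phi> s x) x'"
      using gp_min x x' sV[OF s(1)] sV[OF s0(1)] by blast
    ultimately have "3 * int \<Delta> \<le> gp x (\<phi> s x) x'" using gx' by linarith
    then show ?thesis
      unfolding gp_def using x' d_sym[of "\<phi> s x" x'] sV[OF s(1)] by simp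
  qed
  have "d x' (\<phi> s x') < f x" if s: "s \<in> S" for s
  proof -
    have sx': "\<phi> s x' \<in> V" using sV[OF s] x' by simp
    have dx: "d (\<phi> s x') (\<phi> s x) = 2 * \<Delta>" "d x' x = 2 * \<Delta>" "d x x' = 2 * \<Delta>"
      using d_act[of s x' x] d_sym[of x x'] sV[OF s] x' x by simp_all
    show ?thesis
    proof (cases "?L - 4 * int \<Delta> \<le> int (d x (\<phi> s x))")
      case True
      have "d (\<phi> s x') x = d x' (\<phi> (inv s) x)"
        using d_act[of "inv s" "\<phi> s x'" x] sV[OF s] x' x by simp
      moreover have "int (d x' (\<phi> (inv s) x)) \<le> int (d x (\<phi> s x)) - int \<Delta>"
        using closer[OF S(3)[OF s]] dinv[OF s] True by simp
      moreover have "int (d x' (\<phi> s x)) \<le> int (d x (\<phi> s x)) - int \<Delta>" using closer[OF s True] .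
      moreover have "d x' (\<phi> s x') + d x (\<phi> s x) \<le> max (d x' x + d (\<phi> s x') (\<phi> s x)) (d x' (\<phi> s x) + d (\<phi> s x') x) + \<Delta>"
        using four_point[of x' "\<phi> s x'" x "\<phi> s x"] x' x sx' sV[OF s] by simp
      moreover have "d x (\<phi> s x) \<le> f x" using f_ge s by blast
      ultimately show ?thesis using True L dx \<Delta>_pos by linarith
    next
      case False
      \<comment> \<open>Elements of smaller displacement have \<open>4 * \<Delta>\<close> to spare,
        the most that moving the point by \<open>2 * \<Delta>\<close> can cost.\<close>
      have "d x' (\<phi> s x') \<le> d x' x + d x (\<phi> s x')" using d_triangle x x' sx' by blast
      moreover have "d x (\<phi> s x') \<le> d x (\<phi> s x) + d (\<phi> s x) (\<phi> s x')"
        using d_triangle x x' sx' sV[OF s] by blast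
      moreover have "d (\<phi> s x) (\<phi> s x') = 2 * \<Delta>" using d_act[of s x x'] sV[OF s] x x' by simp
      ultimately show ?thesis using False dx L by linarith
    qed
  qed
  moreover obtain s where "s \<in> S" "f x' = d x' (\<phi> s x')" using f_att by blast
  ultimately show False using x(2)[OF x'(1)] by force
qed

text \<open>A finite symmetric \<open>S\<close> in \<open>H\<close> with more than \<open>N\<close>
  elements is fixed; by acylindricity the points that it moves little are within \<open>R\<close> of
  each other. Adding any \<open>h\<close> and its inverse to \<open>S\<close> still leaves such a
  point, so \<open>h\<close> moves a point near \<open>x0\<close> little.\<close>

lemma no_loxodromic_bounded_orbit:
  assumes H: "subgroup H G" "infinite H" and V: "V \<noteq> {}"
    and nolox: "\<And>g x. g \<in> H \<Longrightarrow> x \<in> V \<Longrightarrow> \<not> loxodromic_at g x"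
  shows "\<exists>x\<in>V. \<exists>D. \<forall>h\<in>H. d x (\<phi> h x) \<le> D"
proof -
  interpret H: subgroup H G by fact
  have small: "\<exists>x\<in>V. \<forall>s\<in>S. d x (\<phi> s x) \<le> 40 * \<Delta>"
    if S: "finite S" "S \<subseteq> H" "\<And>s. s \<in> S \<Longrightarrow> inv s \<in> S" "S \<noteq> {}" for S
  proof (rule ccontr)
    assume "\<not> ?thesis"
    then have large: "\<And>x. x \<in> V \<Longrightarrow> \<exists>s\<in>S. 40 * \<Delta> < d x (\<phi> s x)" by (meson not_le)
    have SG: "S \<subseteq> carrier G" using S(2) H.subset by blast
    obtain g x where "x \<in> V" "loxodromic_at g x" "g \<in> S \<or> (\<exists>s\<in>S. \<exists>t\<in>S. g = s \<otimes> t)"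
      using small_displacement_or_loxodromic[OF S(1) SG S(3,4) V large] by blast
    then show False using nolox S(2) by blast
  qed
  obtain R N where RN: "\<And>x y. x \<in> V \<Longrightarrow> y \<in> V \<Longrightarrow> R \<le> d x y \<Longrightarrow>
    finite {g \<in> carrier G. d x (\<phi> g x) \<le> 40 * \<Delta> \<and> d y (\<phi> g y) \<le> 40 * \<Delta>} \<and>
    card {g \<in> carrier G. d x (\<phi> g x) \<le> 40 * \<Delta> \<and> d y (\<phi> g y) \<le> 40 * \<Delta>} \<le> N"
    using acylindrical[of "40 * \<Delta>"] by blast
  obtain B where B: "finite B" "card B = Suc N" "B \<subseteq> H"
    using infinite_arbitrarily_large[OF H(2)] by blast
  define S where "S = B \<union> (\<lambda>h. inv h) ` B"
  have S: "finite S" "S \<subseteq> H" "S \<noteq> {}" "\<And>s. s \<in> S \<Longrightarrow> inv s \<in> S"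
    using B by (auto simp: S_def)
  have cS: "N < card S" using B card_mono[OF S(1), of B] by (auto simp: S_def)
  obtain x0 where x0: "x0 \<in> V" "\<And>s. s \<in> S \<Longrightarrow> d x0 (\<phi> s x0) \<le> 40 * \<Delta>"
    using small[OF S(1,2,4,3)] by blast
  have "d x0 (\<phi> h x0) \<le> 2 * R + 40 * \<Delta>" if h: "h \<in> H" for h
  proof -
    have "\<exists>x\<in>V. \<forall>s\<in>S \<union> {h, inv h}. d x (\<phi> s x) \<le> 40 * \<Delta>"
      by (rule small) (use S h in auto)
    then obtain x where x: "x \<in> V" "\<And>s. s \<in> S \<union> {h, inv h} \<Longrightarrow> d x (\<phi> s x) \<le> 40 * \<Delta>" by blast
    have "d x0 x < R"
    proof (rule ccontr)
      assume "\<not> ?thesis"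
      then have "R \<le> d x0 x" by simp
      from RN[OF x0(1) x(1) this]
      have "finite {g \<in> carrier G. d x0 (\<phi> g x0) \<le> 40 * \<Delta> \<and> d x (\<phi> g x) \<le> 40 * \<Delta>}"
        "card {g \<in> carrier G. d x0 (\<phi> g x0) \<le> 40 * \<Delta> \<and> d x (\<phi> g x) \<le> 40 * \<Delta>} \<le> N" by auto
      moreover have "S \<subseteq> {g \<in> carrier G. d x0 (\<phi> g x0) \<le> 40 * \<Delta> \<and> d x (\<phi> g x) \<le> 40 * \<Delta>}"
        using x0 x S(2) H.subset by auto
      ultimately show False using cS by (meson card_mono leD le_trans)
    qed
    moreover have "d x0 (\<phi> h x0) \<le> d x0 x + d x (\<phi> h x0)"
      using d_triangle x0 x h by simp
    moreover have "d x (\<phi> h x0) \<le> d x (\<phi> h x) + d (\<phi> h x) (\<phi> h x0)"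
      using d_triangle x0 x h by simp
    moreover have "d (\<phi> h x) (\<phi> h x0) = d x0 x" using d_act[of h x x0] d_sym x0 x h by simp
    moreover have "d x (\<phi> h x) \<le> 40 * \<Delta>" using x by blast
    ultimately show ?thesis by linarith
  qed
  then show ?thesis using x0 by blast
qed

end

section \<open>Powers of a loxodromic element\<close>

lemma set_replicate_subset: "set (replicate n x) \<subseteq> {x}"
  by auto

context hyperbolic_graph_action
begin

lemma gp_transfer:
  assumes "z \<in> V" "x \<in> V" "y \<in> V" "x' \<in> V" "y' \<in> V"
    and "gp z x y \<le> c" "c + 2 * int \<Delta> < gp z x x'" "c + 2 * int \<Delta> < gp z y y'"
  shows "gp z x' y' \<le> c + 2 * int \<Delta>"
  using gp_min[of z x x' y] gp_min[of z x' y' y] gp_commute[of y y' z] assms by auto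

lemma ping_pong_loxodromic:
  assumes "g \<in> carrier G" "p \<in> V" "loxodromic_at g p"
  shows "ping_pong {g} (gp p (\<phi> (inv g) p) (\<phi> g p)) p"
  using assms \<Delta>_pos by (auto simp: ping_pong_def loxodromic_at_def)

lemma act_eq_dist: "g \<in> carrier G \<Longrightarrow> x \<in> V \<Longrightarrow> d x (\<phi> (inv g) x) = d x (\<phi> g x)"
  using d_act[of g x "\<phi> (inv g) x"] d_sym[of x "\<phi> g x"] by simp

lemma loxodromic_inv:
  assumes "g \<in> carrier G" "p \<in> V" "loxodromic_at g p"
  shows "loxodromic_at (inv g) p"
  using assms gp_commute[of "\<phi> g p" "\<phi> (inv g) p" p] act_eq_dist[of g p]
  by (simp add: loxodromic_at_def)

lemma loxodromic_pow_dist: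
  assumes "g \<in> carrier G" "p \<in> V" "loxodromic_at g p"
  shows "n \<le> d p (\<phi> (g [^] n) p)"
  using ping_pong_length[OF ping_pong_loxodromic[OF assms] set_replicate_subset, of n]
    foldr_mult_replicate[OF assms(1)] by simp

text \<open>The first bound is the ping-pong estimate for a one-letter word; the second follows from
  it by \<open>gp_add_swap\<close> after translating by \<open>g\<close>. Together they say that
  positive powers leave \<open>p\<close> in the direction of \<open>g\<close>.\<close>

lemma loxodromic_gp_pow:
  assumes "g \<in> carrier G" "p \<in> V" "loxodromic_at g p"
  shows "gp p (\<phi> (inv g) p) (\<phi> (g [^] (n :: nat)) p) \<le> gp p (\<phi> (inv g) p) (\<phi> g p) + int \<Delta>"
    and "0 < n \<Longrightarrow> 2 * int (d p (\<phi> g p)) - gp p (\<phi> (inv g) p) (\<phi> g p) - int \<Delta> \<le> gp p (\<phi> g p) (\<phi> (g [^] n) p)"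
proof -
  let ?A = "gp p (\<phi> (inv g) p) (\<phi> g p)"
  have A: "0 \<le> ?A" using gp_nonneg assms by simp
  have *: "gp p (\<phi> (inv g) p) (\<phi> (g [^] n) p) \<le> ?A + int \<Delta>" for n :: nat
  proof (cases n)
    case 0
    then show ?thesis using gp_self_left assms A by simp
  next
    case (Suc k)
    then show ?thesis
      using ping_pong_word[OF ping_pong_loxodromic[OF assms] set_replicate_subset, of n g]
        foldr_mult_replicate[OF assms(1), of n] by simp
  qed
  then show "gp p (\<phi> (inv g) p) (\<phi> (g [^] n) p) \<le> ?A + int \<Delta>" .
  assume "0 < n"
  then obtain k where k: "n = Suc k" using gr0_implies_Suc by blast
  have gn: "\<phi> (g [^] n) p = \<phi> g (\<phi> (g [^] k) p)"
    using nat_pow_Suc2[of g k] act_mult[of g "g [^] k" p] assms k by simp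
  have "gp (\<phi> g p) p (\<phi> (g [^] n) p) = gp p (\<phi> (inv g) p) (\<phi> (g [^] k) p)"
    using gp_act[of g p "\<phi> (inv g) p" "\<phi> (g [^] k) p"] assms gn by simp
  then have "gp (\<phi> g p) p (\<phi> (g [^] n) p) \<le> ?A + int \<Delta>" using *[of k] by simp
  moreover have "gp p (\<phi> g p) (\<phi> (g [^] n) p) + gp (\<phi> g p) p (\<phi> (g [^] n) p) = 2 * int (d p (\<phi> g p))"
    using gp_add_swap assms by simp
  ultimately show "2 * int (d p (\<phi> g p)) - ?A - int \<Delta> \<le> gp p (\<phi> g p) (\<phi> (g [^] n) p)"
    by linarith
qed

end

section \<open>The axis of a loxodromic element and its translates\<close>

locale loxodromic_axis = hyperbolic_graph_action V E G \<phi> \<Delta>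
  for V :: "'v set" and E and G (structure) and \<phi> and \<Delta> +
  fixes g p
  assumes g: "g \<in> carrier G" and p: "p \<in> V" and lox: "loxodromic_at g p"
begin

text \<open>Not a geodesic, but the orbit of \<open>p\<close> under the powers of \<open>g\<close>;
  integer indices make translation by \<open>g\<close> a shift.\<close>

definition axis :: "int \<Rightarrow> 'v" where "axis i = \<phi> (g [^] i) p"

definition axis_const :: int where
  "axis_const = gp p (\<phi> (inv g) p) (\<phi> g p) + 2 * int \<Delta>"

lemma axis_in [simp]: "axis i \<in> V"
  using g p by (simp add: axis_def)

lemma axis_0 [simp]: "axis 0 = p"
  using p by (simp add: axis_def)

lemma act_axis: "\<phi> (g [^] i) (axis j) = axis (i + j)"
  using g p by (simp add: axis_def int_pow_mult act_mult)

lemma axis_nat: "axis (int n) = \<phi> (g [^] n) p"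
  by (simp add: axis_def int_pow_int)

lemma axis_neg_nat: "axis (- int n) = \<phi> ((inv g) [^] n) p"
  using g by (simp add: axis_def int_pow_neg int_pow_int nat_pow_inv)

lemma d_axis_shift: "d (axis (k + i)) (axis (k + j)) = d (axis i) (axis j)"
  using d_act[of "g [^] k" "axis i" "axis j"] g by (simp add: act_axis)

lemma d_axis_neg: "d p (axis (- i)) = d p (axis i)"
  using d_axis_shift[of i "- i" 0] d_sym[of p "axis i"] d_sym[of p "axis (- i)"] p by simp

lemma d_axis_ge: "\<bar>i\<bar> \<le> int (d p (axis i))"
proof -
  have "int n \<le> int (d p (axis (int n)))" for n
    using loxodromic_pow_dist[OF g p lox, of n] by (simp add: axis_nat)
  from this[of "nat \<bar>i\<bar>"] show ?thesis
    using d_axis_neg[of i] by (cases "0 \<le> i") auto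
qed

lemma axis_const_nonneg: "0 \<le> axis_const"
  unfolding axis_const_def using gp_nonneg[of p "\<phi> (inv g) p" "\<phi> g p"] g p by simp

text \<open>The point \<open>?u\<close> shows the direction of all negative powers, and its product
  with positive powers is controlled by ping-pong. \<open>gp_min\<close> carries that bound over to
  \<open>axis (- i)\<close> at the cost of one more \<open>\<Delta>\<close>.\<close>

lemma gp_axis_ends:
  assumes "0 \<le> i" "0 \<le> j"
  shows "gp p (axis (- i)) (axis j) \<le> axis_const"
proof -
  let ?A = "gp p (\<phi> (inv g) p) (\<phi> g p)"
  let ?m = "nat i" and ?n = "nat j"
  let ?x = "axis (- i)" and ?y = "axis j"
  have x: "?x = \<phi> ((inv g) [^] ?m) p" and y: "?y = \<phi> (g [^] ?n) p"
    using axis_neg_nat[of ?m] axis_nat[of ?n] assms by simp_all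
  show ?thesis
  proof (cases "?m = 0")
    case True
    then have "?x = p" using x p by simp
    then show ?thesis using gp_self_left p axis_const_nonneg by simp
  next
    case False
    let ?u = "\<phi> (inv g) p"
    have ig: "inv g \<in> carrier G" using g by simp
    have uy: "gp p ?u ?y \<le> ?A + int \<Delta>" using loxodromic_gp_pow(1)[OF g p lox, of ?n] y by simp
    have "2 * int (d p ?u) - gp p (\<phi> (inv (inv g)) p) ?u - int \<Delta> \<le> gp p ?u ?x"
      using loxodromic_gp_pow(2)[OF ig p loxodromic_inv[OF g p lox], of ?m] False x by simp
    then have "2 * int (d p (\<phi> g p)) - ?A - int \<Delta> \<le> gp p ?u ?x"
      using g p gp_commute[of ?u "\<phi> g p" p] act_eq_dist[of g p] by simp
    moreover have "?A + 2 * int \<Delta> < int (d p (\<phi> g p))" using lox by (simp add: loxodromic_at_def)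
    moreover have "0 \<le> ?A" using gp_nonneg g p by simp
    ultimately have "?A + 2 * int \<Delta> < gp p ?u ?x" by linarith
    moreover have "min (gp p ?u ?x) (gp p ?x ?y) - int \<Delta> \<le> gp p ?u ?y"
      using gp_min[of p ?u ?x ?y] g p by simp
    ultimately show ?thesis using uy unfolding axis_const_def by linarith
  qed
qed

lemma gp_axis:
  assumes "i \<le> j" "j \<le> k"
  shows "gp (axis j) (axis i) (axis k) \<le> axis_const"
proof -
  have "gp (axis j) (axis i) (axis k) = gp p (axis (- (j - i))) (axis (k - j))"
    using gp_act[of "g [^] j" p "axis (i - j)" "axis (k - j)"] act_axis[of j "i - j"] act_axis[of j "k - j"]
      act_axis[of j 0] g p by simp
  then show ?thesis using gp_axis_ends[of "j - i" "k - j"] assms by simp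
qed

text \<open>Some axis point \<open>?w\<close> is about as far from the left end \<open>?u\<close> as
  \<open>z\<close> is. Both \<open>z\<close> and \<open>?w\<close> see the two ends with a small
  product, so they lie at about the same place along a geodesic between the ends, and the four-point
  inequality makes them close.\<close>

lemma close_to_axis:
  assumes z: "z \<in> V" and c: "axis_const \<le> c" and gp: "gp z (axis (- int n)) (axis (int n)) \<le> c"
  shows "\<exists>i. int (d z (axis i)) \<le> 2 * c + int (d p (axis 1)) + int \<Delta>"
proof -
  let ?u = "axis (- int n)" and ?v = "axis (int n)" and ?l = "int (d p (axis 1))"
  define f where "f i = int (d ?u (axis (int i - int n)))" for i :: nat
  let ?t = "int (d ?u z)" and ?T = "int (d ?u ?v)"
  have f0: "f 0 = 0" unfolding f_def by simp
  have fT: "f (2 * n) = ?T" unfolding f_def by simp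
  have step: "f (Suc i) \<le> f i + ?l" for i
  proof -
    have "d ?u (axis (int (Suc i) - int n)) \<le> d ?u (axis (int i - int n)) + d (axis (int i - int n)) (axis (int (Suc i) - int n))"
      by (rule d_triangle) simp_all
    moreover have "d (axis (int i - int n)) (axis (int (Suc i) - int n)) = d p (axis 1)"
      using d_axis_shift[of "int i - int n" 0 1] by (simp add: algebra_simps)
    ultimately show ?thesis unfolding f_def by simp
  qed
  have c0: "0 \<le> c" using c axis_const_nonneg by simp
  have zuv: "int (d z ?u) + int (d z ?v) - ?T \<le> c" using gp unfolding gp_def .
  have zu: "int (d z ?u) = ?t" using d_sym z by simp
  have "\<exists>i\<le>2 * n. \<bar>f i - ?t\<bar> \<le> ?l + c"
  proof (cases "?t \<le> ?T")
    case True
    \<comment> \<open>A discrete intermediate value argument: \<open>f\<close> starts at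
      \<open>0\<close>, ends at \<open>?T\<close> and rises by at most \<open>?l\<close> per
      step.\<close>
    define i where "i = (LEAST i. ?t \<le> f i)"
    have ex: "?t \<le> f (2 * n)" using True fT by simp
    have i: "?t \<le> f i" unfolding i_def using ex by (rule LeastI)
    have "i \<le> 2 * n" unfolding i_def using ex by (rule Least_le)
    moreover have "f i \<le> ?t + ?l"
    proof (cases i)
      case 0
      then show ?thesis using f0 by simp
    next
      case (Suc k)
      then have "\<not> ?t \<le> f k" using not_less_Least[of k "\<lambda>i. ?t \<le> f i"] i_def by simp
      then show ?thesis using step[of k] Suc by simp
    qed
    ultimately show ?thesis using i c0 by auto
  next
    case False
    moreover have "?t - ?T \<le> c" using zuv zu by linarith
    ultimately show ?thesis using fT by (intro exI[of _ "2 * n"]) auto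
  qed
  then obtain i where i: "i \<le> 2 * n" "\<bar>f i - ?t\<bar> \<le> ?l + c" by blast
  let ?w = "axis (int i - int n)"
  have "gp ?w ?u ?v \<le> c" using gp_axis[of "- int n" "int i - int n" "int n"] i(1) c by simp
  then have w: "f i + int (d ?w ?v) - ?T \<le> c"
    unfolding gp_def f_def using d_sym[of ?w ?u] by simp
  have "d z ?w + d ?u ?v \<le> max (d z ?u + d ?w ?v) (d z ?v + d ?w ?u) + \<Delta>"
    using four_point[of z ?w ?u ?v] z by simp
  moreover have "int (d ?w ?u) = f i" unfolding f_def using d_sym by simp
  ultimately have "int (d z ?w) \<le> 2 * c + ?l + int \<Delta>"
    using w zuv zu i(2) by linarith
  then show ?thesis by blast
qed

text \<open>For each choice of signs, failure of ping-pong makes one of three pairs of directions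
  close. The margin \<open>\<Delta>\<close> in \<open>ga\<close> and \<open>gb\<close> prevents a
  direction from being close to two opposite ones. So if, say, \<open>a\<close> and \<open>b\<close>
  point the same way, the pair \<open>inv a\<close>, \<open>inv b\<close> forces the inverses to do
  so as well.\<close>

lemma ends_matched:
  assumes a: "a \<in> carrier G" and b: "b \<in> carrier G"
    and nf: "\<not> free_pair G a b" "\<not> free_pair G a (inv b)" "\<not> free_pair G (inv a) b" "\<not> free_pair G (inv a) (inv b)"
    and ga: "gp p (\<phi> (inv a) p) (\<phi> a p) \<le> A - int \<Delta>" and gb: "gp p (\<phi> (inv b) p) (\<phi> b p) \<le> A - int \<Delta>"
    and da: "A + int \<Delta> < int (d p (\<phi> a p))" and db: "A + int \<Delta> < int (d p (\<phi> b p))"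
  shows "A < gp p (\<phi> a p) (\<phi> b p) \<and> A < gp p (\<phi> (inv a) p) (\<phi> (inv b) p) \<or>
    A < gp p (\<phi> a p) (\<phi> (inv b) p) \<and> A < gp p (\<phi> (inv a) p) (\<phi> b p)"
proof -
  have clause: "A < gp p (\<phi> (inv x) p) (\<phi> y p) \<or> A < gp p (\<phi> x p) (\<phi> (inv y) p) \<or> A < gp p (\<phi> x p) (\<phi> y p)"
    if x: "x \<in> {a, inv a}" and y: "y \<in> {b, inv b}" and nf: "\<not> free_pair G x y" for x y
  proof (rule ccontr)
    assume neg: "\<not> ?thesis"
    have c: "x \<in> carrier G" "y \<in> carrier G" using x y a b by auto
    have "int (d p (\<phi> x p)) = int (d p (\<phi> a p))" "int (d p (\<phi> y p)) = int (d p (\<phi> b p))"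
      using x y act_eq_dist[OF a p] act_eq_dist[OF b p] by auto
    moreover have "gp p (\<phi> (inv x) p) (\<phi> x p) = gp p (\<phi> (inv a) p) (\<phi> a p)"
      "gp p (\<phi> (inv y) p) (\<phi> y p) = gp p (\<phi> (inv b) p) (\<phi> b p)"
      using x y a b p gp_commute[of "\<phi> a p" "\<phi> (inv a) p" p] gp_commute[of "\<phi> b p" "\<phi> (inv b) p" p] by auto
    moreover have "gp p (\<phi> (inv y) p) (\<phi> x p) = gp p (\<phi> x p) (\<phi> (inv y) p)"
      using gp_commute c p by simp
    ultimately have "ping_pong {x, y} A p"
      using neg ga gb da db c p \<Delta>_pos by (auto simp: ping_pong_def)
    then show False using ping_pong_free_pair neg nf by fastforce
  qed
  have excl1: "\<not> (A < gp p z (\<phi> b p) \<and> A < gp p z (\<phi> (inv b) p))" if "z \<in> V" for z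
    using gp_min[of p "\<phi> (inv b) p" z "\<phi> b p"] gp_commute[of z "\<phi> (inv b) p" p] that gb b p by auto
  have excl2: "\<not> (A < gp p (\<phi> a p) z \<and> A < gp p (\<phi> (inv a) p) z)" if "z \<in> V" for z
    using gp_min[of p "\<phi> (inv a) p" z "\<phi> a p"] gp_commute[of z "\<phi> a p" p] that ga a p by auto
  show ?thesis
    using clause[of a b] clause[of a "inv b"] clause[of "inv a" b] clause[of "inv a" "inv b"] nf
      excl1[of "\<phi> a p"] excl1[of "\<phi> (inv a) p"] excl2[of "\<phi> b p"] excl2[of "\<phi> (inv b) p"] a b p
    by auto
qed

text \<open>The bound of \<open>close_to_axis\<close> for
  \<open>c = axis_const + 2 * \<Delta>\<close>.\<close>

definition axis_radius :: int where
  "axis_radius = 2 * (axis_const + 2 * int \<Delta>) + int (d p (axis 1)) + int \<Delta>"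

text \<open>
  For large \<open>k\<close>, the lemma \<open>ends_matched\<close> is applied to \<open>a = g^k\<close> and \<open>b = h g^k h^-1\<close>: the two ends of
  the axis fellow-travel with the two ends of its translate by \<open>h\<close>, so \<open>\<phi> h p\<close> lies near a geodesic
  between far away points of the axis. The bound does not depend on \<open>h\<close>.
\<close>

lemma no_free_pair_close_to_axis:
  assumes H: "subgroup H G" "g \<in> H" "h \<in> H" and nf: "\<forall>a\<in>H. \<forall>b\<in>H. \<not> free_pair G a b"
  shows "\<exists>i. int (d (\<phi> h p) (axis i)) \<le> axis_radius"
proof -
  interpret H: subgroup H G by fact
  let ?e = "int (d p (\<phi> h p))"
  \<comment> \<open>Each change of base point between \<open>p\<close> and \<open>?z\<close>, and
    each replacement of \<open>\<phi> ?b p\<close> by \<open>\<phi> h ?u\<close>, costs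
    \<open>2 * ?e\<close>. \<open>A\<close> and \<open>k\<close> absorb these costs, so that
    \<open>?e\<close> does not enter the final radius.\<close>
  define A where "A = 2 * axis_const + 8 * ?e + 4 * int \<Delta>"
  define k where "k = nat (A + int \<Delta> + 2 * ?e + 1)"
  have A0: "0 \<le> A" unfolding A_def using axis_const_nonneg by simp
  then have k: "int k = A + int \<Delta> + 2 * ?e + 1" unfolding k_def by simp
  let ?a = "g [^] k"
  let ?b = "h \<otimes> ?a \<otimes> inv h"
  let ?z = "\<phi> h p" and ?u = "axis (int k)" and ?v = "axis (- int k)"
  have c: "h \<in> carrier G" "?a \<in> carrier G" "?b \<in> carrier G" "?z \<in> V" using H g p by auto
  have aH: "?a \<in> H"
    using subgroup_int_pow_closed[OF H(1,2), of "int k"] by (simp add: int_pow_int)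
  have bH: "?b \<in> H" using aH H(3) by simp
  have au: "\<phi> ?a p = ?u" by (simp add: axis_nat)
  have av: "\<phi> (inv ?a) p = ?v" using g by (simp add: axis_neg_nat nat_pow_inv)
  have binv: "inv ?b = h \<otimes> inv ?a \<otimes> inv h" using c by (simp add: inv_mult_group m_assoc)
  have act_b: "\<phi> ?b p = \<phi> h (\<phi> ?a (\<phi> (inv h) p))" "\<phi> (inv ?b) p = \<phi> h (\<phi> (inv ?a) (\<phi> (inv h) p))"
    unfolding binv using c p by (simp_all add: act_mult)
  have hp: "int (d (\<phi> (inv h) p) p) = ?e"
    using act_eq_dist[OF c(1) p] d_sym[of p "\<phi> (inv h) p"] c p by simp
  have bu: "int (d (\<phi> ?b p) (\<phi> h ?u)) = ?e"
    unfolding act_b au[symmetric] using d_act c p hp by simp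
  have bv: "int (d (\<phi> (inv ?b) p) (\<phi> h ?v)) = ?e"
    unfolding act_b av[symmetric] using d_act c p hp by simp
  have V: "\<phi> ?b p \<in> V" "\<phi> (inv ?b) p \<in> V" "\<phi> h ?u \<in> V" "\<phi> h ?v \<in> V" using c p by simp_all
  have uv: "gp p ?v ?u \<le> axis_const" using gp_axis_ends[of "int k" "int k"] by simp
  have huv: "gp ?z (\<phi> h ?v) (\<phi> h ?u) \<le> axis_const" using gp_act c p uv by simp
  have ga: "gp p (\<phi> (inv ?a) p) (\<phi> ?a p) \<le> A - int \<Delta>"
    unfolding au av A_def using uv axis_const_nonneg by simp
  have gb: "gp p (\<phi> (inv ?b) p) (\<phi> ?b p) \<le> A - int \<Delta>"
  proof -
    have "gp p (\<phi> (inv ?b) p) (\<phi> ?b p) \<le> gp p (\<phi> h ?v) (\<phi> ?b p) + 2 * ?e"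
      using gp_change_left[OF p V(2,1,4)] bv by simp
    also have "gp p (\<phi> h ?v) (\<phi> ?b p) \<le> gp p (\<phi> h ?v) (\<phi> h ?u) + 2 * ?e"
      using gp_change_right[OF p V(4,1,3)] bu by simp
    also have "gp p (\<phi> h ?v) (\<phi> h ?u) \<le> gp ?z (\<phi> h ?v) (\<phi> h ?u) + 2 * ?e"
      using gp_change_base[OF p c(4) V(4,3)] by simp
    finally show ?thesis using huv axis_const_nonneg unfolding A_def by simp
  qed
  have da: "A + int \<Delta> < int (d p (\<phi> ?a p))"
    using d_axis_ge[of "int k"] k unfolding au by simp
  have db: "A + int \<Delta> < int (d p (\<phi> ?b p))"
  proof -
    have "d ?z (\<phi> h ?u) \<le> d ?z p + d p (\<phi> h ?u)" using d_triangle c p V by blast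
    moreover have "d p (\<phi> h ?u) \<le> d p (\<phi> ?b p) + d (\<phi> ?b p) (\<phi> h ?u)" using d_triangle p V by blast
    moreover have "d ?z (\<phi> h ?u) = d p ?u" using d_act c p by simp
    moreover have "d ?z p = d p ?z" using d_sym c p by blast
    ultimately show ?thesis using d_axis_ge[of "int k"] k bu by linarith
  qed
  have "A < gp p ?u (\<phi> ?b p) \<and> A < gp p ?v (\<phi> (inv ?b) p) \<or>
      A < gp p ?u (\<phi> (inv ?b) p) \<and> A < gp p ?v (\<phi> ?b p)"
    using ends_matched[OF c(2,3) _ _ _ _ ga gb da db] nf aH bH unfolding au av by simp
  then have "A - 4 * ?e < gp ?z ?u (\<phi> h ?u) \<and> A - 4 * ?e < gp ?z ?v (\<phi> h ?v) \<or>
      A - 4 * ?e < gp ?z ?u (\<phi> h ?v) \<and> A - 4 * ?e < gp ?z ?v (\<phi> h ?u)"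
  proof -
    have "gp p x y \<le> gp ?z x y' + 4 * ?e" if "x \<in> V" "y \<in> V" "y' \<in> V" "int (d y y') = ?e" for x y y'
      using gp_change_base[OF p c(4) that(1,2)] gp_change_right[OF c(4) that(1,2,3)] that(4) by simp
    then show ?thesis
      using \<open>_ \<or> _\<close> V bu bv by (smt (verit) axis_in)
  qed
  moreover have "axis_const + 2 * int \<Delta> \<le> A - 4 * ?e" unfolding A_def using axis_const_nonneg by simp
  ultimately have "axis_const + 2 * int \<Delta> < gp ?z (\<phi> h ?v) ?v \<and> axis_const + 2 * int \<Delta> < gp ?z (\<phi> h ?u) ?u \<or>
      axis_const + 2 * int \<Delta> < gp ?z (\<phi> h ?u) ?v \<and> axis_const + 2 * int \<Delta> < gp ?z (\<phi> h ?v) ?u"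
    using gp_commute[of _ _ ?z] V by auto
  \<comment> \<open>The ends of the translated axis diverge at \<open>?z\<close> by
    \<open>huv\<close>; being matched with the ends of the axis, they make those diverge at
    \<open>?z\<close> too.\<close>
  then have "gp ?z ?v ?u \<le> axis_const + 2 * int \<Delta>"
    using gp_transfer[OF c(4) V(4,3), of ?v ?u axis_const] gp_transfer[OF c(4) V(3,4), of ?v ?u axis_const]
      huv gp_commute[OF V(3,4), of ?z] by auto
  then show ?thesis
    using close_to_axis[OF c(4), of "axis_const + 2 * int \<Delta>" k] unfolding axis_radius_def by simp
qed

text \<open>A power of \<open>g\<close> moves \<open>\<phi> h p\<close> near \<open>p\<close>, so it
  remains to count elements \<open>f\<close> that move \<open>p\<close> little. Such an
  \<open>f\<close> sends the distant axis point \<open>?y\<close> near some \<open>axis j\<close>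
  with \<open>\<bar>j\<bar>\<close> at most \<open>J\<close>, and for each \<open>j\<close>
  acylindricity leaves finitely many \<open>f\<close>.\<close>

lemma no_free_pair_finite_transversal:
  assumes H: "subgroup H G" "g \<in> H" and nf: "\<forall>a\<in>H. \<forall>b\<in>H. \<not> free_pair G a b"
  shows "\<exists>F. finite F \<and> F \<subseteq> H \<and> (\<forall>h\<in>H. \<exists>i::int. \<exists>f\<in>F. h = g [^] i \<otimes> f)"
proof -
  interpret H: subgroup H G by fact
  define D where "D = nat axis_radius"
  have close: "\<exists>i. d (\<phi> h p) (axis i) \<le> D" if "h \<in> H" for h
  proof -
    obtain i where "int (d (\<phi> h p) (axis i)) \<le> axis_radius"
      using no_free_pair_close_to_axis[OF H \<open>h \<in> H\<close> nf] by blast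
    then have "d (\<phi> h p) (axis i) \<le> D" unfolding D_def by linarith
    then show ?thesis by blast
  qed
  obtain R N where RN: "\<And>x y. x \<in> V \<Longrightarrow> y \<in> V \<Longrightarrow> R \<le> d x y \<Longrightarrow>
    finite {g \<in> carrier G. d x (\<phi> g x) \<le> 2 * D \<and> d y (\<phi> g y) \<le> 2 * D} \<and>
    card {g \<in> carrier G. d x (\<phi> g x) \<le> 2 * D \<and> d y (\<phi> g y) \<le> 2 * D} \<le> N"
    using acylindrical[of "2 * D"] by blast
  let ?y = "axis (int R)"
  have "R \<le> d p ?y" using d_axis_ge[of "int R"] by simp
  then have fin: "finite {g \<in> carrier G. d p (\<phi> g p) \<le> 2 * D \<and> d ?y (\<phi> g ?y) \<le> 2 * D}"
    using RN p by simp
  define J where "J = int (2 * D + d p ?y)"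
  define Fj where "Fj j = {f \<in> H. d (\<phi> f p) p \<le> D \<and> d (\<phi> f ?y) (axis j) \<le> D}" for j
  have finFj: "finite (Fj j)" for j
  proof (cases "Fj j = {}")
    case False
    then obtain f0 where f0: "f0 \<in> Fj j" by blast
    have "(\<lambda>f. inv f0 \<otimes> f) ` Fj j \<subseteq> {g \<in> carrier G. d p (\<phi> g p) \<le> 2 * D \<and> d ?y (\<phi> g ?y) \<le> 2 * D}"
    proof (intro image_subsetI CollectI conjI)
      fix f assume f: "f \<in> Fj j"
      have m: "f0 \<in> H" "f \<in> H" using f f0 by (auto simp: Fj_def)
      then show "inv f0 \<otimes> f \<in> carrier G" by simp
      have "d (\<phi> f0 x) (\<phi> f x) \<le> 2 * D" if "x \<in> V" "z \<in> V" "d (\<phi> f0 x) z \<le> D" "d (\<phi> f x) z \<le> D" for x z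
        using d_triangle[of "\<phi> f0 x" z "\<phi> f x"] d_sym[of z "\<phi> f x"] that m by simp
      from this[of p p] this[of ?y "axis j"]
      have "d (\<phi> f0 p) (\<phi> f p) \<le> 2 * D" "d (\<phi> f0 ?y) (\<phi> f ?y) \<le> 2 * D"
        using f f0 p by (auto simp: Fj_def)
      then show "d p (\<phi> (inv f0 \<otimes> f) p) \<le> 2 * D" "d ?y (\<phi> (inv f0 \<otimes> f) ?y) \<le> 2 * D"
        using orbit_dist(1)[OF H(1) m p p] orbit_dist(1)[OF H(1) m, of ?y ?y] by simp_all
    qed
    moreover have "inj_on (\<lambda>f. inv f0 \<otimes> f) (Fj j)"
      using f0 by (auto simp: inj_on_def Fj_def)
    ultimately show ?thesis using fin inj_on_finite by blast
  qed simp
  let ?F = "\<Union>j\<in>{-J..J}. Fj j"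
  have "\<exists>i::int. \<exists>f\<in>?F. h = g [^] i \<otimes> f" if h: "h \<in> H" for h
  proof -
    obtain i where i: "d (\<phi> h p) (axis i) \<le> D" using close h by blast
    let ?f = "g [^] (- i) \<otimes> h"
    have gi: "g [^] i \<in> H" "g [^] (- i) \<in> H" for i :: int using subgroup_int_pow_closed[OF H] by blast+
    have f: "?f \<in> H" using h gi by simp
    have "d (\<phi> ?f p) p = d (\<phi> h p) (axis i)"
      using d_act[of "g [^] (- i)" "\<phi> h p" "axis i"] act_axis[of "- i" i] h g p by (simp add: act_mult)
    then have fp: "d (\<phi> ?f p) p \<le> D" using i by simp
    \<comment> \<open>\<open>close\<close> speaks of images of \<open>p\<close> only; composing with
      \<open>g [^] (int R)\<close> makes it apply to \<open>?y\<close>.\<close>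
    have "?f \<otimes> g [^] (int R) \<in> H" using f gi by simp
    then obtain j where j: "d (\<phi> (?f \<otimes> g [^] (int R)) p) (axis j) \<le> D" using close by blast
    have fy: "\<phi> (?f \<otimes> g [^] (int R)) p = \<phi> ?f ?y"
      using act_mult[of ?f "g [^] (int R)" p] f g p by (simp add: axis_def)
    have V: "\<phi> ?f p \<in> V" "\<phi> ?f ?y \<in> V" using f p by simp_all
    have "d p (axis j) \<le> d p (\<phi> ?f ?y) + d (\<phi> ?f ?y) (axis j)" using d_triangle p V axis_in by blast
    moreover have "d p (\<phi> ?f ?y) \<le> d p (\<phi> ?f p) + d (\<phi> ?f p) (\<phi> ?f ?y)" using d_triangle p V by blast
    moreover have "d (\<phi> ?f p) (\<phi> ?f ?y) = d p ?y" using d_act f p by simp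
    moreover have "d p (\<phi> ?f p) = d (\<phi> ?f p) p" using d_sym p V by blast
    ultimately have "int (d p (axis j)) \<le> J" using fp j fy unfolding J_def by simp
    then have "j \<in> {-J..J}" using d_axis_ge[of j] by auto
    moreover have "?f \<in> Fj j" using f fp j fy unfolding Fj_def by simp
    ultimately have "?f \<in> ?F" by blast
    moreover have "h = g [^] i \<otimes> ?f"
      using g h by (simp add: m_assoc[symmetric] int_pow_mult[symmetric])
    ultimately show ?thesis by blast
  qed
  moreover have "finite ?F" using finFj by blast
  moreover have "?F \<subseteq> H" by (auto simp: Fj_def)
  ultimately show ?thesis by blast
qed

end

section \<open>Word length\<close>

context group
begin

lemma foldr_mult_append:
  "set xs \<subseteq> carrier G \<Longrightarrow> set ys \<subseteq> carrier G \<Longrightarrow>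
    foldr (\<otimes>) (xs @ ys) \<one> = foldr (\<otimes>) xs \<one> \<otimes> foldr (\<otimes>) ys \<one>"
  by (induction xs) (auto simp: m_assoc foldr_mult_closed simp del: foldr_append)

lemma word_length_le: "set xs \<subseteq> S \<Longrightarrow> word_length G S (foldr (\<otimes>) xs \<one>) \<le> length xs"
  unfolding word_length_def by (rule Least_le) blast

lemma ex_word:
  assumes S: "fin_sym_gen_set G S" and g: "g \<in> carrier G"
  obtains xs where "set xs \<subseteq> S" "foldr (\<otimes>) xs \<one> = g" "length xs = word_length G S g"
proof -
  have SG: "S \<subseteq> carrier G" using S by (simp add: fin_sym_gen_set_def)
  have "g \<in> generate G S" using S g by (simp add: fin_sym_gen_set_def)
  then have "\<exists>xs. set xs \<subseteq> S \<and> foldr (\<otimes>) xs \<one> = g"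
  proof (induction rule: generate.induct)
    case one
    show ?case by (rule exI[of _ "[]"]) simp
  next
    case (incl h)
    then show ?case using SG by (intro exI[of _ "[h]"]) auto
  next
    case (inv h)
    then have "inv h \<in> S" using S by (simp add: fin_sym_gen_set_def)
    then show ?case using SG by (intro exI[of _ "[inv h]"]) auto
  next
    case (eng h k)
    then obtain xs ys where "set xs \<subseteq> S" "foldr (\<otimes>) xs \<one> = h" "set ys \<subseteq> S" "foldr (\<otimes>) ys \<one> = k"
      by blast
    then show ?case using SG foldr_mult_append[of xs ys] by (intro exI[of _ "xs @ ys"]) (simp del: foldr_append)
  qed
  then have "\<exists>n xs. length xs = n \<and> set xs \<subseteq> S \<and> foldr (\<otimes>) xs \<one> = g" by blast
  then have "\<exists>xs. length xs = word_length G S g \<and> set xs \<subseteq> S \<and> foldr (\<otimes>) xs \<one> = g"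
    unfolding word_length_def by (rule LeastI_ex)
  then show ?thesis using that by blast
qed

lemma word_length_mult:
  assumes S: "fin_sym_gen_set G S" and g: "g \<in> carrier G" "h \<in> carrier G"
  shows "word_length G S (g \<otimes> h) \<le> word_length G S g + word_length G S h"
proof -
  have SG: "S \<subseteq> carrier G" using S by (simp add: fin_sym_gen_set_def)
  obtain xs where xs: "set xs \<subseteq> S" "foldr (\<otimes>) xs \<one> = g" "length xs = word_length G S g"
    by (rule ex_word[OF S g(1)])
  obtain ys where ys: "set ys \<subseteq> S" "foldr (\<otimes>) ys \<one> = h" "length ys = word_length G S h"
    by (rule ex_word[OF S g(2)])
  have "foldr (\<otimes>) (xs @ ys) \<one> = g \<otimes> h"
    using foldr_mult_append[of xs ys] xs ys SG by (simp del: foldr_append)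
  then show ?thesis using word_length_le[of "xs @ ys" S] xs ys by simp
qed

lemma word_length_foldr:
  assumes S: "fin_sym_gen_set G S" and xs: "set xs \<subseteq> carrier G" "\<And>x. x \<in> set xs \<Longrightarrow> word_length G S x \<le> q"
  shows "word_length G S (foldr (\<otimes>) xs \<one>) \<le> q * length xs"
  using xs
proof (induction xs)
  case Nil
  show ?case using word_length_le[of "[]" S] by simp
next
  case (Cons x xs)
  have "word_length G S (x \<otimes> foldr (\<otimes>) xs \<one>) \<le> word_length G S x + word_length G S (foldr (\<otimes>) xs \<one>)"
    using Cons.prems foldr_mult_closed by (intro word_length_mult[OF S]) auto
  moreover have "word_length G S (foldr (\<otimes>) xs \<one>) \<le> q * length xs" using Cons by simp
  moreover have "word_length G S x \<le> q" using Cons.prems by simp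
  ultimately show ?case by simp
qed

text \<open>Makes \<open>w\<close> bounded on balls, so that the suprema measuring its growth are
  genuine upper bounds.\<close>

lemma finite_word_ball:
  assumes S: "fin_sym_gen_set G S"
  shows "finite {g \<in> carrier G. word_length G S g \<le> n}"
proof (rule finite_subset)
  show "{g \<in> carrier G. word_length G S g \<le> n} \<subseteq>
    (\<lambda>xs. foldr (\<otimes>) xs \<one>) ` {xs. set xs \<subseteq> S \<and> length xs \<le> n}"
  proof
    fix g assume "g \<in> {g \<in> carrier G. word_length G S g \<le> n}"
    then have g: "g \<in> carrier G" "word_length G S g \<le> n" by auto
    obtain xs where "set xs \<subseteq> S" "foldr (\<otimes>) xs \<one> = g" "length xs = word_length G S g"
      by (rule ex_word[OF S g(1)])
    then show "g \<in> (\<lambda>xs. foldr (\<otimes>) xs \<one>) ` {xs. set xs \<subseteq> S \<and> length xs \<le> n}"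
      using g(2) by (intro image_eqI[of _ _ xs]) auto
  qed
  show "finite ((\<lambda>xs. foldr (\<otimes>) xs \<one>) ` {xs. set xs \<subseteq> S \<and> length xs \<le> n})"
    using S finite_lists_length_le by (auto simp: fin_sym_gen_set_def)
qed

section \<open>The norm on the group algebra\<close>

lemma mem_conj_subgroup:
  assumes "subgroup K G" "g \<in> carrier G" "x \<in> carrier G"
  shows "x \<in> conj_subgroup G g K \<longleftrightarrow> inv g \<otimes> x \<otimes> g \<in> K"
proof
  interpret K: subgroup K G by fact
  assume "x \<in> conj_subgroup G g K"
  then obtain k where k: "k \<in> K" "x = g \<otimes> k \<otimes> inv g"
    by (auto simp: conj_subgroup_def l_coset_def r_coset_def)
  then have "inv g \<otimes> x \<otimes> g = k" using assms by (simp add: m_assoc inv_solve_left')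
  then show "inv g \<otimes> x \<otimes> g \<in> K" using k by simp
next
  assume k: "inv g \<otimes> x \<otimes> g \<in> K"
  have "x = g \<otimes> (inv g \<otimes> x \<otimes> g) \<otimes> inv g" using assms by (simp add: m_assoc[symmetric]) (simp add: m_assoc)
  then show "x \<in> conj_subgroup G g K"
    using k by (auto simp: conj_subgroup_def l_coset_def r_coset_def)
qed

lemma l_coset_eq_iff:
  assumes "subgroup H G" "x \<in> carrier G" "y \<in> carrier G"
  shows "x <# H = y <# H \<longleftrightarrow> inv y \<otimes> x \<in> H"
proof
  assume "x <# H = y <# H"
  then have "x \<in> y <# H" using lcos_self[OF assms(2,1)] by simp
  then show "inv y \<otimes> x \<in> H" using subgroup.lcos_module_imp[OF assms(1) is_group assms(3)] by simp
next
  assume "inv y \<otimes> x \<in> H"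
  then have "x \<in> y <# H" using subgroup.lcos_module_rev[OF assms(1) is_group] assms by simp
  then show "x <# H = y <# H" using l_repr_independence[OF _ assms(3,1)] by simp
qed

lemma mem_lcoset_iff:
  assumes "subgroup H G" "x \<in> lcosets H" "y \<in> carrier G"
  shows "y \<in> x \<longleftrightarrow> y <# H = x"
proof -
  obtain a where a: "a \<in> carrier G" "x = a <# H" using assms(2) unfolding LCOSETS_def by blast
  show ?thesis
    using l_repr_independence[OF _ a(1) assms(1), of y] lcos_self[OF assms(3,1)] a(2) by auto
qed

text \<open>\<open>T\<close> may be larger than the support, so that one index set serves all
  translates occurring in a convolution.\<close>

lemma norm21_finite:
  assumes H: "subgroup H G" and T: "finite T" "T \<subseteq> carrier G" and f: "\<And>g. f g \<noteq> 0 \<Longrightarrow> g \<in> T"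
  shows "norm21 G H f = sqrt (\<Sum>x\<in>(\<lambda>g. g <# H) ` T. (\<Sum>g\<in>{g \<in> T. g <# H = x}. cmod (f g))\<^sup>2)"
proof -
  have sub: "(\<lambda>g. g <# H) ` T \<subseteq> lcosets H" using T by (auto simp: LCOSETS_def)
  have inner: "(\<Sum>\<^sub>\<infinity>g\<in>x. cmod (f g)) = (\<Sum>g\<in>{g \<in> T. g <# H = x}. cmod (f g))" if x: "x \<in> lcosets H" for x
  proof -
    have eq: "{g \<in> T. g <# H = x} = T \<inter> x" using mem_lcoset_iff[OF H x] T by blast
    have "(\<Sum>\<^sub>\<infinity>g\<in>x. cmod (f g)) = (\<Sum>\<^sub>\<infinity>g\<in>T \<inter> x. cmod (f g))"
      using f by (intro infsum_cong_neutral) auto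
    then show ?thesis unfolding eq using T by simp
  qed
  have "(\<Sum>\<^sub>\<infinity>x\<in>lcosets H. (\<Sum>\<^sub>\<infinity>g\<in>x. cmod (f g))\<^sup>2) =
      (\<Sum>\<^sub>\<infinity>x\<in>lcosets H. (\<Sum>g\<in>{g \<in> T. g <# H = x}. cmod (f g))\<^sup>2)"
    by (intro infsum_cong) (simp add: inner)
  also have "\<dots> = (\<Sum>\<^sub>\<infinity>x\<in>(\<lambda>g. g <# H) ` T. (\<Sum>g\<in>{g \<in> T. g <# H = x}. cmod (f g))\<^sup>2)"
  proof (rule infsum_cong_neutral)
    fix x assume "x \<in> lcosets H - (\<lambda>g. g <# H) ` T"
    then have "{g \<in> T. g <# H = x} = {}" by auto
    then show "(\<Sum>g\<in>{g \<in> T. g <# H = x}. cmod (f g))\<^sup>2 = 0" by (simp only: sum.empty) simp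
  qed (use sub in auto)
  finally show ?thesis unfolding norm21_def using T by simp
qed

lemma norm21_translate:
  assumes H: "subgroup H G" and y: "y \<in> carrier G"
  shows "norm21 G H (\<lambda>u. if u \<in> carrier G then f (inv y \<otimes> u) else 0) = norm21 G H f"
proof -
  let ?f = "\<lambda>u. if u \<in> carrier G then f (inv y \<otimes> u) else 0"
  have HG: "H \<subseteq> carrier G" using H subgroup.subset by blast
  have C: "x \<subseteq> carrier G" if "x \<in> lcosets H" for x
    using subgroup.lcosets_carrier[OF H is_group that] .
  have trans: "y <# x \<in> lcosets H" if "x \<in> lcosets H" "y \<in> carrier G" for x y
  proof -
    obtain a where a: "a \<in> carrier G" "x = a <# H"
      using \<open>x \<in> lcosets H\<close> unfolding LCOSETS_def by blast
    then have "y <# x = (y \<otimes> a) <# H" using lcos_m_assoc[OF HG that(2) a(1)] by simp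
    then show ?thesis using a that by (auto simp: LCOSETS_def)
  qed
  have inv: "inv z <# (z <# x) = x" if "x \<subseteq> carrier G" "z \<in> carrier G" for x z
    using lcos_m_assoc[OF that(1), of "inv z" z] lcos_mult_one[OF that(1)] that by simp
  have "bij_betw (\<lambda>x. y <# x) (lcosets H) (lcosets H)"
    by (rule bij_betw_byWitness[where f' = "\<lambda>x. inv y <# x"])
      (use inv[of _ y] inv[of _ "inv y"] trans C y in auto)
  then have "(\<Sum>\<^sub>\<infinity>x\<in>lcosets H. (\<Sum>\<^sub>\<infinity>g\<in>x. cmod (?f g))\<^sup>2) =
      (\<Sum>\<^sub>\<infinity>x\<in>lcosets H. (\<Sum>\<^sub>\<infinity>g\<in>y <# x. cmod (?f g))\<^sup>2)"
    by (rule infsum_reindex_bij_betw[symmetric])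
  also have "\<dots> = (\<Sum>\<^sub>\<infinity>x\<in>lcosets H. (\<Sum>\<^sub>\<infinity>g\<in>x. cmod (f g))\<^sup>2)"
  proof (rule infsum_cong)
    fix x assume x: "x \<in> lcosets H"
    have "bij_betw (\<lambda>g. y \<otimes> g) x (y <# x)"
      using inj_on_cmult[OF y] C[OF x] by (auto simp: bij_betw_def l_coset_def intro: inj_on_subset)
    then have "(\<Sum>\<^sub>\<infinity>g\<in>y <# x. cmod (?f g)) = (\<Sum>\<^sub>\<infinity>g\<in>x. cmod (?f (y \<otimes> g)))"
      by (rule infsum_reindex_bij_betw[symmetric])
    also have "\<dots> = (\<Sum>\<^sub>\<infinity>g\<in>x. cmod (f g))"
      using C[OF x] y by (intro infsum_cong) (auto simp: m_assoc[symmetric])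
    finally show "(\<Sum>\<^sub>\<infinity>g\<in>y <# x. cmod (?f g))\<^sup>2 = (\<Sum>\<^sub>\<infinity>g\<in>x. cmod (f g))\<^sup>2" by simp
  qed
  finally show ?thesis unfolding norm21_def by simp
qed

text \<open>Cauchy-Schwarz over the support of \<open>f\<close>, each translate of
  \<open>\<psi>\<close> having norm one. Since the bound does not depend on \<open>\<psi>\<close>,
  the supremum in \<open>norm_h\<close> is a true upper bound.\<close>

lemma norm21_convolution_le:
  assumes H: "subgroup H G" and f: "f \<in> group_algebra G" and \<psi>: "\<psi> \<in> group_algebra G" "norm21 G H \<psi> = 1"
  shows "norm21 G H (convolution G f \<psi>) \<le> sqrt (real (card {g. f g \<noteq> 0}) * (\<Sum>y\<in>{g. f g \<noteq> 0}. (cmod (f y))\<^sup>2))"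
proof -
  define Y where "Y = {g. f g \<noteq> 0}"
  define Z where "Z = {g. \<psi> g \<noteq> 0}"
  have Y: "finite Y" "Y \<subseteq> carrier G" and Z: "finite Z" "Z \<subseteq> carrier G"
    using f \<psi> by (auto simp: Y_def Z_def group_algebra_def)
  define T where "T = (\<lambda>(y, z). y \<otimes> z) ` (Y \<times> Z)"
  have T: "finite T" "T \<subseteq> carrier G" using Y Z by (auto simp: T_def)
  define L where "L y = (\<lambda>u. if u \<in> carrier G then \<psi> (inv y \<otimes> u) else 0)" for y
  have Ysum: "{y. y \<in> carrier G \<and> f y \<noteq> 0} = Y" using Y by (auto simp: Y_def)
  have conv: "convolution G f \<psi> u = (\<Sum>y\<in>Y. f y * L y u)" for u
    unfolding convolution_def Ysum L_def by simp
  have LT: "u \<in> T" if "L y u \<noteq> 0" "y \<in> Y" for y u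
  proof -
    have u: "u \<in> carrier G" "inv y \<otimes> u \<in> Z" using that by (auto simp: L_def Z_def split: if_splits)
    moreover have "u = y \<otimes> (inv y \<otimes> u)" using that Y u by (auto simp: m_assoc[symmetric])
    ultimately show ?thesis using that(2) unfolding T_def by (intro image_eqI[of _ _ "(y, inv y \<otimes> u)"]) auto
  qed
  have normL: "(\<Sum>x\<in>(\<lambda>g. g <# H) ` T. (\<Sum>u\<in>{g \<in> T. g <# H = x}. cmod (L y u))\<^sup>2) = 1" if "y \<in> Y" for y
  proof -
    have "norm21 G H (L y) = 1" unfolding L_def using norm21_translate[OF H] that Y \<psi> by auto
    then show ?thesis using norm21_finite[OF H T, of "L y"] LT that by simp
  qed
  have convT: "u \<in> T" if "convolution G f \<psi> u \<noteq> 0" for u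
    using that LT unfolding conv by (metis (no_types, lifting) mult_zero_right sum.neutral)
  let ?I = "(\<lambda>g. g <# H) ` T"
  have "(\<Sum>x\<in>?I. (\<Sum>u\<in>{g \<in> T. g <# H = x}. cmod (convolution G f \<psi> u))\<^sup>2)
      \<le> (\<Sum>x\<in>?I. (\<Sum>y\<in>Y. cmod (f y) * (\<Sum>u\<in>{g \<in> T. g <# H = x}. cmod (L y u)))\<^sup>2)"
  proof (intro sum_mono power_mono)
    fix x
    have "(\<Sum>u\<in>{g \<in> T. g <# H = x}. cmod (convolution G f \<psi> u))
        \<le> (\<Sum>u\<in>{g \<in> T. g <# H = x}. \<Sum>y\<in>Y. cmod (f y) * cmod (L y u))"
      unfolding conv by (intro sum_mono order.trans[OF norm_sum]) (simp add: norm_mult)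
    also have "\<dots> = (\<Sum>y\<in>Y. cmod (f y) * (\<Sum>u\<in>{g \<in> T. g <# H = x}. cmod (L y u)))"
      unfolding sum_distrib_left by (rule sum.swap)
    finally show "(\<Sum>u\<in>{g \<in> T. g <# H = x}. cmod (convolution G f \<psi> u))
        \<le> (\<Sum>y\<in>Y. cmod (f y) * (\<Sum>u\<in>{g \<in> T. g <# H = x}. cmod (L y u)))" .
  qed (auto intro: sum_nonneg)
  also have "\<dots> \<le> (\<Sum>x\<in>?I. real (card Y) * (\<Sum>y\<in>Y. (cmod (f y) * (\<Sum>u\<in>{g \<in> T. g <# H = x}. cmod (L y u)))\<^sup>2))"
  proof (intro sum_mono)
    show "(\<Sum>y\<in>Y. cmod (f y) * (\<Sum>u\<in>{g \<in> T. g <# H = x}. cmod (L y u)))\<^sup>2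
      \<le> real (card Y) * (\<Sum>y\<in>Y. (cmod (f y) * (\<Sum>u\<in>{g \<in> T. g <# H = x}. cmod (L y u)))\<^sup>2)" for x
      using sum_squared_le_sum_of_squares[of _ Y] by (simp add: mult.commute)
  qed
  also have "\<dots> = real (card Y) * (\<Sum>y\<in>Y. (cmod (f y))\<^sup>2 * (\<Sum>x\<in>?I. (\<Sum>u\<in>{g \<in> T. g <# H = x}. cmod (L y u))\<^sup>2))"
    unfolding sum_distrib_left[symmetric] power_mult_distrib
    by (subst sum.swap) (simp add: sum_distrib_left)
  also have "\<dots> = real (card Y) * (\<Sum>y\<in>Y. (cmod (f y))\<^sup>2)" using normL by simp
  finally show ?thesis
    using norm21_finite[OF H T convT] by (simp add: Y_def)
qed

lemma norm21_le_norm_h: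
  assumes "subgroup H G" "f \<in> group_algebra G" "\<psi> \<in> group_algebra G" "norm21 G H \<psi> = 1"
  shows "norm21 G H (convolution G f \<psi>) \<le> norm_h G H f"
  unfolding norm_h_def
  by (rule cSup_upper) (use assms norm21_convolution_le in \<open>auto intro!: bdd_aboveI\<close>)

text \<open>
  The test function is the indicator of \<open>F g\<close>. Convolving it with the point mass at \<open>g^-1\<close>
  gives the indicator of \<open>F\<close>, which lives on a single coset; the indicator of \<open>F g\<close> itself is
  spread over many cosets.
\<close>

lemma SLC_card_bound:
  assumes H: "subgroup H G" and F: "finite F" "F \<subseteq> H" "F \<noteq> {}" and g: "g \<in> carrier G"
    and K: "finite (H \<inter> conj_subgroup G g H)"
    and C: "0 < C" "\<And>f. f \<in> group_algebra G \<Longrightarrow> norm_h G H f \<le> C * norm21 G H (\<lambda>x. f x * of_real (w x))"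
    and w: "\<And>h. h \<in> F \<Longrightarrow> 0 \<le> w (h \<otimes> g) \<and> w (h \<otimes> g) \<le> W"
  shows "real (card F) \<le> C\<^sup>2 * real (card (H \<inter> conj_subgroup G g H)) * W\<^sup>2"
proof -
  interpret H: subgroup H G by fact
  let ?K = "H \<inter> conj_subgroup G g H"
  define T where "T = (\<lambda>h. h \<otimes> g) ` F"
  define f :: "'a \<Rightarrow> complex" where "f u = (if u \<in> T then 1 else 0)" for u
  define \<psi> :: "'a \<Rightarrow> complex" where "\<psi> u = (if u = inv g then 1 else 0)" for u
  have FG: "F \<subseteq> carrier G" using F H.subset by blast
  have T: "finite T" "T \<subseteq> carrier G" using F FG g by (auto simp: T_def)
  have fsupp: "{u. f u \<noteq> 0} = T" "\<And>u. f u \<noteq> 0 \<Longrightarrow> u \<in> T" by (auto simp: f_def split: if_splits)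
  have falg: "f \<in> group_algebra G" using T by (simp add: group_algebra_def fsupp(1))
  have \<psi>alg: "\<psi> \<in> group_algebra G" using g by (auto simp: group_algebra_def \<psi>_def)
  have "norm21 G H \<psi> = sqrt (\<Sum>x\<in>(\<lambda>g. g <# H) ` {inv g}. (\<Sum>u\<in>{u \<in> {inv g}. u <# H = x}. cmod (\<psi> u))\<^sup>2)"
    by (rule norm21_finite[OF H]) (use g in \<open>auto simp: \<psi>_def split: if_splits\<close>)
  also have "{u \<in> {inv g}. u <# H = inv g <# H} = {inv g}" by auto
  then have "sqrt (\<Sum>x\<in>(\<lambda>g. g <# H) ` {inv g}. (\<Sum>u\<in>{u \<in> {inv g}. u <# H = x}. cmod (\<psi> u))\<^sup>2) = 1"
    by (simp add: \<psi>_def)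
  finally have n\<psi>: "norm21 G H \<psi> = 1" .
  have conv: "convolution G f \<psi> u = (if u \<in> F then 1 else 0)" for u
  proof (cases "u \<in> carrier G")
    case True
    have Teq: "{y. y \<in> carrier G \<and> f y \<noteq> 0} = T" using T by (auto simp: f_def)
    have eq: "inv y \<otimes> u = inv g \<longleftrightarrow> y = u \<otimes> g" if "y \<in> T" for y
    proof -
      have y: "y \<in> carrier G" using that T by blast
      have "inv y \<otimes> u = inv g \<longleftrightarrow> u = y \<otimes> inv g" using inv_solve_left'[of "inv g" y u] y True g by auto
      also have "\<dots> \<longleftrightarrow> u \<otimes> g = y" using inv_solve_right[of u y g] y True g by auto
      finally show ?thesis by blast
    qed
    have "convolution G f \<psi> u = (\<Sum>y\<in>T. f y * \<psi> (inv y \<otimes> u))"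
      unfolding convolution_def Teq using True by simp
    also have "\<dots> = (\<Sum>y\<in>T. if y = u \<otimes> g then 1 else 0)"
      by (intro sum.cong) (auto simp: f_def \<psi>_def eq)
    also have "\<dots> = (if u \<otimes> g \<in> T then 1 else 0)" using T by simp
    also have "u \<otimes> g \<in> T \<longleftrightarrow> u \<in> F" using FG g True by (auto simp: T_def)
    finally show ?thesis .
  next
    case False
    then show ?thesis using FG by (auto simp: convolution_def)
  qed
  have Fcos: "h <# H = H" if "h \<in> F" for h using that F coset_join3[of h H] H FG by blast
  have "norm21 G H (convolution G f \<psi>) =
      sqrt (\<Sum>x\<in>(\<lambda>g. g <# H) ` F. (\<Sum>u\<in>{u \<in> F. u <# H = x}. cmod (convolution G f \<psi> u))\<^sup>2)"
    by (rule norm21_finite[OF H F(1) FG]) (simp add: conv split: if_splits)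
  also have "(\<lambda>g. g <# H) ` F = {H}" using Fcos F(3) by auto
  also have "(\<Sum>x\<in>{H}. (\<Sum>u\<in>{u \<in> F. u <# H = x}. cmod (convolution G f \<psi> u))\<^sup>2) = (real (card F))\<^sup>2"
  proof -
    have "{u \<in> F. u <# H = H} = F" using Fcos by auto
    then show ?thesis by (simp add: conv)
  qed
  finally have "real (card F) = norm21 G H (convolution G f \<psi>)" by simp
  also have "\<dots> \<le> norm_h G H f" by (rule norm21_le_norm_h[OF H falg \<psi>alg n\<psi>])
  also have "\<dots> \<le> C * norm21 G H (\<lambda>x. f x * of_real (w x))" by (rule C(2)[OF falg])
  also have "norm21 G H (\<lambda>x. f x * of_real (w x)) \<le> sqrt (W\<^sup>2 * real (card ?K) * real (card F))"
  proof -
    let ?Tx = "\<lambda>x. {u \<in> T. u <# H = x}"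
    \<comment> \<open>\<open>h \<otimes> g\<close> and \<open>h0 \<otimes> g\<close> lie in one left
      coset exactly when \<open>inv h0 \<otimes> h\<close> lies in the conjugate of \<open>H\<close>
      by \<open>g\<close>; so a coset meets \<open>T\<close> in at most \<open>card ?K\<close>
      points.\<close>
    have cTx: "card (?Tx x) \<le> card ?K" for x
    proof (cases "?Tx x = {}")
      case True
      show ?thesis unfolding True by simp
    next
      case False
      then obtain h0 where h0: "h0 \<in> F" "(h0 \<otimes> g) <# H = x" by (auto simp: T_def)
      have c0: "h0 \<in> carrier G" "h0 \<in> H" using h0 FG F by auto
      show ?thesis
      proof (rule card_inj_on_le[OF _ _ K])
        show "inj_on (\<lambda>u. inv h0 \<otimes> (u \<otimes> inv g)) (?Tx x)"
        proof (rule inj_onI)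
          fix u v assume "u \<in> ?Tx x" "v \<in> ?Tx x" and eq: "inv h0 \<otimes> (u \<otimes> inv g) = inv h0 \<otimes> (v \<otimes> inv g)"
          then have uv: "u \<in> carrier G" "v \<in> carrier G" using T by auto
          then have "u \<otimes> inv g = v \<otimes> inv g" using eq c0 g by simp
          then show "u = v" using right_cancel[of "inv g" u v] uv g by simp
        qed
        show "(\<lambda>u. inv h0 \<otimes> (u \<otimes> inv g)) ` ?Tx x \<subseteq> ?K"
        proof (rule image_subsetI)
          fix u assume "u \<in> ?Tx x"
          then obtain h where h: "h \<in> F" "u = h \<otimes> g" "(h \<otimes> g) <# H = (h0 \<otimes> g) <# H"
            using h0 by (auto simp: T_def)
          have c: "h \<in> carrier G" "h \<in> H" using h FG F by auto
          have u: "u \<otimes> inv g = h" using h c g by (simp add: m_assoc)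
          have "inv (h0 \<otimes> g) \<otimes> (h \<otimes> g) \<in> H" using h(3) l_coset_eq_iff[OF H] c c0 g by simp
          then have "inv g \<otimes> (inv h0 \<otimes> h) \<otimes> g \<in> H" using c c0 g by (simp add: inv_mult_group m_assoc)
          then have "inv h0 \<otimes> h \<in> conj_subgroup G g H"
            using mem_conj_subgroup[OF H g] c c0 by simp
          then show "inv h0 \<otimes> (u \<otimes> inv g) \<in> ?K" unfolding u using c c0 by simp
        qed
      qed
    qed
    have W: "0 \<le> W" using w F(3) by force
    have "norm21 G H (\<lambda>x. f x * of_real (w x)) =
        sqrt (\<Sum>x\<in>(\<lambda>g. g <# H) ` T. (\<Sum>u\<in>?Tx x. cmod (f u * of_real (w u)))\<^sup>2)"
      by (rule norm21_finite[OF H T]) (simp add: f_def split: if_splits)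
    also have "\<dots> \<le> sqrt (W\<^sup>2 * real (card ?K) * real (card F))"
    proof (rule real_sqrt_le_mono)
      have "(\<Sum>x\<in>(\<lambda>g. g <# H) ` T. (\<Sum>u\<in>?Tx x. cmod (f u * of_real (w u)))\<^sup>2)
          \<le> (\<Sum>x\<in>(\<lambda>g. g <# H) ` T. W\<^sup>2 * real (card ?K) * real (card (?Tx x)))"
      proof (rule sum_mono)
        fix x
        have "(\<Sum>u\<in>?Tx x. cmod (f u * of_real (w u))) \<le> (\<Sum>u\<in>?Tx x. W)"
          using w by (intro sum_mono) (auto simp: f_def T_def)
        then have "(\<Sum>u\<in>?Tx x. cmod (f u * of_real (w u)))\<^sup>2 \<le> (real (card (?Tx x)) * W)\<^sup>2"
          by (intro power_mono) (auto intro: sum_nonneg)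
        also have "\<dots> = W\<^sup>2 * (real (card (?Tx x)) * real (card (?Tx x)))"
          by (simp add: power2_eq_square)
        also have "\<dots> \<le> W\<^sup>2 * (real (card ?K) * real (card (?Tx x)))"
          using cTx by (intro mult_left_mono mult_right_mono) auto
        finally show "(\<Sum>u\<in>?Tx x. cmod (f u * of_real (w u)))\<^sup>2 \<le> W\<^sup>2 * real (card ?K) * real (card (?Tx x))"
          by simp
      qed
      also have "\<dots> = W\<^sup>2 * real (card ?K) * real (\<Sum>x\<in>(\<lambda>g. g <# H) ` T. card (?Tx x))"
        by (simp add: sum_distrib_left)
      also have "(\<Sum>x\<in>(\<lambda>g. g <# H) ` T. card (?Tx x)) = card T"
        using sum.image_gen[OF T(1), of "\<lambda>_. 1::nat" "\<lambda>g. g <# H"] by simp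
      also have "card T \<le> card F" unfolding T_def using F(1) by (rule card_image_le)
      finally show "(\<Sum>x\<in>(\<lambda>g. g <# H) ` T. (\<Sum>u\<in>?Tx x. cmod (f u * of_real (w u)))\<^sup>2)
        \<le> W\<^sup>2 * real (card ?K) * real (card F)" by (simp add: mult_left_mono)
    qed
    finally show ?thesis .
  qed
  finally have le: "real (card F) \<le> C * sqrt (W\<^sup>2 * real (card ?K) * real (card F))"
    using C(1) by simp
  have pos: "0 < real (card F)" using F by (simp add: card_gt_0_iff)
  \<comment> \<open>Squaring removes the root: one factor \<open>card F\<close> cancels and
    \<open>W\<close> appears squared.\<close>
  have "(real (card F))\<^sup>2 \<le> (C * sqrt (W\<^sup>2 * real (card ?K) * real (card F)))\<^sup>2"
    using le by (intro power_mono) auto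
  also have "\<dots> = C\<^sup>2 * real (card ?K) * W\<^sup>2 * real (card F)" by (simp add: power_mult_distrib)
  finally show ?thesis using pos by (simp add: power2_eq_square)
qed

text \<open>The \<open>2 ^ n\<close> products of \<open>n\<close> letters \<open>a\<close> and
  \<open>b\<close> lie in \<open>H\<close> and have word length at most \<open>q * n\<close>, so
  \<open>SLC_card_bound\<close> would keep \<open>2 ^ n\<close> below a subexponential function of
  \<open>n\<close>.\<close>

lemma SLC_no_free_pair:
  assumes S: "fin_sym_gen_set G S" and H: "subgroup H G" and slc: "SLC_subexp G S H"
    and g: "g \<in> carrier G" and K: "finite (H \<inter> conj_subgroup G g H)" and ab: "a \<in> H" "b \<in> H"
  shows "\<not> free_pair G a b"
proof
  assume free: "free_pair G a b"
  interpret H: subgroup H G by fact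
  obtain C w where C: "0 < C" and w: "\<forall>g\<in>carrier G. 1 \<le> w g"
    and bound: "\<forall>f\<in>group_algebra G. norm_h G H f \<le> C * norm21 G H (\<lambda>g. f g * of_real (w g))"
    and lim: "((\<lambda>t::real. ln (Sup {w g | g. g \<in> carrier G \<and> real (word_length G S g) \<le> t}) / t) \<longlongrightarrow> 0) at_top"
    using slc unfolding SLC_subexp_def by blast
  define W where "W t = Sup {w g | g. g \<in> carrier G \<and> real (word_length G S g) \<le> t}" for t :: real
  define q where "q = Suc (max (word_length G S a) (word_length G S b))"
  define r where "r = word_length G S g"
  define \<kappa> where "\<kappa> = C\<^sup>2 * real (card (H \<inter> conj_subgroup G g H))"
  have wW: "w u \<le> W (real n)" if "u \<in> carrier G" "word_length G S u \<le> n" for u n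
  proof -
    have "{w g | g. g \<in> carrier G \<and> real (word_length G S g) \<le> real n} = w ` {g \<in> carrier G. word_length G S g \<le> n}"
      by auto
    then have "finite {w g | g. g \<in> carrier G \<and> real (word_length G S g) \<le> real n}"
      using finite_word_ball[OF S] by simp
    then show ?thesis unfolding W_def using that by (intro cSup_upper bdd_above_finite) auto
  qed
  have main: "2 ^ n \<le> \<kappa> * (W (real (q * n + r)))\<^sup>2" for n
  proof -
    let ?L = "{ws. set ws \<subseteq> {a, b} \<and> length ws = n}"
    let ?F = "(\<lambda>ws. foldr (\<otimes>) ws \<one>) ` ?L"
    have fin: "finite ?L" by (rule finite_lists_length_eq) simp
    have "card {a, b} = 2" using free by (simp add: free_pair_def)
    then have "card ?L = 2 ^ n"
      using card_lists_length_eq[of "{a, b}" n] by simp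
    then have cF: "card ?F = 2 ^ n" using free by (simp add: free_pair_def card_image)
    have cl: "foldr (\<otimes>) ws \<one> \<in> H" if "set ws \<subseteq> {a, b}" for ws
      using that ab by (induction ws) auto
    have "real (card ?F) \<le> C\<^sup>2 * real (card (H \<inter> conj_subgroup G g H)) * (W (real (q * n + r)))\<^sup>2"
    proof (rule SLC_card_bound[OF H _ _ _ g K C])
      show "?F \<subseteq> H" using cl by auto
      show "?F \<noteq> {}" using cF by (metis card.empty power_not_zero zero_neq_numeral)
      show "norm_h G H f \<le> C * norm21 G H (\<lambda>x. f x * complex_of_real (w x))" if "f \<in> group_algebra G" for f
        using bound that by blast
      fix h assume "h \<in> ?F"
      then obtain ws where ws: "h = foldr (\<otimes>) ws \<one>" "set ws \<subseteq> {a, b}" "length ws = n" by blast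
      have "word_length G S h \<le> q * n"
        unfolding ws(1) ws(3)[symmetric]
        by (rule word_length_foldr[OF S]) (use ws(2) ab in \<open>auto simp: q_def\<close>)
      moreover have hG: "h \<in> carrier G" using cl ws by auto
      ultimately have "word_length G S (h \<otimes> g) \<le> q * n + r"
        using word_length_mult[OF S hG g] by (simp add: r_def)
      then show "0 \<le> w (h \<otimes> g) \<and> w (h \<otimes> g) \<le> W (real (q * n + r))"
        using wW hG g w by (metis m_closed order.trans zero_le_one)
    qed (use fin in auto)
    then show ?thesis using cF by (simp add: \<kappa>_def)
  qed
  have W1: "1 \<le> W (real (q * n + r))" for n
    using wW[of g "q * n + r"] w g by (fastforce simp: r_def)
  have "\<kappa> \<noteq> 0" using main[of 0] by auto
  moreover have "0 \<le> \<kappa>" by (simp add: \<kappa>_def)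
  ultimately have \<kappa>: "0 < \<kappa>" by simp
  \<comment> \<open>At this rate the square of \<open>W\<close> is at most a constant times
    \<open>2\<close> to the power \<open>n / 2\<close>, which loses against
    \<open>2 ^ n\<close>.\<close>
  define \<epsilon> where "\<epsilon> = ln 2 / (4 * real q)"
  have q: "0 < real q" by (simp add: q_def)
  have \<epsilon>: "0 < \<epsilon>" using q by (simp add: \<epsilon>_def)
  have tn: "filterlim (\<lambda>n. real (q * n + r)) at_top sequentially"
  proof (rule filterlim_at_top_mono[OF filterlim_real_sequentially])
    have "1 \<le> q" by (simp add: q_def)
    then have "n \<le> q * n + r" for n using mult_le_mono1[of 1 q n] by linarith
    then show "\<forall>\<^sub>F n in sequentially. real n \<le> real (q * n + r)"
      by (intro always_eventually allI) (simp only: of_nat_le_iff)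
  qed
  have "\<forall>\<^sub>F t in at_top. \<bar>ln (W t) / t\<bar> < \<epsilon>"
    using tendstoD[OF lim \<epsilon>] unfolding W_def by (simp add: dist_real_def)
  then have "\<forall>\<^sub>F n in sequentially. \<bar>ln (W (real (q * n + r))) / real (q * n + r)\<bar> < \<epsilon>"
    using tn by (rule eventually_compose_filterlim)
  moreover have "\<forall>\<^sub>F n in sequentially. (2 * ln \<kappa> + 4 * \<epsilon> * real r) / ln 2 < real n"
    using filterlim_real_sequentially by (simp add: filterlim_at_top_dense)
  moreover have "\<forall>\<^sub>F n in sequentially. 0 < n" by (rule eventually_gt_at_top)
  ultimately have "\<forall>\<^sub>F n in sequentially. False"
  proof eventually_elim
    case (elim n)
    let ?t = "real (q * n + r)"
    have "0 < q * n" using elim(3) q by simp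
    then have t: "0 < ?t" by (simp only: of_nat_0_less_iff)
    have "ln (W ?t) < \<epsilon> * ?t" using elim(1) t by (simp add: abs_less_iff pos_divide_less_eq)
    moreover have "ln (2 ^ n) \<le> ln (\<kappa> * (W ?t)\<^sup>2)"
      using main[of n] W1[of n] \<kappa> by (subst ln_le_cancel_iff) (auto intro: mult_pos_pos)
    moreover have "ln (\<kappa> * (W ?t)\<^sup>2) = ln \<kappa> + 2 * ln (W ?t)"
      using W1[of n] \<kappa> by (simp add: ln_mult ln_realpow)
    ultimately have "real n * ln 2 < ln \<kappa> + 2 * (\<epsilon> * ?t)" by (simp add: ln_realpow)
    also have "2 * (\<epsilon> * ?t) = real n * ln 2 / 2 + 2 * \<epsilon> * real r"
      using q by (simp add: \<epsilon>_def field_simps)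
    finally have "real n * ln 2 < 2 * ln \<kappa> + 4 * \<epsilon> * real r" by simp
    then show ?case using elim(2) by (simp add: divide_less_eq)
  qed
  then show False by simp
qed

end

section \<open>Virtually nilpotent and virtually cyclic groups\<close>

lemma finite_image_factor:
  assumes "finite (f ` A)" "\<And>x y. x \<in> A \<Longrightarrow> y \<in> A \<Longrightarrow> f x = f y \<Longrightarrow> k x = k y"
  shows "finite (k ` A)"
proof -
  have "k ` A \<subseteq> (\<lambda>z. k (SOME x. x \<in> A \<and> f x = z)) ` f ` A"
  proof
    fix u assume "u \<in> k ` A"
    then obtain x where x: "x \<in> A" "u = k x" by blast
    let ?y = "SOME y. y \<in> A \<and> f y = f x"
    have "?y \<in> A \<and> f ?y = f x" by (rule someI[of _ x]) (use x in simp)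
    then have "k ?y = u" using assms(2) x by metis
    then show "u \<in> (\<lambda>z. k (SOME x. x \<in> A \<and> f x = z)) ` f ` A" using x by blast
  qed
  then show ?thesis using assms(1) finite_subset by blast
qed

context group
begin

lemma inv_mult_cancel:
  assumes "x \<in> carrier G" "y \<in> carrier G"
  shows "inv x \<otimes> (x \<otimes> y) = y" "x \<otimes> (inv x \<otimes> y) = y"
  using assms by (simp_all flip: m_assoc)

lemma conj_hom: "g \<in> carrier G \<Longrightarrow> (\<lambda>x. g \<otimes> x \<otimes> inv g) \<in> hom G G"
  by (auto simp: hom_def m_assoc inv_mult_cancel)

lemma r_coset_eq_iff:
  assumes "subgroup K G" "x \<in> carrier G" "y \<in> carrier G"
  shows "K #> x = K #> y \<longleftrightarrow> x \<otimes> inv y \<in> K"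
proof
  assume "K #> x = K #> y"
  then have "x \<in> K #> y" using rcos_self[OF assms(2,1)] by simp
  then show "x \<otimes> inv y \<in> K" using subgroup.rcos_module_imp[OF assms(1) is_group assms(3)] by simp
next
  assume "x \<otimes> inv y \<in> K"
  then have "x \<in> K #> y" using subgroup.rcos_module_rev[OF assms(1) is_group assms(3,2)] by simp
  then show "K #> x = K #> y" using repr_independence[OF _ assms(3,1)] by simp
qed

lemma lower_central_subset:
  assumes "subgroup K G"
  shows "lower_central (G\<lparr>carrier := K\<rparr>) n \<subseteq> K"
proof -
  interpret K: subgroup K G by fact
  interpret KG: group "G\<lparr>carrier := K\<rparr>" using subgroup_imp_group[OF assms] .
  show ?thesis
  proof (induction n)
    case (Suc n)
    let ?X = "\<Union>x\<in>K. \<Union>y\<in>lower_central (G\<lparr>carrier := K\<rparr>) n.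
      {x \<otimes> y \<otimes> (inv\<^bsub>G\<lparr>carrier := K\<rparr>\<^esub> x) \<otimes> (inv\<^bsub>G\<lparr>carrier := K\<rparr>\<^esub> y)}"
    have "?X \<subseteq> K"
    proof clarify
      fix x y assume "x \<in> K" "y \<in> lower_central (G\<lparr>carrier := K\<rparr>) n"
      then have "x \<in> K" "y \<in> K" using Suc by auto
      then show "x \<otimes> y \<otimes> (inv\<^bsub>G\<lparr>carrier := K\<rparr>\<^esub> x) \<otimes> (inv\<^bsub>G\<lparr>carrier := K\<rparr>\<^esub> y) \<in> K"
        by (simp add: m_inv_consistent[OF assms])
    qed
    then show ?case using KG.generate_incl[of ?X] by simp
  qed simp
qed

text \<open>Conjugation is a homomorphism and the lower central series is monotone in the subgroup;
  one induction treats both.\<close>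

lemma lower_central_conj_subset:
  assumes K: "subgroup K G" and L: "subgroup L G" and g: "g \<in> carrier G"
    and sub: "L \<subseteq> (\<lambda>x. g \<otimes> x \<otimes> inv g) ` K"
  shows "lower_central (G\<lparr>carrier := L\<rparr>) n \<subseteq> (\<lambda>x. g \<otimes> x \<otimes> inv g) ` lower_central (G\<lparr>carrier := K\<rparr>) n"
proof (induction n)
  case (Suc n)
  let ?c = "\<lambda>x. g \<otimes> x \<otimes> inv g"
  let ?lK = "lower_central (G\<lparr>carrier := K\<rparr>) n" and ?lL = "lower_central (G\<lparr>carrier := L\<rparr>) n"
  interpret K: subgroup K G by fact
  interpret L: subgroup L G by fact
  interpret c: group_hom G G ?c by unfold_locales (rule conj_hom[OF g])
  have lK: "?lK \<subseteq> K" and lL: "?lL \<subseteq> L" using lower_central_subset K L by blast+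
  define XK where "XK = (\<Union>x\<in>K. \<Union>y\<in>?lK. {x \<otimes> y \<otimes> inv x \<otimes> inv y})"
  define XL where "XL = (\<Union>x\<in>L. \<Union>y\<in>?lL. {x \<otimes> y \<otimes> inv x \<otimes> inv y})"
  have XK: "XK \<subseteq> K" and XL: "XL \<subseteq> L" using lK lL by (auto simp: XK_def XL_def dest!: subsetD)
  have eqK: "lower_central (G\<lparr>carrier := K\<rparr>) (Suc n) = generate G XK"
  proof -
    have "(\<Union>x\<in>K. \<Union>y\<in>?lK. {x \<otimes> y \<otimes> (inv\<^bsub>G\<lparr>carrier := K\<rparr>\<^esub> x) \<otimes> (inv\<^bsub>G\<lparr>carrier := K\<rparr>\<^esub> y)}) = XK"
      unfolding XK_def using lK by (intro SUP_cong refl) (simp add: m_inv_consistent[OF K] subset_eq)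
    then show ?thesis using generate_consistent[OF XK K] by simp
  qed
  have eqL: "lower_central (G\<lparr>carrier := L\<rparr>) (Suc n) = generate G XL"
  proof -
    have "(\<Union>x\<in>L. \<Union>y\<in>?lL. {x \<otimes> y \<otimes> (inv\<^bsub>G\<lparr>carrier := L\<rparr>\<^esub> x) \<otimes> (inv\<^bsub>G\<lparr>carrier := L\<rparr>\<^esub> y)}) = XL"
      unfolding XL_def using lL by (intro SUP_cong refl) (simp add: m_inv_consistent[OF L] subset_eq)
    then show ?thesis using generate_consistent[OF XL L] by simp
  qed
  have "XL \<subseteq> ?c ` XK"
  proof
    fix z assume "z \<in> XL"
    then obtain x y where xy: "x \<in> L" "y \<in> ?lL" "z = x \<otimes> y \<otimes> inv x \<otimes> inv y" by (auto simp: XL_def)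
    obtain a where a: "a \<in> K" "x = ?c a" using sub xy(1) by blast
    obtain b where b: "b \<in> ?lK" "y = ?c b" using Suc xy(2) by blast
    have ab: "a \<in> carrier G" "b \<in> carrier G" using a b lK by auto
    then have "?c (a \<otimes> b \<otimes> inv a \<otimes> inv b) = ?c a \<otimes> ?c b \<otimes> inv (?c a) \<otimes> inv (?c b)"
      by (simp only: c.hom_mult c.hom_inv m_closed inv_closed)
    then have "z = ?c (a \<otimes> b \<otimes> inv a \<otimes> inv b)" using xy(3) a b by simp
    moreover have "a \<otimes> b \<otimes> inv a \<otimes> inv b \<in> XK" unfolding XK_def using a b by blast
    ultimately show "z \<in> ?c ` XK" by blast
  qed
  then have "generate G XL \<subseteq> generate G (?c ` XK)"
    using XK K.subset g by (intro mono_generate) auto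
  also have "\<dots> = ?c ` generate G XK" using c.generate_img[of XK] XK K.subset by blast
  finally show ?case unfolding eqK eqL .
qed (use sub in simp)

text \<open>\<open>L\<close> consists of the elements of \<open>H\<close> that conjugation carries
  into the nilpotent subgroup \<open>K\<close> of \<open>P\<close>. Its cosets in \<open>H\<close>
  map injectively to cosets of \<open>K\<close> in \<open>P\<close>, which gives finite
  index.\<close>

lemma virtually_nilpotent_conj_subgroup:
  assumes P: "subgroup P G" and H: "subgroup H G" and g: "g \<in> carrier G"
    and sub: "H \<subseteq> conj_subgroup G g P" and vn: "virtually_nilpotent (G\<lparr>carrier := P\<rparr>)"
  shows "virtually_nilpotent (G\<lparr>carrier := H\<rparr>)"
proof -
  interpret P: subgroup P G by fact
  interpret H: subgroup H G by fact
  obtain K n where K: "subgroup K (G\<lparr>carrier := P\<rparr>)" "finite (rcosets\<^bsub>G\<lparr>carrier := P\<rparr>\<^esub> K)"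
    and nil: "lower_central (G\<lparr>carrier := K\<rparr>) n = {\<one>}"
    using vn by (auto simp: virtually_nilpotent_def finite_index_subgroup_def nilpotent_group_def)
  have KG: "subgroup K G" using incl_subgroup[OF P K(1)] .
  interpret K: subgroup K G by fact
  let ?c = "\<lambda>x. inv g \<otimes> x \<otimes> g"
  define L where "L = H \<inter> {x \<in> carrier G. ?c x \<in> K}"
  have c_mult: "?c (x \<otimes> y) = ?c x \<otimes> ?c y" if "x \<in> carrier G" "y \<in> carrier G" for x y
    using that g by (simp add: m_assoc inv_mult_cancel)
  have c_inv: "?c (inv x) = inv (?c x)" if "x \<in> carrier G" for x
    using that g by (simp add: m_assoc inv_mult_group)
  have L: "subgroup L G"
  proof (rule subgroupI)
    have "\<one> \<in> L" using g by (simp add: L_def)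
    then show "L \<noteq> {}" by blast
    show "L \<subseteq> carrier G" by (auto simp: L_def)
    show "inv x \<in> L" if "x \<in> L" for x using that c_inv by (auto simp: L_def)
    show "x \<otimes> y \<in> L" if "x \<in> L" "y \<in> L" for x y using that c_mult by (auto simp: L_def)
  qed
  have LH: "subgroup L (G\<lparr>carrier := H\<rparr>)"
    using subgroup_incl[OF L H] by (auto simp: L_def)
  have cP: "?c h \<in> P" if "h \<in> H" for h
    using that sub mem_conj_subgroup[OF P g, of h] by auto
  have "finite ((\<lambda>h. L #> h) ` H)"
  proof (rule finite_image_factor[of "\<lambda>h. K #> ?c h"])
    have "(\<lambda>h. K #> ?c h) ` H \<subseteq> rcosets\<^bsub>G\<lparr>carrier := P\<rparr>\<^esub> K"
      using cP by (auto simp: RCOSETS_def)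
    then show "finite ((\<lambda>h. K #> ?c h) ` H)" using K(2) finite_subset by blast
    fix x y assume xy: "x \<in> H" "y \<in> H" and eq: "K #> ?c x = K #> ?c y"
    have c: "x \<in> carrier G" "y \<in> carrier G" using xy by auto
    have "?c x \<otimes> inv (?c y) \<in> K" using eq r_coset_eq_iff[OF KG] c g by simp
    then have "?c (x \<otimes> inv y) \<in> K" using c_mult[of x "inv y"] c_inv[of y] c by simp
    then have "x \<otimes> inv y \<in> L" using xy c by (simp add: L_def)
    then show "L #> x = L #> y" using r_coset_eq_iff[OF L] c by simp
  qed
  moreover have "rcosets\<^bsub>G\<lparr>carrier := H\<rparr>\<^esub> L = (\<lambda>h. L #> h) ` H"
    by (auto simp: RCOSETS_def)
  ultimately have fi: "finite_index_subgroup L (G\<lparr>carrier := H\<rparr>)"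
    using LH by (simp add: finite_index_subgroup_def)
  have "L \<subseteq> (\<lambda>x. g \<otimes> x \<otimes> inv g) ` K"
  proof
    fix x assume x: "x \<in> L"
    then have "x \<in> carrier G" "?c x \<in> K" by (auto simp: L_def)
    moreover have "x = g \<otimes> ?c x \<otimes> inv g"
      using \<open>x \<in> carrier G\<close> g by (simp add: m_assoc[symmetric]) (simp add: m_assoc)
    ultimately show "x \<in> (\<lambda>x. g \<otimes> x \<otimes> inv g) ` K" by blast
  qed
  then have "lower_central (G\<lparr>carrier := L\<rparr>) n \<subseteq> {\<one>}"
    using lower_central_conj_subset[OF KG L g, of n] nil g by auto
  moreover have "\<one> \<in> lower_central (G\<lparr>carrier := L\<rparr>) n"
    using subgroup.one_closed[OF L] generate.one[of "G\<lparr>carrier := L\<rparr>"] by (cases n) simp_all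
  ultimately have "lower_central (G\<lparr>carrier := L\<rparr>) n = {\<one>}" by blast
  then have "nilpotent_group (G\<lparr>carrier := L\<rparr>)" by (auto simp: nilpotent_group_def)
  then show ?thesis using fi by (auto simp: virtually_nilpotent_def)
qed

lemma finite_virtually_cyclic:
  assumes H: "subgroup H G" "finite H"
  shows "virtually_cyclic (G\<lparr>carrier := H\<rparr>)"
proof -
  interpret HG: group "G\<lparr>carrier := H\<rparr>" using subgroup_imp_group[OF H(1)] .
  have "finite_index_subgroup {\<one>} (G\<lparr>carrier := H\<rparr>)"
    using HG.triv_subgroup H(2) by (simp add: finite_index_subgroup_def RCOSETS_def)
  moreover have "trivial_group (G\<lparr>carrier := {\<one>}\<rparr>)"
    using subgroup_imp_group[OF triv_subgroup] by (simp add: trivial_group_def)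
  ultimately show ?thesis
    using trivial_imp_cyclic_group by (auto simp: virtually_cyclic_def)
qed

lemma virtually_cyclic_transversal:
  assumes H: "subgroup H G" "g \<in> H"
    and F: "finite F" "F \<subseteq> H" "\<And>h. h \<in> H \<Longrightarrow> \<exists>i::int. \<exists>f\<in>F. h = g [^] i \<otimes> f"
  shows "virtually_cyclic (G\<lparr>carrier := H\<rparr>)"
proof -
  interpret H: subgroup H G by fact
  have g: "g \<in> carrier G" using H by auto
  let ?K = "range (\<lambda>i::int. g [^] i)"
  have KH: "?K \<subseteq> H" using subgroup_int_pow_closed[OF H] by auto
  have K: "subgroup ?K G"
  proof (rule subgroupI)
    show "?K \<subseteq> carrier G" using g by auto
    fix x assume "x \<in> ?K"
    then obtain i :: int where i: "x = g [^] i" by blast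
    then have "inv x = g [^] (- i)" using int_pow_neg[OF g] by simp
    then show "inv x \<in> ?K" by (rule range_eqI)
    fix y assume "y \<in> ?K"
    then obtain j :: int where "y = g [^] j" by blast
    then have "x \<otimes> y = g [^] (i + j)" using i int_pow_mult[OF g] by simp
    then show "x \<otimes> y \<in> ?K" by (rule range_eqI)
  qed simp
  have "rcosets\<^bsub>G\<lparr>carrier := H\<rparr>\<^esub> ?K \<subseteq> (\<lambda>f. ?K #> f) ` F"
  proof
    fix X assume "X \<in> rcosets\<^bsub>G\<lparr>carrier := H\<rparr>\<^esub> ?K"
    then obtain h where h: "h \<in> H" "X = ?K #> h" by (auto simp: RCOSETS_def)
    then obtain i :: int and f where f: "f \<in> F" "h = g [^] i \<otimes> f" using F(3)[OF h(1)] by blast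
    have fG: "f \<in> carrier G" "h \<in> carrier G" using f F(2) h by auto
    then have "h \<otimes> inv f = g [^] i" using f(2) g by (simp add: m_assoc)
    then have "?K #> h = ?K #> f" using r_coset_eq_iff[OF K fG(2,1)] by simp
    then show "X \<in> (\<lambda>f. ?K #> f) ` F" using f(1) h(2) by blast
  qed
  then have "finite (rcosets\<^bsub>G\<lparr>carrier := H\<rparr>\<^esub> ?K)" using F(1) finite_surj by blast
  then have fi: "finite_index_subgroup ?K (G\<lparr>carrier := H\<rparr>)"
    using subgroup_incl[OF K H(1) KH] by (simp add: finite_index_subgroup_def)
  interpret KG: group "G\<lparr>carrier := ?K\<rparr>" using subgroup_imp_group[OF K] .
  have gK: "g \<in> ?K" using g by (intro range_eqI[of _ _ 1]) (simp add: int_pow_1)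
  have "g [^]\<^bsub>G\<lparr>carrier := ?K\<rparr>\<^esub> i = g [^] i" for i :: int
    by (rule int_pow_consistent[OF K gK, symmetric])
  then have "cyclic_group (G\<lparr>carrier := ?K\<rparr>)"
    unfolding KG.cyclic_group using gK by (intro bexI[of _ g]) simp_all
  then show ?thesis using fi by (auto simp: virtually_cyclic_def)
qed

end

section \<open>The classification\<close>

lemma bowditch_graph_subgroup:
  assumes G: "group G" and bg: "bowditch_graph G m P V E \<phi>"
    and H: "subgroup H G" "infinite H" and nf: "\<forall>a\<in>H. \<forall>b\<in>H. \<not> free_pair G a b"
  shows "parabolic G m P H \<or> virtually_cyclic (G\<lparr>carrier := H\<rparr>)"
proof -
  interpret grp: group G by fact
  interpret H: subgroup H G by fact
  interpret connected_graph V E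
    by unfold_locales (use bg in \<open>simp_all add: bowditch_graph_def\<close>)
  interpret act: group_action G V \<phi> using bg by (simp add: bowditch_graph_def)
  interpret fine_graph_action V E G \<phi>
    by unfold_locales (use bg in \<open>simp_all add: bowditch_graph_def\<close>)
  obtain \<delta> :: real where \<delta>: "\<forall>x\<in>V. \<forall>y\<in>V. \<forall>z\<in>V. \<forall>u\<in>V. real (d x y + d z u) \<le>
       max (real (d x z + d y u)) (real (d x u + d y z)) + 2 * \<delta>"
    using bg unfolding bowditch_graph_def graph_hyperbolic_def by blast
  \<comment> \<open>Rounding up keeps later estimates in the integers; the successor makes the
    constant positive, which turns weak gains into strict ones.\<close>
  define \<Delta> where "\<Delta> = Suc (nat \<lceil>2 * \<delta>\<rceil>)"
  have \<Delta>: "2 * \<delta> \<le> real \<Delta>" unfolding \<Delta>_def by linarith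
  interpret hyperbolic_graph_action V E G \<phi> \<Delta>
  proof unfold_locales
    fix x y z u assume "x \<in> V" "y \<in> V" "z \<in> V" "u \<in> V"
    then have "real (d x y + d z u) \<le> max (real (d x z + d y u)) (real (d x u + d y z)) + 2 * \<delta>"
      using \<delta> by blast
    then have "real (d x y + d z u) \<le> real (max (d x z + d y u) (d x u + d y z) + \<Delta>)"
      using \<Delta> by (simp add: max_def split: if_splits)
    then show "d x y + d z u \<le> max (d x z + d y u) (d x u + d y z) + \<Delta>" by (simp only: of_nat_le_iff)
  qed (simp add: \<Delta>_def)
  show ?thesis
  proof (cases "\<exists>g\<in>H. \<exists>x\<in>V. loxodromic_at g x")
    case True
    then obtain g p where gp: "g \<in> H" "p \<in> V" "loxodromic_at g p" by blast
    interpret loxodromic_axis V E G \<phi> \<Delta> g p by unfold_locales (use gp in auto)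
    obtain F where "finite F" "F \<subseteq> H" "\<forall>h\<in>H. \<exists>i::int. \<exists>f\<in>F. h = g [^]\<^bsub>G\<^esub> i \<otimes>\<^bsub>G\<^esub> f"
      using no_free_pair_finite_transversal[OF H(1) gp(1) nf] by blast
    then show ?thesis using grp.virtually_cyclic_transversal[OF H(1) gp(1)] by blast
  next
    case False
    have "V \<noteq> {}" using connected by (simp add: graph_connected_def)
    then obtain x D where x: "x \<in> V" "\<forall>h\<in>H. d x (\<phi> h x) \<le> D"
      using no_loxodromic_bounded_orbit[OF H] False by blast
    then obtain v where v: "v \<in> V" "\<forall>h\<in>H. \<phi> h v = v"
      using bounded_orbit_fixed_vertex[OF H x(1), of D] by blast
    then have sub: "H \<subseteq> stabilizer G \<phi> v" by (auto simp: stabilizer_def)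
    \<comment> \<open>Only infinite vertex stabilizers are known to be conjugate to some
      \<open>P i\<close>.\<close>
    then have "infinite (stabilizer G \<phi> v)" using H(2) finite_subset by blast
    then have "\<exists>i\<in>{1..m}. \<exists>g\<in>carrier G. stabilizer G \<phi> v = conj_subgroup G g (P i)"
      using bg v(1) unfolding bowditch_graph_def by blast
    then show ?thesis using sub by (auto simp: parabolic_def)
  qed
qed

theorem proposition3p38:
  fixes G :: "('a, 'b) monoid_scheme"
    and S H :: "'a set" and m :: nat and P :: "nat \<Rightarrow> 'a set"
  assumes "group G" and "fin_gen_group G"
    and "\<forall>i\<in>{1..m}. subgroup (P i) G"
    and "relatively_hyperbolic G m P"
    and "subgroup H G" and "fin_gen_group (G\<lparr>carrier := H\<rparr>)"
    and "fin_sym_gen_set G S"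
    and "SLC_subexp G S H"
  shows "(s_normal G H \<or> parabolic G m P H \<or> virtually_cyclic (G\<lparr>carrier := H\<rparr>)) \<and>
    ((\<forall>i\<in>{1..m}. virtually_nilpotent (G\<lparr>carrier := P i\<rparr>)) \<longrightarrow> parabolic G m P H \<longrightarrow>
      virtually_nilpotent (G\<lparr>carrier := H\<rparr>))"
proof -
  interpret group G by fact
  interpret H: subgroup H G by fact
  have "parabolic G m P H \<or> virtually_cyclic (G\<lparr>carrier := H\<rparr>)" if ns: "\<not> s_normal G H" and inf: "infinite H"
  proof -
    obtain g where g: "g \<in> carrier G" "finite (H \<inter> conj_subgroup G g H)"
      using ns inf assms(5) by (auto simp: s_normal_def)
    have "\<forall>a\<in>H. \<forall>b\<in>H. \<not> free_pair G a b"
      using SLC_no_free_pair[OF assms(7,5,8) g] by blast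
    moreover obtain V :: "nat set" and E \<phi> where "bowditch_graph G m P V E \<phi>"
      using assms(4) unfolding relatively_hyperbolic_def by blast
    ultimately show ?thesis using bowditch_graph_subgroup[OF assms(1) _ assms(5) inf] by blast
  qed
  \<comment> \<open>A finite \<open>H\<close> is never \<open>s_normal\<close>; it falls under the
    virtually cyclic alternative.\<close>
  then have "s_normal G H \<or> parabolic G m P H \<or> virtually_cyclic (G\<lparr>carrier := H\<rparr>)"
    using finite_virtually_cyclic[OF assms(5)] by blast
  moreover have "virtually_nilpotent (G\<lparr>carrier := H\<rparr>)"
    if vn: "\<forall>i\<in>{1..m}. virtually_nilpotent (G\<lparr>carrier := P i\<rparr>)" and par: "parabolic G m P H"
  proof -
    obtain i g where "i \<in> {1..m}" "g \<in> carrier G" "H \<subseteq> conj_subgroup G g (P i)"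
      using par by (auto simp: parabolic_def)
    then show ?thesis
      using virtually_nilpotent_conj_subgroup[OF _ assms(5)] assms(3) vn by blast
  qed
  ultimately show ?thesis by blast
qed

end
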